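(* Let $A$ be a densely defined strongly positive operator in a Banach space $X$ with spectral characteristics $\rho_0,\varphi$, let $u_0\in D(A^{\alpha})$ with $\alpha\in(0,1)$, and let $w\in C[0,T]$, $w\ge0$, satisfy $$\|w\|_{C[0,T]}\le \frac1T .$$ Let $u_n(t)$ and its Sinc-quadrature approximation $u_{n,N}(t)$ with step size $h$ be as defined in the context. Then $u_{n,N}(t)$ approximates $u_n(t)$ as follows. (i) Let $h=\sqrt{\dfrac{\pi d_1}{\alpha(N+1)}}$. For arbitrarily small $\delta>0$, with $d=d_1-\delta$, there is a constant $c$ independent of $h$, $N$ and $t$ such that, uniformly in $t\ge0$, $$\|u_n(t)-u_{n,N}(t)\|\le \frac{c}{\alpha}\exp\left(-\sqrt{\pi d\,\alpha (N+1)}\right)\|A^{\alpha}u_0\| .$$ (ii) Let $h=c_1\ln N/N$ with some positive constant $c_1$. Then for each fixed $t>0$ there is a constant $c$ independent of $N$ such that $$\|u_n(t)-u_{n,N}(t)\|\le c\left[e^{-\pi d_1N/(c_1\ln N)}+e^{-c_1ta_IN/2-c_1\alpha\ln N}\right]\|A^{\alpha}u_0\| .$$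
   Context: $X$ is a complex Banach space and $T>0$. A densely defined operator $A$ with domain $D(A)\subset X$ is called strongly positive (sectorial) with spectral characteristics $\rho_0>0$ and $\varphi\in(0,\pi/2)$ if its spectrum lies in the sector $$\Sigma=\{z=\rho_0+re^{i\theta}:\ r\in[0,\infty),\ |\theta|<\varphi\}$$ and, for some constant $M$, $\|(zI-A)^{-1}\|\le \frac{M}{1+|z|}$ for all $z$ outside $\Sigma$ and on its boundary. $A^\alpha$ denotes the fractional power of $A$, and $\|w\|_{C[0,T]}=\max_{s\in[0,T]}|w(s)|$. Put $b_0=\rho_0\tan\varphi$, fix a number $\rho_1$ with $0\le\rho_1<\rho_0$, and define $$d_1=\arccos\left(\frac{\rho_1}{\sqrt{\rho_0^2+b_0^2}}\right)-\varphi,$$ $$a_I=\sqrt{\rho_0^2+b_0^2}\,\cos\left(\frac{d_1}{2}+\varphi\right),\qquad b_I=\sqrt{\rho_0^2+b_0^2}\,\sin\left(\frac{d_1}{2}+\varphi\right),$$ $$z(\zeta)=a_I\cosh\zeta-i\,b_I\sinh\zeta,\qquad z'(\zeta)=a_I\sinh\zeta-i\,b_I\cosh\zeta,\qquad \zeta\in(-\infty,\infty).$$ For a fixed $n$, let $\theta_0,\dots,\theta_n$ be the roots of the Legendre polynomial $P_{n+1}$, let $\omega_0,\dots,\omega_n$ be the corresponding Gauss quadrature weights on $[-1,1]$, and let $\xi_j=\frac T2(\theta_j+1)$. Define $$I_n(\zeta)=\sum_{j=0}^n\frac T2\,\omega_j\,w(\xi_j)\,e^{-z(\zeta)\xi_j}$$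 (the Gauss approximation of $\int_0^Tw(s)e^{-z(\zeta)s}ds$), $$\mathcal F_n(t,\zeta)=\frac1{2\pi i}\,e^{-z(\zeta)t}\,[1+I_n(\zeta)]^{-1}\left[(z(\zeta)I-A)^{-1}-\frac1{z(\zeta)}I\right]z'(\zeta)\,u_0,$$ $$u_n(t)=\int_{-\infty}^{\infty}\mathcal F_n(t,\zeta)\,d\zeta,\qquad u_{n,N}(t)=h\sum_{k=-N}^{N}\mathcal F_n(t,kh).$$ The function $u_n$ is an approximation of the solution of the nonlocal problem $\frac{du}{dt}+Au=0$, $t\in[0,T]$, $u(0)+\int_0^Tw(s)u(s)ds=u_0$. *)

theory Defs
  imports "HOL-Analysis.Analysis" "HOL-Computational_Algebra.Polynomial"
begin

text \<open>The real structure inherited from \<^class>\<open>banach\<close> is the restriction of the complex one.\<close>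

class complex_banach = banach +
  fixes scaleC :: "complex \<Rightarrow> 'a \<Rightarrow> 'a" (infixr "*\<^sub>C" 75)
  assumes scaleC_add_right: "c *\<^sub>C (x + y) = c *\<^sub>C x + c *\<^sub>C y"
    and scaleC_add_left: "(c + d) *\<^sub>C x = c *\<^sub>C x + d *\<^sub>C x"
    and scaleC_scaleC: "c *\<^sub>C d *\<^sub>C x = (c * d) *\<^sub>C x"
    and scaleC_of_real: "complex_of_real r *\<^sub>C x = r *\<^sub>R x"
    and norm_scaleC: "norm (c *\<^sub>C x) = cmod c * norm x"

instantiation complex :: complex_banach
begin

definition scaleC_complex :: "complex \<Rightarrow> complex \<Rightarrow> complex" where
  "scaleC_complex c x = c * x"

instance
  by standard (simp_all add: scaleC_complex_def algebra_simps norm_mult scaleR_conv_of_real)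

end

text \<open>An unbounded operator is a pair of a domain \<open>D\<close> and a function \<open>A\<close>
  whose values outside \<open>D\<close> are never used.\<close>

definition linear_operator :: "'a::complex_banach set \<Rightarrow> ('a \<Rightarrow> 'a) \<Rightarrow> bool" where
  "linear_operator D A \<longleftrightarrow> 0 \<in> D \<and>
     (\<forall>x\<in>D. \<forall>y\<in>D. x + y \<in> D \<and> A (x + y) = A x + A y) \<and>
     (\<forall>c. \<forall>x\<in>D. c *\<^sub>C x \<in> D \<and> A (c *\<^sub>C x) = c *\<^sub>C A x)"

definition densely_defined :: "'a::complex_banach set \<Rightarrow> bool" where
  "densely_defined D \<longleftrightarrow> closure D = UNIV"

text \<open>\<open>resolvent D A z\<close> is $(zI - A)^{-1}$, with this sign.\<close>

definition resolvent ::
    "'a::complex_banach set \<Rightarrow> ('a \<Rightarrow> 'a) \<Rightarrow> complex \<Rightarrow> 'a \<Rightarrow> 'a" where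
  "resolvent D A z = inv_into D (\<lambda>x. z *\<^sub>C x - A x)"

definition resolvent_set :: "'a::complex_banach set \<Rightarrow> ('a \<Rightarrow> 'a) \<Rightarrow> complex set" where
  "resolvent_set D A =
     {z. bij_betw (\<lambda>x. z *\<^sub>C x - A x) D UNIV \<and> bounded_linear (resolvent D A z)}"

definition spectrum :: "'a::complex_banach set \<Rightarrow> ('a \<Rightarrow> 'a) \<Rightarrow> complex set" where
  "spectrum D A = - resolvent_set D A"

definition sector :: "real \<Rightarrow> real \<Rightarrow> complex set" where
  "sector \<rho>\<^sub>0 \<phi> = {of_real \<rho>\<^sub>0 + of_real r * cis \<theta> | r \<theta>. 0 \<le> r \<and> \<bar>\<theta>\<bar> < \<phi>}"

text \<open>The vertex \<open>\<rho>\<^sub>0\<close> belongs both to the sector and to its frontier, so membership in the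
  resolvent set is not implied there by the inclusion of the spectrum in the sector; it is part
  of the norm estimate.\<close>

definition strongly_positive ::
    "'a::complex_banach set \<Rightarrow> ('a \<Rightarrow> 'a) \<Rightarrow> real \<Rightarrow> real \<Rightarrow> bool" where
  "strongly_positive D A \<rho>\<^sub>0 \<phi> \<longleftrightarrow>
     0 < \<rho>\<^sub>0 \<and> 0 < \<phi> \<and> \<phi> < pi / 2 \<and>
     linear_operator D A \<and> densely_defined D \<and>
     spectrum D A \<subseteq> sector \<rho>\<^sub>0 \<phi> \<and>
     (\<exists>M. \<forall>z \<in> - sector \<rho>\<^sub>0 \<phi> \<union> frontier (sector \<rho>\<^sub>0 \<phi>).
        z \<in> resolvent_set D A \<and> onorm (resolvent D A z) \<le> M / (1 + cmod z))"

text \<open>Fractional powers for $0 < \alpha < 1$ by Balakrishnan's formula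
  $A^{-\alpha} = \frac{\sin \pi\alpha}{\pi} \int_0^\infty \lambda^{-\alpha} (\lambda I + A)^{-1} d\lambda$
  and $A^\alpha = (A^{-\alpha})^{-1}$ on the range of $A^{-\alpha}$. Note that
  $(\lambda I + A)^{-1} = - (-\lambda I - A)^{-1}$.\<close>

definition neg_frac_power ::
    "'a::complex_banach set \<Rightarrow> ('a \<Rightarrow> 'a) \<Rightarrow> real \<Rightarrow> 'a \<Rightarrow> 'a" where
  "neg_frac_power D A \<alpha> x = (sin (pi * \<alpha>) / pi) *\<^sub>R
     integral {0<..} (\<lambda>l. (l powr (- \<alpha>)) *\<^sub>R (- resolvent D A (- of_real l) x))"

definition frac_power_dom ::
    "'a::complex_banach set \<Rightarrow> ('a \<Rightarrow> 'a) \<Rightarrow> real \<Rightarrow> 'a set" where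
  "frac_power_dom D A \<alpha> = range (neg_frac_power D A \<alpha>)"

definition frac_power ::
    "'a::complex_banach set \<Rightarrow> ('a \<Rightarrow> 'a) \<Rightarrow> real \<Rightarrow> 'a \<Rightarrow> 'a" where
  "frac_power D A \<alpha> = inv (neg_frac_power D A \<alpha>)"

definition C_norm :: "real \<Rightarrow> (real \<Rightarrow> real) \<Rightarrow> real" where
  "C_norm T w = (SUP s\<in>{0..T}. \<bar>w s\<bar>)"

text \<open>Rodrigues' formula for the Legendre polynomials.\<close>

definition legendre :: "nat \<Rightarrow> real poly" where
  "legendre m = smult (1 / (2 ^ m * fact m)) ((pderiv ^^ m) ([:-1, 0, 1:] ^ m))"

definition gauss_node :: "nat \<Rightarrow> nat \<Rightarrow> real" where
  "gauss_node n j = sorted_list_of_set {x. poly (legendre (Suc n)) x = 0} ! j"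

text \<open>The weight at a node is the integral of the corresponding Lagrange basis polynomial.\<close>

definition gauss_weight :: "nat \<Rightarrow> nat \<Rightarrow> real" where
  "gauss_weight n j = integral {-1..1} (\<lambda>x. \<Prod>i\<in>{..n} - {j}.
     (x - gauss_node n i) / (gauss_node n j - gauss_node n i))"

definition scaled_node :: "real \<Rightarrow> nat \<Rightarrow> nat \<Rightarrow> real" where
  "scaled_node T n j = T / 2 * (gauss_node n j + 1)"

definition b0 :: "real \<Rightarrow> real \<Rightarrow> real" where
  "b0 \<rho>\<^sub>0 \<phi> = \<rho>\<^sub>0 * tan \<phi>"

definition d1 :: "real \<Rightarrow> real \<Rightarrow> real \<Rightarrow> real" where
  "d1 \<rho>\<^sub>0 \<phi> \<rho>\<^sub>1 = arccos (\<rho>\<^sub>1 / sqrt (\<rho>\<^sub>0\<^sup>2 + (b0 \<rho>\<^sub>0 \<phi>)\<^sup>2)) - \<phi>"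

definition aI :: "real \<Rightarrow> real \<Rightarrow> real \<Rightarrow> real" where
  "aI \<rho>\<^sub>0 \<phi> \<rho>\<^sub>1 = sqrt (\<rho>\<^sub>0\<^sup>2 + (b0 \<rho>\<^sub>0 \<phi>)\<^sup>2) * cos (d1 \<rho>\<^sub>0 \<phi> \<rho>\<^sub>1 / 2 + \<phi>)"

definition bI :: "real \<Rightarrow> real \<Rightarrow> real \<Rightarrow> real" where
  "bI \<rho>\<^sub>0 \<phi> \<rho>\<^sub>1 = sqrt (\<rho>\<^sub>0\<^sup>2 + (b0 \<rho>\<^sub>0 \<phi>)\<^sup>2) * sin (d1 \<rho>\<^sub>0 \<phi> \<rho>\<^sub>1 / 2 + \<phi>)"

definition zpath :: "real \<Rightarrow> real \<Rightarrow> real \<Rightarrow> real \<Rightarrow> complex" where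
  "zpath \<rho>\<^sub>0 \<phi> \<rho>\<^sub>1 \<zeta> =
     of_real (aI \<rho>\<^sub>0 \<phi> \<rho>\<^sub>1 * cosh \<zeta>) - \<i> * of_real (bI \<rho>\<^sub>0 \<phi> \<rho>\<^sub>1 * sinh \<zeta>)"

definition zpath' :: "real \<Rightarrow> real \<Rightarrow> real \<Rightarrow> real \<Rightarrow> complex" where
  "zpath' \<rho>\<^sub>0 \<phi> \<rho>\<^sub>1 \<zeta> =
     of_real (aI \<rho>\<^sub>0 \<phi> \<rho>\<^sub>1 * sinh \<zeta>) - \<i> * of_real (bI \<rho>\<^sub>0 \<phi> \<rho>\<^sub>1 * cosh \<zeta>)"

definition I_n ::
    "real \<Rightarrow> real \<Rightarrow> real \<Rightarrow> real \<Rightarrow> (real \<Rightarrow> real) \<Rightarrow> nat \<Rightarrow> real \<Rightarrow> complex" where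
  "I_n \<rho>\<^sub>0 \<phi> \<rho>\<^sub>1 T w n \<zeta> =
     (\<Sum>j=0..n. of_real (T / 2 * gauss_weight n j * w (scaled_node T n j)) *
        exp (- zpath \<rho>\<^sub>0 \<phi> \<rho>\<^sub>1 \<zeta> * of_real (scaled_node T n j)))"

definition F_n ::
    "'a::complex_banach set \<Rightarrow> ('a \<Rightarrow> 'a) \<Rightarrow> real \<Rightarrow> real \<Rightarrow> real \<Rightarrow> real \<Rightarrow> (real \<Rightarrow> real) \<Rightarrow>
     nat \<Rightarrow> 'a \<Rightarrow> real \<Rightarrow> real \<Rightarrow> 'a" where
  "F_n D A \<rho>\<^sub>0 \<phi> \<rho>\<^sub>1 T w n u0 t \<zeta> =
     (let z = zpath \<rho>\<^sub>0 \<phi> \<rho>\<^sub>1 \<zeta> in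
      (1 / (2 * of_real pi * \<i>) * exp (- z * of_real t) *
         inverse (1 + I_n \<rho>\<^sub>0 \<phi> \<rho>\<^sub>1 T w n \<zeta>) * zpath' \<rho>\<^sub>0 \<phi> \<rho>\<^sub>1 \<zeta>) *\<^sub>C
      (resolvent D A z u0 - (1 / z) *\<^sub>C u0))"

definition u_n ::
    "'a::complex_banach set \<Rightarrow> ('a \<Rightarrow> 'a) \<Rightarrow> real \<Rightarrow> real \<Rightarrow> real \<Rightarrow> real \<Rightarrow> (real \<Rightarrow> real) \<Rightarrow>
     nat \<Rightarrow> 'a \<Rightarrow> real \<Rightarrow> 'a" where
  "u_n D A \<rho>\<^sub>0 \<phi> \<rho>\<^sub>1 T w n u0 t = integral UNIV (F_n D A \<rho>\<^sub>0 \<phi> \<rho>\<^sub>1 T w n u0 t)"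

definition u_nN ::
    "'a::complex_banach set \<Rightarrow> ('a \<Rightarrow> 'a) \<Rightarrow> real \<Rightarrow> real \<Rightarrow> real \<Rightarrow> real \<Rightarrow> (real \<Rightarrow> real) \<Rightarrow>
     nat \<Rightarrow> 'a \<Rightarrow> real \<Rightarrow> nat \<Rightarrow> real \<Rightarrow> 'a" where
  "u_nN D A \<rho>\<^sub>0 \<phi> \<rho>\<^sub>1 T w n u0 h N t =
     h *\<^sub>R (\<Sum>k=- int N..int N. F_n D A \<rho>\<^sub>0 \<phi> \<rho>\<^sub>1 T w n u0 t (of_int k * h))"

end

theory Submission
  imports Defs "HOL-Complex_Analysis.Complex_Analysis"
begin

text \<open>
Put \<open>R = sqrt (\<rho>\<^sub>0\<^sup>2 + b\<^sub>0\<^sup>2) = \<rho>\<^sub>0 / cos \<phi>\<close> and \<open>\<beta> = \<phi> + d\<^sub>1 / 2\<close>. Then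
\<open>z(\<zeta>) = R cos (\<beta> + \<i> \<zeta>)\<close>, and this formula makes sense for complex \<open>\<zeta>\<close>: the line
\<open>Im \<zeta> = y\<close> is mapped to the branch of a hyperbola whose angle parameter is \<open>\<beta> - y\<close>, so the strip
\<open>\<bar>Im \<zeta>\<bar> < d\<^sub>1 / 2\<close> fills the region between the branch through \<open>\<rho>\<^sub>0\<close>, which just avoids the
sector \<open>\<Sigma>\<close>, and the branch through \<open>\<rho>\<^sub>1\<close>. On this region three facts hold. The resolvent is
bounded by \<open>M / (1 + \<bar>z\<bar>)\<close>. The Gauss weights are nonnegative with sum 2 and the nodes are interior
to the interval, so the hypothesis on \<open>w\<close> gives \<open>\<bar>I\<^sub>n\<bar> < 1\<close> wherever \<open>Re z > 0\<close>
(\<open>gauss_weight_nonneg\<close>, \<open>norm_S_less_1\<close>). Balakrishnan's formula and the resolvent identity give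
\<open>\<parallel>(z - A)\<^sup>-\<^sup>1 u\<^sub>0 - u\<^sub>0 / z\<parallel> \<le> C \<bar>z\<bar> powr (-1 - \<alpha>) \<parallel>A\<^sup>\<alpha> u\<^sub>0\<parallel>\<close> (\<open>neg_frac_power_bounds\<close>). Hence the
integrand is holomorphic on the strip and decays like \<open>exp (- \<alpha> \<bar>Re \<zeta>\<bar>)\<close>
(\<open>norm_integrand_strip_le\<close>).

For such functions the residue theorem, applied to \<open>F(\<zeta>) / (exp (2 \<pi> \<i> \<zeta> / h) - 1)\<close> on long rectangles,
turns the error of the infinite trapezoidal sum into two integrals along \<open>Im \<zeta> = \<plusminus> d\<close> which carry the
factor \<open>1 / (exp (2 \<pi> d / h) - 1)\<close>; cutting the sum at \<open>N\<close> costs a geometric tail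
(\<open>sinc_quadrature_error\<close>). In (i) the line may stay inside the strip, and inserting \<open>h\<close> balances the
two contributions.

In (ii) the rate belongs to the full strip, so the bounds must survive \<open>d \<rightarrow> d\<^sub>1 / 2\<close>. This is immediate
on the upper line, and on the lower one if \<open>\<rho>\<^sub>1 > 0\<close>. If \<open>\<rho>\<^sub>1 = 0\<close>, the lower boundary is the imaginary
axis, where \<open>f = 1 / (1 + I\<^sub>n)\<close> can have infinitely many poles and where the pole \<open>z = 0\<close> also lies; the
absolute value of the integrand is then not uniformly integrable. The lower line is moved to
\<open>Re z = \<epsilon>\<close>, and there
\<open>f(z) = [f(z) + f(2 \<epsilon> - z) - 2 f(\<epsilon>)] + [2 f(\<epsilon>) - f(2 \<epsilon> - z)]\<close>.
On that line \<open>f(2 \<epsilon> - z)\<close> is the conjugate of \<open>f(z)\<close>, so the first bracket is \<open>2 Re f\<close> up to a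
constant. Since \<open>\<bar>I\<^sub>n\<bar> < 1\<close> makes \<open>Re f\<close> positive, Harnack's inequality bounds its integral over every
segment of length 2, uniformly in \<open>\<epsilon>\<close> (\<open>half_plane_harnack\<close>). The second bracket is bounded on
\<open>Re z \<le> 0\<close> away from the axis, so its contour can be pushed to the left, at the price of a single
residue at 0; the kernel does not grow in that direction (\<open>boundary_line_bound\<close>).

All contour integrals are scalar: a vector-valued error is tested with a functional that attains its
norm (\<open>norming_functional\<close>, \<open>operator_error\<close>).
\<close>

section \<open>Norming functionals\<close>

definition sublinear :: "('a::real_normed_vector \<Rightarrow> real) \<Rightarrow> bool" where
  "sublinear p \<longleftrightarrow> (\<forall>x y. p (x + y) \<le> p x + p y) \<and> (\<forall>c x. 0 < c \<longrightarrow> p (c *\<^sub>R x) = c * p x)"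

lemma sublinear_zero: "sublinear p \<Longrightarrow> p 0 = 0"
  unfolding sublinear_def by (metis add.right_neutral less_numeral_extra(1) mult_2 mult_cancel_right1 scaleR_zero_right numeral_eq_one_iff semiring_norm(85) zero_less_numeral add_cancel_right_right)

text \<open>The largest function below \<open>p\<close> that changes by \<open>p y\<close> in the direction \<open>y\<close>. It is again sublinear,
so a minimal sublinear function equals all its tilts, and this forces additivity.\<close>

definition tilt :: "('a::real_normed_vector \<Rightarrow> real) \<Rightarrow> 'a \<Rightarrow> 'a \<Rightarrow> real" where
  "tilt p y x = (INF s\<in>{0..}. p (x + s *\<^sub>R y) - s * p y)"

lemma tilt_bdd:
  assumes "sublinear p" shows "bdd_below ((\<lambda>s. p (x + s *\<^sub>R y) - s * p y) ` {0..})"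
proof (rule bdd_belowI2)
  fix s :: real assume s: "s \<in> {0..}"
  have "p (s *\<^sub>R y) = s * p y"
    using assms s sublinear_zero[OF assms] by (cases "s = 0") (auto simp: sublinear_def)
  moreover have "p (s *\<^sub>R y) \<le> p (x + s *\<^sub>R y) + p (- x)"
    using assms unfolding sublinear_def by (metis add.commute minus_add_cancel)
  ultimately show "- p (- x) \<le> p (x + s *\<^sub>R y) - s * p y" by linarith
qed

lemma tilt_upper: "sublinear p \<Longrightarrow> 0 \<le> s \<Longrightarrow> tilt p y x \<le> p (x + s *\<^sub>R y) - s * p y"
  unfolding tilt_def by (rule cINF_lower[OF tilt_bdd]) auto

lemma tilt_le: "sublinear p \<Longrightarrow> tilt p y x \<le> p x"
  using tilt_upper[of p 0 y x] by simp

lemma sublinear_tilt: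
  assumes p: "sublinear p" shows "sublinear (tilt p y)"
  unfolding sublinear_def
proof (intro conjI allI impI)
  fix u v
  have "tilt p y (u + v) - (p (u + s *\<^sub>R y) - s * p y) \<le> (p (v + r *\<^sub>R y) - r * p y)"
    if "0 \<le> s" "0 \<le> r" for s r
  proof -
    have "tilt p y (u + v) \<le> p (u + v + (s + r) *\<^sub>R y) - (s + r) * p y"
      using tilt_upper[OF p] that by simp
    also have "u + v + (s + r) *\<^sub>R y = (u + s *\<^sub>R y) + (v + r *\<^sub>R y)" by (simp add: scaleR_add_left)
    also have "p \<dots> \<le> p (u + s *\<^sub>R y) + p (v + r *\<^sub>R y)" using p by (simp add: sublinear_def)
    finally show ?thesis by (simp add: algebra_simps)
  qed
  then have "tilt p y (u + v) - (p (u + s *\<^sub>R y) - s * p y) \<le> tilt p y v" if "0 \<le> s" for s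
    unfolding tilt_def[of p y v] using that by (intro cINF_greatest) auto
  then have "tilt p y (u + v) - tilt p y v \<le> p (u + s *\<^sub>R y) - s * p y" if "0 \<le> s" for s
    using that by (simp add: algebra_simps)
  then have "tilt p y (u + v) - tilt p y v \<le> tilt p y u"
    unfolding tilt_def[of p y u] by (intro cINF_greatest) auto
  then show "tilt p y (u + v) \<le> tilt p y u + tilt p y v" by simp
next
  have le: "tilt p y (c *\<^sub>R x) \<le> c * tilt p y x" if c: "0 < c" for c x
  proof -
    have "tilt p y (c *\<^sub>R x) / c \<le> p (x + s *\<^sub>R y) - s * p y" if "0 \<le> s" for s
    proof -
      have "tilt p y (c *\<^sub>R x) \<le> p (c *\<^sub>R x + (c * s) *\<^sub>R y) - c * s * p y"
        using tilt_upper[OF p, of "c * s"] that c by simp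
      also have "c *\<^sub>R x + (c * s) *\<^sub>R y = c *\<^sub>R (x + s *\<^sub>R y)" by (simp add: scaleR_add_right)
      also have "p \<dots> = c * p (x + s *\<^sub>R y)" using p c by (simp add: sublinear_def)
      finally show ?thesis using c by (simp add: field_simps)
    qed
    then have "tilt p y (c *\<^sub>R x) / c \<le> tilt p y x"
      unfolding tilt_def[of p y x] by (intro cINF_greatest) auto
    then show ?thesis using c by (simp add: field_simps)
  qed
  fix c :: real and x :: 'a assume c: "0 < c"
  have "tilt p y (inverse c *\<^sub>R c *\<^sub>R x) \<le> inverse c * tilt p y (c *\<^sub>R x)"
    using c by (intro le) auto
  then have "c * tilt p y x \<le> tilt p y (c *\<^sub>R x)" using c by (simp add: field_simps)
  with le[OF c, of x] show "tilt p y (c *\<^sub>R x) = c * tilt p y x" by simp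
qed

text \<open>A chain of sublinear functions below \<open>q\<close> has its pointwise infimum as a lower bound: the values at
\<open>x\<close> are at least \<open>- q (- x)\<close>, and subadditivity passes to the infimum because of two members of a
chain one lies below the other. Zorn's lemma does the rest.\<close>

lemma minimal_sublinear_exists:
  fixes q :: "'a::real_normed_vector \<Rightarrow> real"
  assumes q: "sublinear q"
  obtains m where "sublinear m" "m \<le> q" "\<And>p. sublinear p \<Longrightarrow> p \<le> m \<Longrightarrow> p = m"
proof -
  define S where "S = {p. sublinear p \<and> p \<le> q}"
  have low: "- q (- x) \<le> p x" if "p \<in> S" for p x
  proof -
    have "p (x + - x) \<le> p x + p (- x)" "p (- x) \<le> q (- x)"
      using that unfolding S_def sublinear_def le_fun_def by blast+
    moreover have "p 0 = 0" using that sublinear_zero by (auto simp: S_def)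
    ultimately show ?thesis by simp
  qed
  have "\<exists>m\<in>S. \<forall>a\<in>S. a \<le> m \<longrightarrow> a = m"
  proof (rule predicate_Zorn[where P = "\<lambda>a b. b \<le> a"])
    show "partial_order_on S (relation_of (\<lambda>a b. b \<le> a) S)"
      by (rule partial_order_on_relation_ofI) auto
    fix C assume C: "C \<in> Chains (relation_of (\<lambda>a b. b \<le> a) S)"
    show "\<exists>u\<in>S. \<forall>a\<in>C. u \<le> a"
    proof (cases "C = {}")
      case True then show ?thesis using q by (auto simp: S_def)
    next
      case False
      have CS: "C \<subseteq> S" and tot: "\<And>a b. a \<in> C \<Longrightarrow> b \<in> C \<Longrightarrow> a \<le> b \<or> b \<le> a"
        using C by (auto simp: Chains_def relation_of_def)
      define u where "u x = (INF p\<in>C. p x)" for x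
      have bdd: "bdd_below ((\<lambda>p. p x) ` C)" for x
        using low CS by (intro bdd_belowI2[of _ "- q (- x)"]) auto
      have ule: "u x \<le> p x" if "p \<in> C" for p x
        unfolding u_def by (rule cINF_lower[OF bdd that])
      have "sublinear u" unfolding sublinear_def
      proof (intro conjI allI impI)
        fix x y
        have "u (x + y) - a x \<le> b y" if ab: "a \<in> C" "b \<in> C" for a b
        proof -
          obtain c where c: "c \<in> C" "c \<le> a" "c \<le> b" using tot[OF ab] ab by auto
          have "u (x + y) \<le> c (x + y)" using ule c by simp
          also have "\<dots> \<le> c x + c y" using c CS by (auto simp: S_def sublinear_def)
          also have "\<dots> \<le> a x + b y" using c by (simp add: le_fun_def add_mono)
          finally show ?thesis by simp
        qed
        then have "u (x + y) - a x \<le> u y" if "a \<in> C" for a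
          unfolding u_def[of y] using that False by (intro cINF_greatest) auto
        then have "u (x + y) - u y \<le> a x" if "a \<in> C" for a
          using that by (simp add: algebra_simps)
        then have "u (x + y) - u y \<le> u x"
          unfolding u_def[of x] using False by (intro cINF_greatest) auto
        then show "u (x + y) \<le> u x + u y" by simp
      next
        fix c :: real and x assume c: "0 < c"
        have hom: "p (c *\<^sub>R x) = c * p x" if "p \<in> C" for p using that CS c by (auto simp: S_def sublinear_def)
        show "u (c *\<^sub>R x) = c * u x"
        proof (rule antisym)
          have "u (c *\<^sub>R x) / c \<le> p x" if "p \<in> C" for p
            using ule[OF that, of "c *\<^sub>R x"] hom[OF that] c by (simp add: field_simps)
          then have "u (c *\<^sub>R x) / c \<le> u x" unfolding u_def[of x] using False by (intro cINF_greatest) auto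
          then show "u (c *\<^sub>R x) \<le> c * u x" using c by (simp add: field_simps)
          have "c * u x \<le> p (c *\<^sub>R x)" if "p \<in> C" for p
            using ule[OF that, of x] hom[OF that] c by simp
          then show "c * u x \<le> u (c *\<^sub>R x)" unfolding u_def[of "c *\<^sub>R x"] using False by (intro cINF_greatest) auto
        qed
      qed
      moreover have "u \<le> q" using ule False CS unfolding le_fun_def S_def
        by (metis (mono_tags, lifting) ex_in_conv le_fun_def mem_Collect_eq order_trans subsetD)
      ultimately show ?thesis using ule by (auto simp: S_def le_fun_def)
    qed
  qed
  then show ?thesis using that unfolding S_def by (metis (mono_tags, lifting) mem_Collect_eq order_trans)
qed

text \<open>The Hahn--Banach theorem in the form needed here. A minimal sublinear function \<open>m\<close> is linear.
Starting below the tilt of the norm in direction \<open>x0\<close> makes \<open>m (- x0) \<le> - norm x0\<close>, hence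
\<open>m x0 = norm x0\<close>.\<close>

lemma real_norming_functional:
  fixes x0 :: "'a::real_normed_vector"
  obtains g :: "'a \<Rightarrow> real" where
    "\<And>x y. g (x + y) = g x + g y" "\<And>c x. g (c *\<^sub>R x) = c * g x"
    "\<And>x. g x \<le> norm x" "g x0 = norm x0"
proof -
  have sn: "sublinear (norm :: 'a \<Rightarrow> real)" by (auto simp: sublinear_def norm_triangle_ineq)
  obtain m where m: "sublinear m" "m \<le> tilt norm x0" and
    min: "\<And>p. sublinear p \<Longrightarrow> p \<le> m \<Longrightarrow> p = m"
    using minimal_sublinear_exists[OF sublinear_tilt[OF sn]] by blast
  have add: "m (x + y) = m x + m y" for x y
  proof -
    have "tilt m y = m"
      using min[OF sublinear_tilt[OF m(1)]] tilt_le[OF m(1)] by (simp add: le_fun_def)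
    then have "m x \<le> m (x + y) - m y" using tilt_upper[OF m(1), of 1 y x] by simp
    then show ?thesis using m(1) unfolding sublinear_def by (smt (verit))
  qed
  have z: "m 0 = 0" using sublinear_zero m by blast
  have neg: "m (- x) = - m x" for x using add[of x "- x"] z by simp
  have sc: "m (c *\<^sub>R x) = c * m x" for c x
  proof -
    consider "c > 0" | "c = 0" | "- c > 0" by linarith
    then show ?thesis
    proof cases
      case 3
      then have "m ((- c) *\<^sub>R x) = - c * m x" using m(1) unfolding sublinear_def by blast
      then show ?thesis using neg[of "c *\<^sub>R x"] by simp
    qed (use m z in \<open>auto simp: sublinear_def\<close>)
  qed
  have le: "m x \<le> norm x" for x using m(2) tilt_le[OF sn] order_trans by (fastforce simp: le_fun_def)
  have "m (- x0) \<le> tilt norm x0 (- x0)" using m(2) by (simp add: le_fun_def)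
  also have "\<dots> \<le> - norm x0" using tilt_upper[OF sn, of 1 x0 "- x0"] by simp
  finally have "m x0 = norm x0" using le[of x0] neg[of x0] by simp
  with add sc le show ?thesis using that by blast
qed

text \<open>The complexification \<open>g x - \<i> g (\<i> x)\<close> of a real norming functional. Rotating \<open>x\<close> by a unimodular
scalar makes its value real, so the bound by the norm carries over.\<close>

lemma norming_functional:
  fixes x0 :: "'a::complex_banach"
  obtains f :: "'a \<Rightarrow> complex" where
    "bounded_linear f" "\<And>c x. f (c *\<^sub>C x) = c * f x"
    "\<And>x. cmod (f x) \<le> norm x" "f x0 = of_real (norm x0)"
proof -
  obtain g :: "'a \<Rightarrow> real" where g: "\<And>x y. g (x + y) = g x + g y" "\<And>c x. g (c *\<^sub>R x) = c * g x"
    "\<And>x. g x \<le> norm x" "g x0 = norm x0" using real_norming_functional by blast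
  define f where "f x = Complex (g x) (- g (\<i> *\<^sub>C x))" for x
  have add: "f (x + y) = f x + f y" for x y
    by (simp add: f_def complex_eq_iff g(1) scaleC_add_right)
  have mi: "g (- x) = - g x" for x using g(2)[of "-1" x] by simp
  have md: "g (x - y) = g x - g y" for x y using g(1)[of x "- y"] mi by simp
  have hom: "f (c *\<^sub>C x) = c * f x" for c x
  proof -
    have e: "c *\<^sub>C x = Re c *\<^sub>R x + Im c *\<^sub>R (\<i> *\<^sub>C x)" for c and x :: 'a
      by (metis complex_eq mult.commute scaleC_add_left scaleC_of_real scaleC_scaleC)
    have "\<i> *\<^sub>C \<i> *\<^sub>C x = - x" using scaleC_of_real[of "-1" x] by (simp add: scaleC_scaleC)
    then have i: "\<i> *\<^sub>C (c *\<^sub>C x) = Re c *\<^sub>R (\<i> *\<^sub>C x) + Im c *\<^sub>R (- x)"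
      using e[of c "\<i> *\<^sub>C x"] by (metis mult.commute scaleC_scaleC)
    show ?thesis unfolding f_def i
      by (subst (1) e) (simp add: complex_eq_iff g mi md)
  qed
  have bd: "cmod (f x) \<le> norm x" for x
  proof (cases "f x = 0")
    case False
    define c where "c = cnj (f x) / cmod (f x)"
    have c1: "cmod c = 1" using False by (simp add: c_def norm_divide)
    have "f (c *\<^sub>C x) = of_real (cmod (f x))"
      unfolding hom c_def using False complex_norm_square[of "f x"]
      by (simp add: divide_simps mult.commute power2_eq_square)
    then have "cmod (f x) = g (c *\<^sub>C x)" by (simp add: f_def complex_eq_iff)
    also have "\<dots> \<le> norm x" using g(3)[of "c *\<^sub>C x"] c1 by (simp add: norm_scaleC)
    finally show ?thesis .
  qed simp
  have "f (r *\<^sub>R x) = r *\<^sub>R f x" for r x using hom[of "of_real r" x] by (simp add: scaleC_of_real scaleR_conv_of_real)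
  then have bl: "bounded_linear f" by (intro bounded_linear_intro[where K = 1]) (auto simp: add bd)
  have "f x0 = of_real (norm x0)"
  proof -
    have "(Re (f x0))\<^sup>2 + (Im (f x0))\<^sup>2 \<le> (norm x0)\<^sup>2"
      using bd[of x0] by (metis cmod_power2 norm_ge_zero power_mono)
    then have "Im (f x0) = 0" using g(4) by (simp add: f_def)
    then show ?thesis using g(4) by (simp add: f_def complex_eq_iff)
  qed
  with bl hom bd show ?thesis using that by blast
qed

section \<open>Gauss--Legendre nodes and weights\<close>

definition integral_poly :: "real poly \<Rightarrow> real" where "integral_poly p = integral {-1..1} (poly p)"

lemma integral_poly_integrable: "poly p integrable_on {-1..1::real}"
  by (intro integrable_continuous_interval continuous_intros)

lemma integral_poly_add: "integral_poly (p + q) = integral_poly p + integral_poly q"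
  unfolding integral_poly_def poly_add by (rule integral_add) (rule integral_poly_integrable)+

lemma integral_poly_smult: "integral_poly (smult c p) = c * integral_poly p"
  unfolding integral_poly_def poly_smult by simp

lemma integral_poly_zero: "integral_poly 0 = 0"
  using integral_poly_smult[of 0 0] by simp

lemma integral_poly_diff: "integral_poly (p - q) = integral_poly p - integral_poly q"
  using integral_poly_add[of "p - q" q] by simp

lemma integral_poly_sum: "integral_poly (\<Sum>i\<in>S. f i) = (\<Sum>i\<in>S. integral_poly (f i))"
  by (induction S rule: infinite_finite_induct) (auto simp: integral_poly_add integral_poly_zero)

lemma integral_poly_pderiv: "integral_poly (pderiv p) = poly p 1 - poly p (-1)"
  unfolding integral_poly_def
  by (intro integral_unique fundamental_theorem_of_calculus)
    (auto intro: poly_DERIV DERIV_subset simp flip: has_real_derivative_iff_has_vector_derivative)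

text \<open>Between two consecutive roots of \<open>p\<close> lies a root of its derivative; the bounds by the extreme roots
keep the new roots apart from each other.\<close>

lemma rolle_roots:
  fixes p :: "real poly"
  assumes "finite A" "A \<noteq> {}" "\<And>x. x \<in> A \<Longrightarrow> poly p x = 0"
  shows "\<exists>B. finite B \<and> Suc (card B) = card A \<and>
    (\<forall>x\<in>B. poly (pderiv p) x = 0 \<and> Min A < x \<and> x < Max A)"
  using assms
proof (induction A rule: finite_linorder_max_induct)
  case (insert b A)
  show ?case
  proof (cases "A = {}")
    case True then show ?thesis by (intro exI[of _ "{}"]) auto
  next
    case False
    then obtain B where B: "finite B" "Suc (card B) = card A"
      "\<And>x. x \<in> B \<Longrightarrow> poly (pderiv p) x = 0 \<and> Min A < x \<and> x < Max A" using insert by blast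
    have mb: "Max A < b" using insert False by simp
    have "poly p (Max A) = 0" "poly p b = 0" using insert False by auto
    then obtain r where r: "Max A < r" "r < b" "poly (pderiv p) r = 0"
      using poly_MVT[OF mb, of p] mb by auto
    have mm: "Min A \<le> Max A" using insert(1) False by simp
    have M: "Max (insert b A) = b" "Min (insert b A) = Min A"
    proof -
      have "max b (Max A) = b" "min b (Min A) = Min A" using mb mm by auto
      then show "Max (insert b A) = b" "Min (insert b A) = Min A"
        using insert(1) False by (simp_all only: Max_insert Min_insert not_False_eq_True)
    qed
    have "r \<notin> B" using B(3) r(1) by force
    moreover have "b \<notin> A" using insert by auto
    ultimately show ?thesis using B r insert(1) mb mm unfolding M
      by (intro exI[of _ "insert r B"]) (auto intro: less_trans less_le_trans le_less_trans)
  qed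
qed simp

lemma power_dvd_pderiv:
  fixes p q :: "real poly"
  assumes "q ^ Suc k dvd p" shows "q ^ k dvd pderiv p"
proof -
  obtain r where p: "p = q ^ Suc k * r" using assms by (elim dvdE)
  show ?thesis unfolding p by (simp only: pderiv_mult pderiv_power_Suc) (auto intro!: dvd_add dvd_smult)
qed

abbreviation rodrigues :: "nat \<Rightarrow> nat \<Rightarrow> real poly" where
  "rodrigues m j \<equiv> (pderiv ^^ j) ([:-1, 0, 1:] ^ m)"

lemma rodrigues_dvd: "j \<le> m \<Longrightarrow> [:-1, 0, 1:] ^ (m - j) dvd rodrigues m j"
proof (induction j)
  case (Suc j)
  then have "[:-1, 0, 1:] ^ Suc (m - Suc j) dvd rodrigues m j" by (simp add: Suc_diff_Suc)
  then show ?case by (simp add: power_dvd_pderiv)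
qed simp

lemma rodrigues_endpoint: "j < m \<Longrightarrow> x = 1 \<or> x = -1 \<Longrightarrow> poly (rodrigues m j) x = 0"
  using rodrigues_dvd[of j m] by (auto elim!: dvdE simp: power_0_left)

text \<open>The endpoints stay roots up to order \<open>m - 1\<close>; together with them, Rolle's theorem gains one interior root
with each differentiation.\<close>

lemma rodrigues_roots:
  "j \<le> m \<Longrightarrow> \<exists>B. finite B \<and> card B = j \<and> B \<subseteq> {-1<..<1} \<and> (\<forall>x\<in>B. poly (rodrigues m j) x = 0)"
proof (induction j)
  case 0 then show ?case by (intro exI[of _ "{}"]) auto
next
  case (Suc j)
  then obtain B where B: "finite B" "card B = j" "B \<subseteq> {-1<..<1}" "\<And>x. x \<in> B \<Longrightarrow> poly (rodrigues m j) x = 0"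
    by auto
  let ?A = "insert (-1) (insert 1 B)"
  have "\<exists>C. finite C \<and> Suc (card C) = card ?A \<and>
    (\<forall>x\<in>C. poly (pderiv (rodrigues m j)) x = 0 \<and> Min ?A < x \<and> x < Max ?A)"
    using B rodrigues_endpoint[of j m] Suc.prems by (intro rolle_roots) auto
  moreover have "card ?A = Suc (Suc j)"
  proof -
    have "1 \<notin> B" "-1 \<notin> insert 1 B" using B(3) by auto
    then show ?thesis using B(1,2) by simp
  qed
  moreover have "Min ?A = -1"
  proof (rule Min_eqI)
    show "-1 \<le> y" if "y \<in> ?A" for y using that B(3) by (auto dest: subsetD)
  qed (use B(1) in auto)
  moreover have "Max ?A = 1"
  proof (rule Max_eqI)
    show "y \<le> 1" if "y \<in> ?A" for y using that B(3) by (auto dest: subsetD)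
  qed (use B(1) in auto)
  ultimately show ?case by (auto simp: subset_iff)
qed

text \<open>Integration by parts moves the derivatives onto \<open>p\<close>; the boundary terms vanish because the lower
derivatives of \<open>(x\<^sup>2 - 1) ^ m\<close> are zero at both endpoints.\<close>

lemma rodrigues_orthogonal: "j \<le> m \<Longrightarrow> degree p < j \<Longrightarrow> integral_poly (rodrigues m j * p) = 0"
proof (induction j arbitrary: p)
  case (Suc j)
  have "integral_poly (pderiv (rodrigues m j * p)) = 0"
    using rodrigues_endpoint[of j m] Suc.prems unfolding integral_poly_pderiv by simp
  then have e: "integral_poly (pderiv (rodrigues m j) * p) = - integral_poly (rodrigues m j * pderiv p)"
    by (simp add: pderiv_mult integral_poly_add mult.commute)
  have "integral_poly (rodrigues m j * pderiv p) = 0"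
  proof (cases "degree p = 0")
    case True then show ?thesis by (simp add: pderiv_eq_0_iff[symmetric] pderiv_eq_0_iff[THEN iffD2] integral_poly_zero)
  next
    case False then show ?thesis using Suc by (intro Suc.IH) (auto simp: degree_pderiv)
  qed
  with e show ?case by simp
qed simp

lemma degree_rodrigues: "degree (rodrigues m j) = 2 * m - j"
  by (induction j) (auto simp: degree_pderiv degree_power_eq)

lemma degree_legendre: "degree (legendre m) = m"
  by (simp add: legendre_def degree_rodrigues)

lemma legendre_nonzero: "legendre m \<noteq> 0"
proof (cases m)
  case 0 then show ?thesis by (simp add: legendre_def)
next
  case Suc then show ?thesis using degree_legendre[of m] by force
qed

lemma legendre_orthogonal: "degree p < m \<Longrightarrow> integral_poly (legendre m * p) = 0"
  by (simp add: legendre_def integral_poly_smult rodrigues_orthogonal)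

lemma legendre_roots:
  defines "S m \<equiv> {x. poly (legendre m) x = 0}"
  shows "finite (S m)" "card (S m) = m" "S m \<subseteq> {-1<..<1}"
proof -
  show f: "finite (S m)" unfolding S_def using legendre_nonzero by (rule poly_roots_finite)
  obtain B where B: "finite B" "card B = m" "B \<subseteq> {-1<..<1}" "\<And>x. x \<in> B \<Longrightarrow> poly (rodrigues m m) x = 0"
    using rodrigues_roots[of m m] by auto
  have "B \<subseteq> S m" using B(4) by (auto simp: S_def legendre_def)
  moreover have "card (S m) \<le> m"
    unfolding S_def using card_poly_roots_bound[OF legendre_nonzero, of m] by (simp add: degree_legendre)
  ultimately have "B = S m" using B f by (intro card_subset_eq) (auto simp: card_mono le_antisym)
  with B show "card (S m) = m" "S m \<subseteq> {-1<..<1}" by auto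
qed

lemma gauss_node_root: "j \<le> n \<Longrightarrow> poly (legendre (Suc n)) (gauss_node n j) = 0"
  and gauss_node_bounds: "j \<le> n \<Longrightarrow> gauss_node n j \<in> {-1<..<1}"
  and gauss_node_inj: "inj_on (gauss_node n) {..n}"
proof -
  let ?S = "{x. poly (legendre (Suc n)) x = 0}"
  have len: "length (sorted_list_of_set ?S) = Suc n" by (simp add: legendre_roots(2))
  have m: "gauss_node n j \<in> ?S" if "j \<le> n" for j
  proof -
    have "gauss_node n j \<in> set (sorted_list_of_set ?S)"
      unfolding gauss_node_def by (rule nth_mem) (use len that in linarith)
    then show ?thesis by (simp only: set_sorted_list_of_set legendre_roots(1))
  qed
  show "j \<le> n \<Longrightarrow> poly (legendre (Suc n)) (gauss_node n j) = 0" using m by blast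
  show "j \<le> n \<Longrightarrow> gauss_node n j \<in> {-1<..<1}" using m legendre_roots(3) by blast
  show "inj_on (gauss_node n) {..n}"
    unfolding gauss_node_def inj_on_def using len by (auto simp: nth_eq_iff_index_eq)
qed

lemma poly_vanishing_at_nodes_zero:
  assumes "degree p \<le> n" "\<And>j. j \<le> n \<Longrightarrow> poly p (gauss_node n j) = 0"
  shows "p = 0"
proof (rule ccontr)
  assume nz: "p \<noteq> 0"
  have "card (gauss_node n ` {..n}) \<le> card {x. poly p x = 0}"
    using assms(2) poly_roots_finite[OF nz] by (intro card_mono) auto
  moreover have "card {x. poly p x = 0} \<le> degree p" using card_poly_roots_bound[OF nz] .
  ultimately show False using assms(1) card_image[OF gauss_node_inj[of n]] by simp
qed

text \<open>Exactness of Gauss quadrature up to degree \<open>2 n + 1\<close>, for polynomials that vanish at the nodes: such a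
polynomial is a multiple of the Legendre polynomial with a cofactor of degree at most \<open>n\<close>.\<close>

lemma integral_poly_zero_if_vanishing_at_nodes:
  assumes "degree p \<le> 2 * n + 1" "\<And>j. j \<le> n \<Longrightarrow> poly p (gauss_node n j) = 0"
  shows "integral_poly p = 0"
proof -
  let ?P = "legendre (Suc n)"
  have d: "p = ?P * (p div ?P) + p mod ?P" by simp
  have "p mod ?P = 0"
  proof (rule poly_vanishing_at_nodes_zero)
    show "degree (p mod ?P) \<le> n" using degree_mod_less'[of ?P p] legendre_nonzero[of "Suc n"]
      by (cases "p mod ?P = 0") (auto simp: degree_legendre)
    fix j assume j: "j \<le> n"
    have "poly p (gauss_node n j) = poly (?P * (p div ?P) + p mod ?P) (gauss_node n j)"
      by (rule arg_cong[OF d])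
    then show "poly (p mod ?P) (gauss_node n j) = 0" using gauss_node_root[OF j] assms(2)[OF j]
      unfolding poly_add poly_mult by simp
  qed
  then have p: "p = ?P * (p div ?P)" using d by simp
  have "degree (p div ?P) < Suc n"
  proof (cases "p div ?P = 0")
    case False
    then have "degree p = Suc n + degree (p div ?P)"
      using p degree_mult_eq[OF legendre_nonzero[of "Suc n"] False] by (metis degree_legendre)
    then show ?thesis using assms(1) by linarith
  qed simp
  then show ?thesis using legendre_orthogonal p by metis
qed

definition gauss_lagrange :: "nat \<Rightarrow> nat \<Rightarrow> real poly" where
  "gauss_lagrange n j = (\<Prod>i\<in>{..n} - {j}.
     smult (1 / (gauss_node n j - gauss_node n i)) [:- gauss_node n i, 1:])"

lemma gauss_weight_eq: "gauss_weight n j = integral_poly (gauss_lagrange n j)"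
  unfolding gauss_weight_def integral_poly_def gauss_lagrange_def
  by (intro arg_cong2[where f = integral] refl ext) (simp add: poly_prod diff_divide_distrib)

lemma degree_gauss_lagrange: "j \<le> n \<Longrightarrow> degree (gauss_lagrange n j) \<le> n"
proof -
  assume "j \<le> n"
  have "degree (gauss_lagrange n j) \<le> (\<Sum>i\<in>{..n} - {j}. 1)"
    unfolding gauss_lagrange_def
    by (rule order_trans[OF degree_prod_sum_le])
       (simp, simp only: o_def, rule sum_mono, rule order_trans[OF degree_smult_le], simp)
  then show ?thesis using \<open>j \<le> n\<close> by simp
qed

lemma poly_gauss_lagrange:
  assumes "j \<le> n" "k \<le> n"
  shows "poly (gauss_lagrange n j) (gauss_node n k) = (if k = j then 1 else 0)"
proof -
  have "gauss_node n j - gauss_node n i \<noteq> 0" if "i \<in> {..n} - {j}" for i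
    using gauss_node_inj[of n] assms that by (auto simp: inj_on_def)
  then show ?thesis using assms unfolding gauss_lagrange_def poly_prod
    by (auto simp: diff_divide_distrib[symmetric] intro!: prod.neutral)
qed

text \<open>The Lagrange polynomial \<open>l\<close> of a node satisfies \<open>l\<^sup>2 = l\<close> at all nodes, so exactness turns the weight
\<open>\<integral> l\<close> into \<open>\<integral> l\<^sup>2\<close>.\<close>

lemma gauss_weight_nonneg:
  assumes "j \<le> n" shows "0 \<le> gauss_weight n j"
proof -
  let ?l = "gauss_lagrange n j"
  have "integral_poly (?l * ?l - ?l) = 0"
  proof (rule integral_poly_zero_if_vanishing_at_nodes)
    have "degree (?l * ?l) \<le> 2 * n + 1" "degree ?l \<le> 2 * n + 1"
      using degree_gauss_lagrange[OF assms] degree_mult_le[of ?l ?l] by linarith+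
    then show "degree (?l * ?l - ?l) \<le> 2 * n + 1" by (rule degree_diff_le)
  qed (simp add: poly_gauss_lagrange assms)
  then have "gauss_weight n j = integral_poly (?l * ?l)" by (simp add: gauss_weight_eq integral_poly_diff)
  also have "\<dots> \<ge> 0" unfolding integral_poly_def by (intro integral_nonneg integral_poly_integrable) simp
  finally show ?thesis .
qed

lemma sum_gauss_weight: "(\<Sum>j\<le>n. gauss_weight n j) = 2"
proof -
  have "(\<Sum>j\<le>n. gauss_lagrange n j) - 1 = 0"
  proof (rule poly_vanishing_at_nodes_zero)
    show "degree ((\<Sum>j\<le>n. gauss_lagrange n j) - 1) \<le> n"
      using degree_gauss_lagrange by (intro degree_diff_le degree_sum_le) auto
  qed (simp add: poly_sum poly_gauss_lagrange)
  then have "(\<Sum>j\<le>n. gauss_weight n j) = integral_poly 1"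
    unfolding gauss_weight_eq integral_poly_sum[symmetric] by simp
  also have "integral_poly 1 = integral {-1..1} (\<lambda>_::real. 1::real)"
    unfolding integral_poly_def by (intro arg_cong2[where f = integral] ext) auto
  finally show ?thesis by simp
qed

section \<open>Resolvents and fractional powers of strongly positive operators\<close>

lemma scaleC_scaleR: "c *\<^sub>C (r *\<^sub>R x) = r *\<^sub>R (c *\<^sub>C (x :: 'a::complex_banach))"
  by (metis mult.commute scaleC_of_real scaleC_scaleC)

lemma bounded_bilinear_scaleC: "bounded_bilinear ((*\<^sub>C) :: complex \<Rightarrow> 'a \<Rightarrow> 'a::complex_banach)"
proof (rule bounded_bilinear.intro)
  show "\<exists>K. \<forall>a (b::'a). norm (a *\<^sub>C b) \<le> norm a * norm b * K"
    by (intro exI[of _ 1]) (simp add: norm_scaleC)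
qed (auto simp: scaleC_add_left scaleC_add_right scaleC_scaleR, metis scaleC_of_real scaleC_scaleC scaleR_conv_of_real)

interpretation scaleC: bounded_bilinear "(*\<^sub>C) :: complex \<Rightarrow> 'a \<Rightarrow> 'a::complex_banach"
  by (rule bounded_bilinear_scaleC)

text \<open>The complement of the closed sector as a single inequality: to the left of the vertex its left-hand side
is negative.\<close>

definition sector_compl :: "real \<Rightarrow> real \<Rightarrow> complex set" where
  "sector_compl r\<^sub>0 \<phi> = {z. tan \<phi> * (Re z - r\<^sub>0) < \<bar>Im z\<bar>}"

lemma sector_compl_disjoint:
  assumes "0 < \<phi>" "\<phi> < pi / 2" "z \<in> sector_compl r\<^sub>0 \<phi>"
  shows "z \<notin> sector r\<^sub>0 \<phi>"
proof
  assume "z \<in> sector r\<^sub>0 \<phi>"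
  then obtain r \<theta> where z: "z = of_real r\<^sub>0 + of_real r * cis \<theta>" and r: "0 \<le> r" and t: "\<bar>\<theta>\<bar> < \<phi>"
    by (auto simp: sector_def)
  have c: "0 < cos \<theta>" using t assms by (intro cos_gt_zero_pi) auto
  have "0 \<le> sin \<bar>\<theta>\<bar>" using t assms by (intro sin_ge_zero) auto
  then have "sin \<bar>\<theta>\<bar> = \<bar>sin \<theta>\<bar>" by (cases "0 \<le> \<theta>") auto
  then have "\<bar>sin \<theta>\<bar> / cos \<theta> = tan \<bar>\<theta>\<bar>" by (simp add: tan_def)
  also have "\<dots> \<le> tan \<phi>" using t assms by (intro less_imp_le tan_monotone) auto
  finally have "\<bar>sin \<theta>\<bar> \<le> tan \<phi> * cos \<theta>" using c by (simp add: field_simps)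
  then have "r * \<bar>sin \<theta>\<bar> \<le> r * (tan \<phi> * cos \<theta>)" using r by (rule mult_left_mono)
  then show False using assms(3) r by (simp add: sector_compl_def z abs_mult mult.left_commute)
qed

context
  fixes D :: "'a::complex_banach set" and A :: "'a \<Rightarrow> 'a"
  assumes lin: "linear_operator D A"
begin

lemma resolvent_solves:
  assumes "z \<in> resolvent_set D A"
  shows "resolvent D A z y \<in> D" "z *\<^sub>C resolvent D A z y - A (resolvent D A z y) = y"
  using assms unfolding resolvent_set_def resolvent_def bij_betw_def
  by (auto intro: inv_into_into f_inv_into_f[where f = "\<lambda>x. z *\<^sub>C x - A x"])

lemma resolvent_unique:
  assumes "z \<in> resolvent_set D A" "x \<in> D" "z *\<^sub>C x - A x = y"
  shows "resolvent D A z y = x"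
  using assms inv_into_f_f[of "\<lambda>x. z *\<^sub>C x - A x" D x]
  unfolding resolvent_set_def resolvent_def bij_betw_def by auto

lemma resolvent_linear:
  assumes "z \<in> resolvent_set D A" shows "bounded_linear (resolvent D A z)"
  using assms by (simp add: resolvent_set_def)

lemma resolvent_scaleC:
  assumes z: "z \<in> resolvent_set D A"
  shows "resolvent D A z (c *\<^sub>C y) = c *\<^sub>C resolvent D A z y"
proof (rule resolvent_unique[OF z])
  let ?x = "resolvent D A z y"
  show "c *\<^sub>C ?x \<in> D" using lin resolvent_solves[OF z] by (simp add: linear_operator_def)
  have "A (c *\<^sub>C ?x) = c *\<^sub>C A ?x" using lin resolvent_solves(1)[OF z] by (simp add: linear_operator_def)
  moreover have "z *\<^sub>C c *\<^sub>C ?x = c *\<^sub>C z *\<^sub>C ?x" by (simp add: scaleC_scaleC mult.commute)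
  ultimately have "z *\<^sub>C c *\<^sub>C ?x - A (c *\<^sub>C ?x) = c *\<^sub>C (z *\<^sub>C ?x - A ?x)"
    by (simp add: scaleC.diff_right)
  then show "z *\<^sub>C c *\<^sub>C ?x - A (c *\<^sub>C ?x) = c *\<^sub>C y" using resolvent_solves[OF z] by simp
qed

lemma resolvent_identity:
  assumes z: "z \<in> resolvent_set D A" and w: "w \<in> resolvent_set D A"
  shows "resolvent D A z y - resolvent D A w y = (w - z) *\<^sub>C resolvent D A z (resolvent D A w y)"
proof -
  let ?u = "resolvent D A w y"
  have "z *\<^sub>C ?u - A ?u = y + (z - w) *\<^sub>C ?u"
    using resolvent_solves(2)[OF w, of y] by (simp add: scaleC.diff_left algebra_simps)
  then have "resolvent D A z (y + (z - w) *\<^sub>C ?u) = ?u"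
    using resolvent_solves(1)[OF w] by (intro resolvent_unique[OF z])
  then have "resolvent D A z y + (z - w) *\<^sub>C resolvent D A z ?u = ?u"
    by (simp add: linear_add[OF bounded_linear.linear[OF resolvent_linear[OF z]]] resolvent_scaleC[OF z])
  then show ?thesis by (simp add: scaleC.diff_left algebra_simps)
qed

end

lemma strongly_positiveD:
  assumes "strongly_positive D A r\<^sub>0 \<phi>"
  obtains M where "0 \<le> M"
    "\<And>z. z \<in> sector_compl r\<^sub>0 \<phi> \<Longrightarrow> z \<in> resolvent_set D A"
    "\<And>z x. z \<in> sector_compl r\<^sub>0 \<phi> \<Longrightarrow> norm (resolvent D A z x) \<le> M / (1 + cmod z) * norm x"
proof -
  have p: "0 < r\<^sub>0" "0 < \<phi>" "\<phi> < pi / 2" using assms by (auto simp: strongly_positive_def)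
  obtain M where M: "\<And>z. z \<in> - sector r\<^sub>0 \<phi> \<Longrightarrow> z \<in> resolvent_set D A \<and> onorm (resolvent D A z) \<le> M / (1 + cmod z)"
    using assms by (auto simp: strongly_positive_def)
  have "norm (resolvent D A z x) \<le> M / (1 + cmod z) * norm x" if "z \<in> sector_compl r\<^sub>0 \<phi>" for z x
  proof -
    have z: "z \<in> - sector r\<^sub>0 \<phi>" using sector_compl_disjoint[OF p(2,3) that] by simp
    then have "bounded_linear (resolvent D A z)" using M by (auto simp: resolvent_set_def)
    then have "norm (resolvent D A z x) \<le> onorm (resolvent D A z) * norm x" by (rule onorm)
    also have "\<dots> \<le> M / (1 + cmod z) * norm x" using M[OF z] by (intro mult_right_mono) auto
    finally show ?thesis .
  qed
  moreover have "0 \<le> M"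
  proof -
    have "0 \<in> sector_compl r\<^sub>0 \<phi>" using p by (simp add: sector_compl_def tan_gt_zero)
    then have "0 \<in> - sector r\<^sub>0 \<phi>" using sector_compl_disjoint[OF p(2,3)] by auto
    from M[OF this] have "onorm (resolvent D A 0) \<le> M" "bounded_linear (resolvent D A 0)"
      by (auto simp: resolvent_set_def)
    then show ?thesis using onorm_pos_le order_trans by blast
  qed
  ultimately show ?thesis using that M sector_compl_disjoint[OF p(2,3)] by blast
qed

lemma resolvent_lipschitz:
  assumes lin: "linear_operator D A" and M: "0 \<le> M"
    and U: "\<And>z. z \<in> U \<Longrightarrow> z \<in> resolvent_set D A"
    and B: "\<And>z x. z \<in> U \<Longrightarrow> norm (resolvent D A z x) \<le> M * norm x"
    and zw: "z \<in> U" "w \<in> U"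
  shows "norm (resolvent D A z y - resolvent D A w y) \<le> cmod (z - w) * (M * (M * norm y))"
proof -
  have "norm (resolvent D A z y - resolvent D A w y) = cmod (w - z) * norm (resolvent D A z (resolvent D A w y))"
    by (simp add: resolvent_identity[OF lin U U] zw norm_scaleC)
  also have "\<dots> \<le> cmod (w - z) * (M * (M * norm y))"
    using order_trans[OF B[OF zw(1)] mult_left_mono[OF B[OF zw(2)] M]] by (intro mult_left_mono) auto
  finally show ?thesis by (simp add: norm_minus_commute)
qed

lemma resolvent_continuous_on:
  assumes "linear_operator D A" "0 \<le> M"
    and "\<And>z. z \<in> U \<Longrightarrow> z \<in> resolvent_set D A"
    and "\<And>z x. z \<in> U \<Longrightarrow> norm (resolvent D A z x) \<le> M * norm x"
  shows "continuous_on U (\<lambda>z. resolvent D A z y)"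
proof -
  have "(M * (M * norm y))-lipschitz_on U (\<lambda>z. resolvent D A z y)"
  proof (rule lipschitz_onI)
    fix z w assume "z \<in> U" "w \<in> U"
    from resolvent_lipschitz[OF assms(1,2,3,4) this]
    show "dist (resolvent D A z y) (resolvent D A w y) \<le> M * (M * norm y) * dist z w"
      by (simp add: dist_norm mult.commute)
  qed (use assms(2) in auto)
  then show ?thesis by (rule lipschitz_on_continuous_on)
qed

lemma resolvent_holomorphic_on:
  fixes f :: "'a::complex_banach \<Rightarrow> complex"
  assumes R: "linear_operator D A" "0 \<le> M"
    "\<And>z. z \<in> U \<Longrightarrow> z \<in> resolvent_set D A"
    "\<And>z x. z \<in> U \<Longrightarrow> norm (resolvent D A z x) \<le> M * norm x"
    and f: "bounded_linear f" "\<And>c x. f (c *\<^sub>C x) = c * f x"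
  shows "(\<lambda>z. f (resolvent D A z y)) holomorphic_on U"
proof -
  have "((\<lambda>z. f (resolvent D A z y)) has_field_derivative - f (resolvent D A w (resolvent D A w y))) (at w within U)"
    if w: "w \<in> U" for w
    unfolding has_field_derivative_iff
  proof (rule Lim_transform_within[OF _ zero_less_one])
    have "continuous_on U (\<lambda>z. - f (resolvent D A z (resolvent D A w y)))"
      by (intro continuous_intros bounded_linear.continuous_on[OF f(1)] resolvent_continuous_on[OF R])
    then show "((\<lambda>z. - f (resolvent D A z (resolvent D A w y))) \<longlongrightarrow> - f (resolvent D A w (resolvent D A w y))) (at w within U)"
      using w by (simp add: continuous_on)
    fix z assume z: "z \<in> U" "0 < dist z w"
    have "f (resolvent D A z y) - f (resolvent D A w y) = (w - z) * f (resolvent D A z (resolvent D A w y))"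
      using resolvent_identity[OF R(1) R(3)[OF z(1)] R(3)[OF w], of y]
      by (metis f(2) linear_diff[OF bounded_linear.linear[OF f(1)]])
    then show "- f (resolvent D A z (resolvent D A w y)) = (f (resolvent D A z y) - f (resolvent D A w y)) / (z - w)"
      using z by (simp add: field_simps)
  qed
  then show ?thesis by (auto simp: holomorphic_on_def field_differentiable_def)
qed

text \<open>The integral \<open>\<integral> l powr (-\<alpha>) / max r l\<close> splits at \<open>l = r\<close> into two elementary pieces of size
\<open>r powr (-\<alpha>)\<close>.\<close>

lemma norm_integral_powr_le:
  fixes k :: "real \<Rightarrow> 'a::banach"
  assumes a: "0 < \<alpha>" "\<alpha> < 1" and r: "0 < r" and C: "0 \<le> C"
    and k: "k integrable_on {0<..}"
    and small: "\<And>l. 0 < l \<Longrightarrow> norm (k l) \<le> C * l powr (-\<alpha>) / r"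
    and large: "\<And>l. 0 < l \<Longrightarrow> norm (k l) \<le> C * l powr (-\<alpha>) / l"
  shows "norm (integral {0<..} k) \<le> C * (1 / (1 - \<alpha>) + 1 / \<alpha>) * r powr (-\<alpha>)"
proof -
  define g where "g l = (if l \<le> r then C * l powr (-\<alpha>) / r else C * l powr (-\<alpha> - 1))" for l
  have "((\<lambda>l. C / r * l powr (-\<alpha>)) has_integral C / r * (r powr (-\<alpha> + 1) / (-\<alpha> + 1))) {0..r}"
    using a r by (intro has_integral_mult_right has_integral_powr_from_0) auto
  then have 1: "(g has_integral C / r * (r powr (-\<alpha> + 1) / (-\<alpha> + 1))) {0..r}"
    by (rule has_integral_eq[rotated]) (simp add: g_def)
  have "((\<lambda>l. C * l powr (-\<alpha> - 1)) has_integral C * (- (r powr (-\<alpha> - 1 + 1)) / (-\<alpha> - 1 + 1))) {r..}"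
    using a r by (intro has_integral_mult_right has_integral_powr_to_inf) auto
  then have 2: "(g has_integral C * (- (r powr (-\<alpha> - 1 + 1)) / (-\<alpha> - 1 + 1))) {r..}"
    by (rule has_integral_spike[where S = "{r}", rotated 2]) (auto simp: g_def)
  have "(g has_integral (C / r * (r powr (-\<alpha> + 1) / (-\<alpha> + 1)) + C * (- (r powr (-\<alpha> - 1 + 1)) / (-\<alpha> - 1 + 1)))) ({0..r} \<union> {r..})"
    by (rule has_integral_Un[OF 1 2]) (rule negligible_subset[of "{r}"], auto)
  also have "C / r * (r powr (-\<alpha> + 1) / (-\<alpha> + 1)) + C * (- (r powr (-\<alpha> - 1 + 1)) / (-\<alpha> - 1 + 1))
      = C * (1 / (1 - \<alpha>) + 1 / \<alpha>) * r powr (-\<alpha>)"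
  proof -
    have "r powr (1 - \<alpha>) = r powr (-\<alpha>) * r" using r powr_add[of r 1 "-\<alpha>"] by (simp add: mult.commute)
    then show ?thesis using a r by (simp add: field_simps)
  qed
  finally have g: "(g has_integral C * (1 / (1 - \<alpha>) + 1 / \<alpha>) * r powr (-\<alpha>)) ({0..r} \<union> {r..})" .
  have g': "(g has_integral C * (1 / (1 - \<alpha>) + 1 / \<alpha>) * r powr (-\<alpha>)) {0<..}"
    by (rule iffD1[OF has_integral_spike_set_eq g]; rule negligible_subset[of "{0}"]) (use r in auto)
  have "norm (k l) \<le> g l" if "l \<in> {0<..}" for l
    using that small[of l] large[of l] by (auto simp: g_def powr_diff)
  then have "norm (integral {0<..} k) \<le> integral {0<..} g"
    using k g' by (intro integral_norm_bound_integral) auto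
  then show ?thesis using integral_unique[OF g'] by simp
qed

text \<open>If \<open>z\<close> keeps an angle of at least \<open>\<pi> / 4\<close> from the negative half axis, then \<open>l + z\<close> is comparable to
the larger of \<open>l\<close> and \<open>cmod z\<close>.\<close>

lemma cmod_add_real_ge:
  assumes "0 < l" "- Re z \<le> \<bar>Im z\<bar>"
  shows "cmod z \<le> 2 * cmod (of_real l + z)" "l \<le> 3 * cmod (of_real l + z)"
proof -
  show 1: "cmod z \<le> 2 * cmod (of_real l + z)"
  proof (cases "0 \<le> Re z")
    case True
    have "cmod z \<le> cmod (of_real l + z)"
      using True assms by (auto simp: cmod_def intro!: real_sqrt_le_mono power_mono)
    then show ?thesis using norm_ge_zero[of "of_real l + z"] by linarith
  next
    case False
    then show ?thesis using assms cmod_le[of z] abs_Im_le_cmod[of "of_real l + z"] by simp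
  qed
  have "cmod (of_real l) \<le> cmod (of_real l + z) + cmod z"
    by (metis add_diff_cancel norm_triangle_ineq4)
  with 1 show "l \<le> 3 * cmod (of_real l + z)" using assms by simp
qed

text \<open>For \<open>S = (l + A)\<^sup>-\<^sup>1\<close> and \<open>Z = (z - A)\<^sup>-\<^sup>1\<close> the resolvent identity gives
\<open>(l + z) (z Z S - S) = z Z - l S\<close>, whose right-hand side is bounded. Balakrishnan's integral of
\<open>z Z S - S\<close> is therefore at most a multiple of \<open>\<integral> l powr (-\<alpha>) / \<bar>l + z\<bar>\<close>, which has size
\<open>\<bar>z\<bar> powr (-\<alpha>)\<close>. If Balakrishnan's integrand is not integrable, the integral is 0 by convention and the
bounds are trivial.\<close>

lemma neg_frac_power_bounds:
  assumes SP: "strongly_positive D A r\<^sub>0 \<phi>" and a: "0 < \<alpha>" "\<alpha> < 1"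
  obtains C where "0 \<le> C"
    "\<And>v. norm (neg_frac_power D A \<alpha> v) \<le> C * norm v"
    "\<And>v z. z \<in> sector_compl r\<^sub>0 \<phi> \<Longrightarrow> - Re z \<le> \<bar>Im z\<bar> \<Longrightarrow> z \<noteq> 0 \<Longrightarrow>
      norm (z *\<^sub>C resolvent D A z (neg_frac_power D A \<alpha> v) - neg_frac_power D A \<alpha> v)
        \<le> C * cmod z powr (-\<alpha>) * norm v"
proof -
  have p: "0 < r\<^sub>0" "0 < \<phi>" "\<phi> < pi / 2" "linear_operator D A" using SP by (auto simp: strongly_positive_def)
  obtain M where M: "0 \<le> M"
    and rs: "\<And>z. z \<in> sector_compl r\<^sub>0 \<phi> \<Longrightarrow> z \<in> resolvent_set D A"
    and bd: "\<And>z x. z \<in> sector_compl r\<^sub>0 \<phi> \<Longrightarrow> norm (resolvent D A z x) \<le> M / (1 + cmod z) * norm x"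
    using strongly_positiveD[OF SP] by blast
  define s where "s = sin (pi * \<alpha>) / pi"
  define S where "S l v = - resolvent D A (- of_real l) v" for l v
  define k where "k v l = (l powr (-\<alpha>)) *\<^sub>R S l v" for v l
  have nfp: "neg_frac_power D A \<alpha> v = s *\<^sub>R integral {0<..} (k v)" for v
    by (simp add: neg_frac_power_def s_def k_def[abs_def] S_def)
  have neg: "- of_real l \<in> sector_compl r\<^sub>0 \<phi>" if "0 < l" for l
  proof -
    have "tan \<phi> * (- l - r\<^sub>0) < 0" using that p tan_gt_zero[of \<phi>] by (intro mult_pos_neg) auto
    then show ?thesis by (simp add: sector_compl_def)
  qed
  have Sb: "norm (S l v) \<le> M / (1 + l) * norm v" if "0 < l" for l v
    using bd[OF neg[OF that], of v] that by (simp add: S_def)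
  define E where "E = 1 / (1 - \<alpha>) + 1 / \<alpha>"
  have E: "0 \<le> E" using a by (simp add: E_def)
  define C where "C = \<bar>s\<bar> * (6 * M * E)"
  have "0 \<le> C" using M E by (simp add: C_def)
  moreover have "norm (neg_frac_power D A \<alpha> v) \<le> C * norm v" for v
  proof (cases "k v integrable_on {0<..}")
    case True
    have "norm (integral {0<..} (k v)) \<le> (M * norm v) * (1 / (1 - \<alpha>) + 1 / \<alpha>) * 1 powr (-\<alpha>)"
    proof (rule norm_integral_powr_le[OF a _ _ True])
      fix l :: real assume l: "0 < l"
      have "M / (1 + l) * norm v \<le> M / 1 * norm v" "M / (1 + l) * norm v \<le> M / l * norm v"
        using M l by (intro mult_right_mono divide_left_mono; simp)+
      with Sb[OF l, of v] have "norm (S l v) \<le> M * norm v" "norm (S l v) \<le> M * norm v / l" by auto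
      then have "l powr (-\<alpha>) * norm (S l v) \<le> l powr (-\<alpha>) * (M * norm v)"
        "l powr (-\<alpha>) * norm (S l v) \<le> l powr (-\<alpha>) * (M * norm v / l)" by (intro mult_left_mono; simp)+
      then show "norm (k v l) \<le> M * norm v * l powr (-\<alpha>) / 1" "norm (k v l) \<le> M * norm v * l powr (-\<alpha>) / l"
        by (simp_all add: k_def mult.commute)
    qed (use M in auto)
    then have "\<bar>s\<bar> * norm (integral {0<..} (k v)) \<le> \<bar>s\<bar> * (M * norm v * E)"
      by (intro mult_left_mono) (auto simp: E_def)
    also have "\<dots> \<le> C * norm v" using M E by (simp add: C_def mult_left_mono mult_right_mono)
    finally show ?thesis by (simp add: nfp)
  qed (use \<open>0 \<le> C\<close> in \<open>simp add: nfp not_integrable_integral\<close>)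
  moreover have "norm (z *\<^sub>C resolvent D A z (neg_frac_power D A \<alpha> v) - neg_frac_power D A \<alpha> v)
        \<le> C * cmod z powr (-\<alpha>) * norm v"
    if zU: "z \<in> sector_compl r\<^sub>0 \<phi>" and zre: "- Re z \<le> \<bar>Im z\<bar>" and z0: "z \<noteq> 0" for v z
  proof -
    define B where "B x = z *\<^sub>C resolvent D A z x - x" for x
    note zr = rs[OF zU]
    note Rl = bounded_linear.linear[OF resolvent_linear[OF p(4) zr]]
    have Bl: "bounded_linear B" unfolding B_def[abs_def]
      by (intro bounded_linear_sub bounded_linear_ident
          bounded_linear_compose[OF scaleC.bounded_linear_right resolvent_linear[OF p(4) zr]])
    note Bs = linear_scale[OF bounded_linear.linear[OF Bl]]
    have BS: "norm (B (S l v)) \<le> 2 * M * norm v / cmod (of_real l + z)" if l: "0 < l" for l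
    proof -
      have ne: "of_real l + z \<noteq> 0" using cmod_add_real_ge[OF l zre] z0 by auto
      have id: "resolvent D A z v + S l v = (of_real l + z) *\<^sub>C resolvent D A z (S l v)"
        using resolvent_identity[OF p(4) zr rs[OF neg[OF l]], of v] linear_neg[OF Rl]
        by (simp add: S_def scaleC.minus_left scaleC.minus_right scaleC.add_left scaleC.diff_left)
      have "(of_real l + z) *\<^sub>C B (S l v) = z *\<^sub>C (of_real l + z) *\<^sub>C resolvent D A z (S l v) - (of_real l + z) *\<^sub>C S l v"
        by (simp add: B_def scaleC.diff_right scaleC_scaleC mult.commute)
      also have "\<dots> = z *\<^sub>C resolvent D A z v - of_real l *\<^sub>C S l v"
        unfolding id[symmetric] by (simp add: scaleC_add_left scaleC_add_right)
      finally have "cmod (of_real l + z) * norm (B (S l v)) = norm (z *\<^sub>C resolvent D A z v - of_real l *\<^sub>C S l v)"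
        by (metis norm_scaleC)
      also have "\<dots> \<le> cmod z * norm (resolvent D A z v) + l * norm (S l v)"
        using l by (intro order_trans[OF norm_triangle_ineq4]) (simp add: norm_scaleC)
      also have "\<dots> \<le> cmod z * (M / (1 + cmod z) * norm v) + l * (M / (1 + l) * norm v)"
        using l bd[OF zU] Sb[OF l] by (intro add_mono mult_left_mono) auto
      also have "\<dots> = cmod z / (1 + cmod z) * (M * norm v) + l / (1 + l) * (M * norm v)"
        by simp
      also have "\<dots> \<le> 1 * (M * norm v) + 1 * (M * norm v)"
      proof -
        have "cmod z / (1 + cmod z) \<le> 1" using norm_ge_zero[of z]
          by (subst divide_le_eq_1_pos) linarith+
        moreover have "l / (1 + l) \<le> 1" using l by simp
        ultimately show ?thesis using M by (intro add_mono mult_right_mono) auto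
      qed
      finally show ?thesis using ne by (simp add: field_simps)
    qed
    have Bk: "(B \<circ> k v) l = l powr (-\<alpha>) *\<^sub>R B (S l v)" for l by (simp add: k_def Bs)
    have "norm (B (neg_frac_power D A \<alpha> v)) \<le> C * cmod z powr (-\<alpha>) * norm v"
    proof (cases "k v integrable_on {0<..}")
      case True
      have "norm (integral {0<..} (B \<circ> k v)) \<le> (6 * M * norm v) * (1 / (1 - \<alpha>) + 1 / \<alpha>) * cmod z powr (-\<alpha>)"
      proof (rule norm_integral_powr_le[OF a _ _ integrable_linear[OF True Bl]])
        fix l :: real assume l: "0 < l"
        have pos: "0 < cmod (of_real l + z)" "0 < cmod z"
          using cmod_add_real_ge[OF l zre] z0 l by auto
        have "2 * M * norm v / cmod (of_real l + z) \<le> 6 * M * norm v / cmod z"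
        proof -
          have "2 * M * norm v / cmod (of_real l + z) = 4 * M * norm v / (2 * cmod (of_real l + z))" by simp
          also have "\<dots> \<le> 4 * M * norm v / cmod z"
            using pos M cmod_add_real_ge[OF l zre] by (intro divide_left_mono) auto
          also have "\<dots> \<le> 6 * M * norm v / cmod z" using M by (intro divide_right_mono mult_right_mono) auto
          finally show ?thesis .
        qed
        moreover have "2 * M * norm v / cmod (of_real l + z) \<le> 6 * M * norm v / l"
        proof -
          have "2 * M * norm v / cmod (of_real l + z) = 6 * M * norm v / (3 * cmod (of_real l + z))" by simp
          also have "\<dots> \<le> 6 * M * norm v / l"
            using pos l M cmod_add_real_ge[OF l zre] by (intro divide_left_mono) auto
          finally show ?thesis .
        qed
        ultimately have "norm (B (S l v)) \<le> 6 * M * norm v / cmod z" "norm (B (S l v)) \<le> 6 * M * norm v / l"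
          using BS[OF l] by linarith+
        then have "l powr (-\<alpha>) * norm (B (S l v)) \<le> l powr (-\<alpha>) * (6 * M * norm v / cmod z)"
          "l powr (-\<alpha>) * norm (B (S l v)) \<le> l powr (-\<alpha>) * (6 * M * norm v / l)" by (intro mult_left_mono; simp)+
        then show "norm ((B \<circ> k v) l) \<le> 6 * M * norm v * l powr (-\<alpha>) / cmod z"
          "norm ((B \<circ> k v) l) \<le> 6 * M * norm v * l powr (-\<alpha>) / l"
          unfolding Bk by (simp_all add: mult.commute)
      qed (use M z0 in auto)
      then have "\<bar>s\<bar> * norm (integral {0<..} (B \<circ> k v)) \<le> \<bar>s\<bar> * (6 * M * norm v * E * cmod z powr (-\<alpha>))"
        by (intro mult_left_mono) (auto simp: E_def)
      moreover have "B (neg_frac_power D A \<alpha> v) = s *\<^sub>R integral {0<..} (B \<circ> k v)"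
        by (simp add: nfp Bs integral_linear[OF True Bl])
      ultimately show ?thesis by (simp add: C_def mult_ac)
    qed (use \<open>0 \<le> C\<close> linear_0[OF bounded_linear.linear[OF Bl]] in \<open>simp add: nfp not_integrable_integral\<close>)
    then show ?thesis by (simp add: B_def)
  qed
  ultimately show ?thesis using that by blast
qed

section \<open>The trapezoidal sum as a residue sum\<close>

lemma continuous_on_Complex_Re [continuous_intros]:
  "continuous_on S (\<lambda>x. Complex x y)" "continuous_on S (\<lambda>y. Complex x y)"
  unfolding Complex_eq by (intro continuous_intros)+

lemma contour_integral_linepath_Complex_Im:
  assumes "a < b"
  shows "contour_integral (linepath (Complex a y) (Complex b y)) f = integral {a..b} (\<lambda>x. f (Complex x y))"
proof -
  have "contour_integral (linepath (Complex a y) (Complex b y)) f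
      = (Complex b y - Complex a y) * integral {0..1} (\<lambda>x. f (linepath (Complex a y) (Complex b y) x))"
    by (simp add: contour_integral_integral)
  also have "\<dots> = (Complex b y - Complex a y) * integral {0..1} (\<lambda>x. f (Complex (a + (b - a) * x) y))"
    by (simp add: linepath_def Complex_eq scaleR_conv_of_real algebra_simps)
  also have "\<dots> = of_real (b - a) * integral {0..(b - a) / (b - a)} (\<lambda>x. f (Complex (a + (b - a) * x) y))"
    using assms by (simp add: Complex_eq)
  also have "{0..(b - a) / (b - a)} = (\<lambda>x. x / (b - a)) ` {0..b - a}" using assms by simp
  also have "integral \<dots> (\<lambda>x. f (Complex (a + (b - a) * x) y)) =
             integral {a-a..b-a} (\<lambda>x. f (Complex (x + a) y)) / of_real (b - a)"
    using \<open>a < b\<close> by (subst integral_stretch_real) (auto simp: scaleR_conv_of_real add_ac)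
  also have "\<dots> = integral {a..b} (\<lambda>x. f (Complex x y)) / of_real (b - a)"
    by (subst integral_shift_real_ivl) (rule refl)
  finally show ?thesis using \<open>a < b\<close> by simp
qed

lemma contour_integral_rectangle:
  assumes x: "x1 < x2" and y: "y1 < y2"
    and f: "continuous_on (path_image (rectpath (Complex x1 y1) (Complex x2 y2))) f"
  shows "contour_integral (rectpath (Complex x1 y1) (Complex x2 y2)) f =
    integral {x1..x2} (\<lambda>x. f (Complex x y1)) + \<i> * integral {y1..y2} (\<lambda>y. f (Complex x2 y))
    - integral {x1..x2} (\<lambda>x. f (Complex x y2)) - \<i> * integral {y1..y2} (\<lambda>y. f (Complex x1 y))"
proof -
  let ?a = "Complex x1 y1" and ?b = "Complex x2 y1" and ?c = "Complex x2 y2" and ?d = "Complex x1 y2"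
  have r: "rectpath ?a ?c = linepath ?a ?b +++ linepath ?b ?c +++ linepath ?c ?d +++ linepath ?d ?a"
    by (simp add: rectpath_def Let_def)
  have P: "path_image (rectpath ?a ?c) = closed_segment ?a ?b \<union> (closed_segment ?b ?c \<union> (closed_segment ?c ?d \<union> closed_segment ?d ?a))"
    unfolding r by (simp add: path_image_join)
  have ci: "f contour_integrable_on (linepath u v)" if "closed_segment u v \<subseteq> path_image (rectpath ?a ?c)" for u v
    by (rule contour_integrable_continuous_linepath) (rule continuous_on_subset[OF f that])
  have "contour_integral (rectpath ?a ?c) f = contour_integral (linepath ?a ?b) f + (contour_integral (linepath ?b ?c) f +
     (contour_integral (linepath ?c ?d) f + contour_integral (linepath ?d ?a) f))"
  proof -
    have "f contour_integrable_on linepath ?a ?b" "f contour_integrable_on linepath ?b ?c"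
      "f contour_integrable_on linepath ?c ?d" "f contour_integrable_on linepath ?d ?a"
      by (rule ci, use P in blast)+
    then show ?thesis unfolding r
      by (simp add: contour_integral_join contour_integrable_joinI valid_path_join)
  qed
  moreover have "contour_integral (linepath ?c ?d) f = - contour_integral (linepath ?d ?c) f"
    "contour_integral (linepath ?d ?a) f = - contour_integral (linepath ?a ?d) f"
    using ci P by (metis contour_integral_reverse_linepath continuous_on_subset[OF f] closed_segment_commute Un_upper1 Un_upper2 order_trans)+
  ultimately show ?thesis using x y
    by (simp add: contour_integral_linepath_Complex_Im contour_integral_linepath_same_Re)
qed

text \<open>Stated with ordinary integrals over the four sides, because the sides are estimated separately.\<close>

lemma rectangle_residue_theorem:
  assumes x: "x1 < x2" and y: "y1 < y2"
    and S: "open S" "convex S" "cbox (Complex x1 y1) (Complex x2 y2) \<subseteq> S"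
    and P: "finite P" "P \<subseteq> box (Complex x1 y1) (Complex x2 y2)" and f: "f holomorphic_on S - P"
  shows "integral {x1..x2} (\<lambda>x. f (Complex x y1)) + \<i> * integral {y1..y2} (\<lambda>y. f (Complex x2 y))
    - integral {x1..x2} (\<lambda>x. f (Complex x y2)) - \<i> * integral {y1..y2} (\<lambda>y. f (Complex x1 y))
    = 2 * pi * \<i> * (\<Sum>p\<in>P. residue f p)"
proof -
  let ?g = "rectpath (Complex x1 y1) (Complex x2 y2)"
  have pi: "path_image ?g \<subseteq> S - P"
    using x y S(3) P(2) by (subst path_image_rectpath_cbox_minus_box) auto
  have "contour_integral ?g f = 2 * pi * \<i> * (\<Sum>p\<in>P. winding_number ?g p * residue f p)"
  proof (rule Residue_theorem)
    show "\<forall>z. z \<notin> S \<longrightarrow> winding_number ?g z = 0"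
      using S(3) x y by (auto intro!: winding_number_rectpath_outside)
  qed (use S P f pi convex_connected in auto)
  also have "(\<Sum>p\<in>P. winding_number ?g p * residue f p) = (\<Sum>p\<in>P. residue f p)"
    using P(2) by (intro sum.cong) (auto simp: winding_number_rectpath subset_iff)
  finally show ?thesis
    using contour_integral_rectangle[OF x y continuous_on_subset[OF holomorphic_on_imp_continuous_on[OF f] pi]]
    by simp
qed

lemma norm_integral_le_length:
  fixes f :: "real \<Rightarrow> complex"
  assumes "a \<le> b" "continuous_on {a..b} f" "\<And>x. x \<in> {a..b} \<Longrightarrow> cmod (f x) \<le> B"
  shows "cmod (integral {a..b} f) \<le> B * (b - a)"
  using integral_bound[of a b f B] assms by auto

definition sinc_exp :: "real \<Rightarrow> complex \<Rightarrow> complex" where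
  "sinc_exp h \<zeta> = exp (2 * pi * \<i> * \<zeta> / h)"

lemma norm_sinc_exp: "cmod (sinc_exp h \<zeta>) = exp (- 2 * pi * Im \<zeta> / h)"
  by (simp add: sinc_exp_def)

lemma sinc_exp_eq_1_iff:
  assumes "0 < h" shows "sinc_exp h \<zeta> = 1 \<longleftrightarrow> (\<exists>k::int. \<zeta> = of_real (of_int k * h))"
proof -
  have "sinc_exp h \<zeta> = 1 \<longleftrightarrow> Im \<zeta> = 0 \<and> (\<exists>k::int. Re \<zeta> = of_int k * h)"
    using assms by (simp add: sinc_exp_def exp_eq_1 field_simps)
  then show ?thesis by (auto simp: complex_eq_iff)
qed

text \<open>Near a grid point \<open>k h\<close> the denominator behaves like \<open>(2 \<pi> \<i> / h) (\<zeta> - k h)\<close>.\<close>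

lemma residue_sinc_kernel:
  assumes h: "0 < h" and S: "open S" "of_real (of_int k * h) \<in> S" and F: "F holomorphic_on S"
  shows "residue (\<lambda>\<zeta>. F \<zeta> / (sinc_exp h \<zeta> - 1)) (of_real (of_int k * h)) = F (of_real (of_int k * h)) * h / (2 * pi * \<i>)"
proof -
  let ?p = "of_real (of_int k * h) :: complex"
  have qp: "sinc_exp h ?p = 1" using sinc_exp_eq_1_iff[OF h] by blast
  have D: "(sinc_exp h has_field_derivative (2 * pi * \<i> / h)) (at ?p)"
    using qp h unfolding sinc_exp_def[abs_def] by (auto intro!: derivative_eq_intros simp: field_simps)
  have fin: "open (S \<inter> ball ?p h)" using S by auto
  have nz: "sinc_exp h \<zeta> \<noteq> 1" if "\<zeta> \<in> ball ?p h" "\<zeta> \<noteq> ?p" for \<zeta>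
  proof
    assume "sinc_exp h \<zeta> = 1"
    then obtain m :: int where m: "\<zeta> = of_real (of_int m * h)" using sinc_exp_eq_1_iff[OF h] by auto
    then have "\<zeta> - ?p = of_real (of_int (m - k) * h)" by (simp add: algebra_simps)
    then have "cmod (\<zeta> - ?p) = \<bar>of_int (m - k) * h\<bar>" by (metis norm_of_real)
    then have "\<bar>of_int (m - k)\<bar> * h < h" using that h by (simp add: dist_norm norm_minus_commute abs_mult)
    then have "\<bar>real_of_int (m - k)\<bar> < 1" using h by simp
    then have "m = k" by linarith
    then show False using m that by simp
  qed
  show ?thesis
  proof (rule residue_simple'[OF fin])
    show "?p \<in> S \<inter> ball ?p h" using S h by simp
    show "(\<lambda>\<zeta>. F \<zeta> / (sinc_exp h \<zeta> - 1)) holomorphic_on S \<inter> ball ?p h - {?p}"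
      using nz unfolding sinc_exp_def
      by (intro holomorphic_intros holomorphic_on_subset[OF F]) (use h in auto)
    have lq: "((\<lambda>w. (sinc_exp h w - sinc_exp h ?p) / (w - ?p)) \<longlongrightarrow> 2 * pi * \<i> / h) (at ?p)"
      using D by (simp add: has_field_derivative_iff)
    have lF: "(F \<longlongrightarrow> F ?p) (at ?p)"
      using F S holomorphic_on_imp_continuous_on[of F S] by (auto simp: continuous_on_eq_continuous_at isCont_def)
    have "((\<lambda>w. F w / ((sinc_exp h w - sinc_exp h ?p) / (w - ?p))) \<longlongrightarrow> F ?p / (2 * pi * \<i> / h)) (at ?p)"
      by (rule tendsto_divide[OF lF lq]) (use h in simp)
    then show "((\<lambda>w. F w / (sinc_exp h w - 1) * (w - ?p)) \<longlongrightarrow> F ?p * h / (2 * pi * \<i>)) (at ?p)"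
      using qp by (simp add: field_simps)
  qed
qed

text \<open>The residues of \<open>F / (q - 1)\<close>, \<open>q = exp (2 \<pi> \<i> \<zeta> / h)\<close>, add up to the trapezoidal sum. On the upper side
\<open>- 1 / (q - 1) = 1 + q / (1 - q)\<close>, and the summand 1 produces the integral of \<open>F\<close>, which Cauchy's
theorem moves back to the real axis. The vertical sides lie halfway between two grid points, where \<open>q\<close> is
negative and so \<open>\<bar>q - 1\<bar> \<ge> 1\<close>.\<close>

lemma sinc_rectangle:
  fixes F :: "complex \<Rightarrow> complex" and h d D B :: real and M :: nat
  defines "X \<equiv> (M + 1/2) * h"
  assumes h: "0 < h" and d: "0 < d" "d < D"
    and F: "F holomorphic_on {\<zeta>. \<bar>Im \<zeta>\<bar> < D}"
    and B: "\<And>x y. \<bar>x\<bar> = X \<Longrightarrow> \<bar>y\<bar> \<le> d \<Longrightarrow> cmod (F (Complex x y)) \<le> B"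
  shows "cmod (h * (\<Sum>k=- int M..int M. F (of_real (of_int k * h))) - integral {-X..X} (\<lambda>x. F (of_real x)))
    \<le> cmod (integral {-X..X} (\<lambda>x. F (Complex x (-d)) / (sinc_exp h (Complex x (-d)) - 1)))
      + cmod (integral {-X..X} (\<lambda>x. F (Complex x d) * sinc_exp h (Complex x d) / (1 - sinc_exp h (Complex x d))))
      + 6 * d * B"
proof -
  define G where "G \<zeta> = F \<zeta> / (sinc_exp h \<zeta> - 1)" for \<zeta>
  define P where "P = (\<lambda>k::int. of_real (of_int k * h) :: complex) ` {- int M..int M}"
  define S where "S = {\<zeta>. \<bar>Im \<zeta>\<bar> < D} \<inter> {\<zeta>. \<bar>Re \<zeta>\<bar> < (M + 1) * h}"
  have X0: "0 < X" using h by (simp add: X_def)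
  have strip: "{\<zeta>. \<bar>f \<zeta>\<bar> < r} = {\<zeta>. f \<zeta> < r} \<inter> {\<zeta>. f \<zeta> > - r}" for f :: "complex \<Rightarrow> real" and r by auto
  have oS: "open {\<zeta>::complex. \<bar>Im \<zeta>\<bar> < D}" "open S"
    unfolding S_def by (intro open_Int open_Collect_less continuous_intros)+
  have cS: "convex S" unfolding S_def strip
    by (intro convex_Int convex_halfspace_Im_lt convex_halfspace_Im_gt convex_halfspace_Re_lt convex_halfspace_Re_gt)
  have inj: "inj_on (\<lambda>k::int. of_real (of_int k * h) :: complex) {- int M..int M}"
    using h by (auto simp: inj_on_def)
  have XM: "X < (M + 1) * h" "M * h < X" using h by (auto simp: X_def)
  have Pint: "\<bar>of_int k * h\<bar> < X" if "k \<in> {- int M..int M}" for k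
  proof -
    have "\<bar>real_of_int k\<bar> \<le> M" using that by auto
    then have "\<bar>of_int k * h\<bar> \<le> M * h" using h by (simp add: abs_mult mult_right_mono)
    then show ?thesis using XM by simp
  qed
  have q1: "sinc_exp h \<zeta> \<noteq> 1" if "\<zeta> \<in> S - P" for \<zeta>
  proof
    assume "sinc_exp h \<zeta> = 1"
    then obtain k :: int where k: "\<zeta> = of_real (of_int k * h)" using sinc_exp_eq_1_iff[OF h] by auto
    then have "\<bar>of_int k * h\<bar> < (M + 1) * h" using that by (simp add: S_def)
    then have "\<bar>real_of_int k\<bar> < M + 1" using h by (simp add: abs_mult)
    then have "k \<in> {- int M..int M}" by auto
    then show False using that k by (auto simp: P_def)
  qed
  have hq: "sinc_exp h holomorphic_on A" for A
    unfolding sinc_exp_def[abs_def] using h by (intro holomorphic_intros) auto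
  have hG: "G holomorphic_on S - P"
    unfolding G_def[abs_def] using q1 F
    by (intro holomorphic_intros hq) (auto intro: holomorphic_on_subset simp: S_def)
  have box: "cbox (Complex (-X) (-d)) (Complex X d) \<subseteq> S"
    using XM d by (auto simp: S_def in_cbox_complex_iff)
  have res: "integral {-X..X} (\<lambda>x. G (Complex x (-d))) + \<i> * integral {-d..d} (\<lambda>y. G (Complex X y))
    - integral {-X..X} (\<lambda>x. G (Complex x d)) - \<i> * integral {-d..d} (\<lambda>y. G (Complex (-X) y))
    = 2 * pi * \<i> * (\<Sum>p\<in>P. residue G p)"
    by (rule rectangle_residue_theorem[OF _ _ oS(2) cS box _ _ hG])
       (use X0 d Pint in \<open>force simp: P_def in_box_complex_iff abs_less_iff\<close>)+
  have "(\<Sum>p\<in>P. residue G p) = (\<Sum>k=- int M..int M. F (of_real (of_int k * h)) * h / (2 * pi * \<i>))"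
    unfolding P_def sum.reindex[OF inj] o_def G_def
    by (intro sum.cong refl residue_sinc_kernel[OF h oS(1) _ F]) (use d in auto)
  also have "2 * pi * \<i> * \<dots> = h * (\<Sum>k=- int M..int M. F (of_real (of_int k * h)))"
    by (simp add: sum_distrib_left mult.commute)
  finally have sum: "2 * pi * \<i> * (\<Sum>p\<in>P. residue G p) = \<dots>" .
  have cauchy: "integral {-X..X} (\<lambda>x. F (Complex x 0)) + \<i> * integral {0..d} (\<lambda>y. F (Complex X y))
    - integral {-X..X} (\<lambda>x. F (Complex x d)) - \<i> * integral {0..d} (\<lambda>y. F (Complex (-X) y)) = 2 * pi * \<i> * (\<Sum>p\<in>{}. residue F p)"
    by (rule rectangle_residue_theorem[where S = S])
       (use X0 d oS(2) cS box F in \<open>auto simp: in_cbox_complex_iff S_def subset_iff intro: holomorphic_on_subset\<close>)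
  have cont: "continuous_on I (\<lambda>t. F (g t))"
    if "continuous_on I g" "\<And>t. t \<in> I \<Longrightarrow> \<bar>Im (g t)\<bar> \<le> d" for I :: "real set" and g
    by (rule continuous_on_compose2[OF holomorphic_on_imp_continuous_on[OF F] that(1)]) (use that(2) d in force)
  have contG: "continuous_on I (\<lambda>t. G (g t))"
    if "continuous_on I g" "\<And>t. t \<in> I \<Longrightarrow> g t \<in> S - P" for I :: "real set" and g
    by (rule continuous_on_compose2[OF holomorphic_on_imp_continuous_on[OF hG] that(1)]) (use that(2) in force)
  have up: "- integral {-X..X} (\<lambda>x. G (Complex x d)) = integral {-X..X} (\<lambda>x. F (Complex x d))
      + integral {-X..X} (\<lambda>x. F (Complex x d) * sinc_exp h (Complex x d) / (1 - sinc_exp h (Complex x d)))"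
  proof -
    have n1: "sinc_exp h (Complex x d) \<noteq> 1" for x
      using norm_sinc_exp[of h "Complex x d"] d h by (auto simp: divide_less_0_iff)
    have cq: "continuous_on {-X..X} (\<lambda>x. sinc_exp h (Complex x d))"
      by (rule continuous_on_compose2[OF holomorphic_on_imp_continuous_on[OF hq, of UNIV]]) (auto intro!: continuous_intros)
    have "- integral {-X..X} (\<lambda>x. G (Complex x d)) = integral {-X..X} (\<lambda>x. F (Complex x d)
      + F (Complex x d) * sinc_exp h (Complex x d) / (1 - sinc_exp h (Complex x d)))"
      unfolding integral_neg[symmetric] G_def
    proof (rule integral_cong)
      fix x
      have "sinc_exp h (Complex x d) - 1 \<noteq> 0" "1 - sinc_exp h (Complex x d) \<noteq> 0" using n1[of x] by auto
      then show "- (F (Complex x d) / (sinc_exp h (Complex x d) - 1)) = F (Complex x d)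
        + F (Complex x d) * sinc_exp h (Complex x d) / (1 - sinc_exp h (Complex x d))"
        by (simp add: divide_simps) (simp add: algebra_simps)
    qed
    also have "\<dots> = integral {-X..X} (\<lambda>x. F (Complex x d))
      + integral {-X..X} (\<lambda>x. F (Complex x d) * sinc_exp h (Complex x d) / (1 - sinc_exp h (Complex x d)))"
      using n1 d by (intro integral_add integrable_continuous_interval continuous_intros cq cont)
        (auto simp: eq_commute[of 1])
    finally show ?thesis .
  qed
  have qX: "cmod (G (Complex x y)) \<le> B" if "\<bar>x\<bar> = X" "\<bar>y\<bar> \<le> d" for x y
  proof -
    have "sinc_exp h (Complex x y) = exp (\<i> * of_real (2 * pi * x / h)) * exp (of_real (- 2 * pi * y / h))"
      unfolding sinc_exp_def exp_add[symmetric] using h by (simp add: Complex_eq field_simps)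
    also have "exp (\<i> * of_real (2 * pi * x / h)) = -1"
    proof -
      have "2 * pi * X / h = (2 * M + 1) * pi" using h by (simp add: X_def field_simps)
      then have "exp (\<i> * of_real (2 * pi * X / h)) = cis ((2 * M + 1) * pi)"
        by (simp add: cis_conv_exp)
      also have "\<dots> = -1" by (simp add: complex_eq_iff distrib_right cos_add sin_add)
      finally have *: "exp (\<i> * of_real (2 * pi * X / h)) = -1" .
      have "exp (\<i> * of_real (2 * pi * (- X) / h)) = inverse (exp (\<i> * of_real (2 * pi * X / h)))"
        by (simp add: exp_minus[symmetric])
      then show ?thesis using * that by (cases "x = X") (auto simp: abs_if split: if_splits)
    qed
    also have "-1 * exp (of_real (- 2 * pi * y / h)) = of_real (- exp (- 2 * pi * y / h))"
      by (simp add: exp_of_real[symmetric])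
    finally have "cmod (sinc_exp h (Complex x y) - 1) = exp (- 2 * pi * y / h) + 1"
      by (metis (no_types, lifting) abs_minus_cancel abs_of_pos add_pos_pos exp_gt_zero minus_add_distrib norm_of_real of_real_1 of_real_diff uminus_add_conv_diff zero_less_one add.commute)
    then have "1 \<le> cmod (sinc_exp h (Complex x y) - 1)" by simp
    then have "cmod (F (Complex x y)) / cmod (sinc_exp h (Complex x y) - 1) \<le> cmod (F (Complex x y)) / 1"
      by (intro divide_left_mono) auto
    then show ?thesis using B[OF that] by (simp add: G_def norm_divide)
  qed
  have sP: "Complex x y \<in> S - P" if "\<bar>x\<bar> = X" "\<bar>y\<bar> \<le> d" for x y
    using that XM(1) d Pint by (fastforce simp: S_def P_def complex_eq_iff)
  have b1: "cmod (integral {-d..d} (\<lambda>y. G (Complex x y))) \<le> B * (d - - d)" if "\<bar>x\<bar> = X" for x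
    using d that by (intro norm_integral_le_length contG qX continuous_intros sP) auto
  have b2: "cmod (integral {0..d} (\<lambda>y. F (Complex x y))) \<le> B * (d - 0)" if "\<bar>x\<bar> = X" for x
    using d that by (intro norm_integral_le_length cont B continuous_intros) auto
  define l u r1 r2 s1 s2 where "l = integral {-X..X} (\<lambda>x. G (Complex x (-d)))"
    and "u = integral {-X..X} (\<lambda>x. F (Complex x d) * sinc_exp h (Complex x d) / (1 - sinc_exp h (Complex x d)))"
    and "r1 = \<i> * integral {-d..d} (\<lambda>y. G (Complex X y))" and "r2 = \<i> * integral {-d..d} (\<lambda>y. G (Complex (-X) y))"
    and "s1 = \<i> * integral {0..d} (\<lambda>y. F (Complex X y))" and "s2 = \<i> * integral {0..d} (\<lambda>y. F (Complex (-X) y))"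
  have "h * (\<Sum>k=- int M..int M. F (of_real (of_int k * h))) - integral {-X..X} (\<lambda>x. F (of_real x))
      = l + u + (r1 + (- r2) + s1 + (- s2))"
  proof -
    have "h * (\<Sum>k=- int M..int M. F (of_real (of_int k * h))) = l + r1 + (- integral {-X..X} (\<lambda>x. G (Complex x d))) - r2"
      using res unfolding sum l_def r1_def r2_def by simp
    moreover have "integral {-X..X} (\<lambda>x. F (Complex x d)) = integral {-X..X} (\<lambda>x. F (Complex x 0)) + s1 - s2"
      using cauchy by (simp add: s1_def s2_def algebra_simps)
    ultimately show ?thesis unfolding up u_def by (simp add: complex_of_real_def)
  qed
  also have "cmod \<dots> \<le> cmod l + cmod u + (cmod r1 + cmod r2 + cmod s1 + cmod s2)"
    by (intro norm_triangle_le order_trans[OF norm_triangle_ineq] add_mono order_refl) (simp_all add: norm_triangle_le)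
  also have "\<dots> \<le> cmod l + cmod u + (B * (d - - d) + B * (d - - d) + B * (d - 0) + B * (d - 0))"
    unfolding r1_def r2_def s1_def s2_def norm_mult using b1 b2 X0 by (intro add_mono) auto
  finally show ?thesis by (simp add: l_def u_def G_def algebra_simps)
qed

section \<open>Functions of positive real part in the half plane\<close>

lemma le_if_le_add_inverse:
  fixes a J K B :: real
  assumes "\<And>Y. 2 \<le> Y \<Longrightarrow> J \<le> K + B / Y"
  shows "J \<le> K"
proof (rule LIMSEQ_le_const)
  show "(\<lambda>n. K + B / real n) \<longlonglongrightarrow> K"
    using tendsto_add[OF tendsto_const lim_const_over_n, of K B] by simp
  show "\<exists>N. \<forall>n\<ge>N. J \<le> K + B / real n"
    using assms by (intro exI[of _ 2]) auto
qed

text \<open>Cauchy's formula for \<open>G\<close> with the kernel \<open>1 / (1 - (z - c)\<^sup>2)\<close>, \<open>c = e + \<i> y\<^sub>0\<close>, on large squares: on the line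
\<open>Re z = e\<close> the kernel is the positive function \<open>1 / (1 + (y - y\<^sub>0)\<^sup>2)\<close>, which is at least \<open>1/2\<close> on the segment,
and to the right of that line its only pole is \<open>c + 1\<close>. The bound \<open>B\<close>, which may blow up as \<open>e\<close> tends to 0,
serves to discard the other sides of the square in the limit.\<close>

lemma half_plane_harnack:
  assumes G: "G holomorphic_on {z. 0 < Re z}" and e: "0 < e"
    and B: "\<And>z. e \<le> Re z \<Longrightarrow> cmod (G z) \<le> B"
    and pos: "\<And>z. 0 < Re z \<Longrightarrow> 0 \<le> Re (G z)"
  shows "integral {y0 - 1..y0 + 1} (\<lambda>y. Re (G (Complex e y))) \<le> 2 * pi * Re (G (Complex (e + 1) y0))"
    (is "?J \<le> _")
proof (rule le_if_le_add_inverse)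
  fix Y :: real assume Y: "2 \<le> Y"
  define c where "c = Complex e y0"
  define p where "p = Complex (e + 1) y0"
  define k where "k z = G z / (1 - (z - c)\<^sup>2)" for z
  \<comment> \<open>The second pole \<open>c - 1\<close> of the kernel is kept outside \<open>S\<close>.\<close>
  define S where "S = {z. max 0 (e - 1) < Re z}"
  have B0: "0 \<le> B" using order_trans[OF norm_ge_zero B[of "of_real e"]] by simp
  have ne: "1 - (z - c)\<^sup>2 \<noteq> 0" if "z \<in> S" "z \<noteq> p" for z
  proof
    assume "1 - (z - c)\<^sup>2 = 0"
    then have "(z - c - 1) * (z - c + 1) = 0" by (simp add: power2_eq_square algebra_simps)
    then have "z - c - 1 = 0 \<or> z - c + 1 = 0" by (simp only: mult_eq_0_iff)
    then show False using that by (auto simp: S_def p_def c_def complex_eq_iff)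
  qed
  have oS: "open S" unfolding S_def by (intro open_Collect_less continuous_intros)
  have cS: "convex S" unfolding S_def by (rule convex_halfspace_Re_gt)
  have GS: "G holomorphic_on S" by (rule holomorphic_on_subset[OF G]) (auto simp: S_def)
  have kh: "k holomorphic_on S - {p}"
    unfolding k_def[abs_def] using ne by (intro holomorphic_intros holomorphic_on_subset[OF GS]) auto
  have res: "residue k p = - G p / 2"
  proof -
    have "k = (\<lambda>z. (- G z / (z - c + 1)) / (z - p))"
    proof
      fix z
      have "1 - (z - c)\<^sup>2 = - ((z - c + 1) * (z - p))"
        by (simp add: p_def c_def Complex_eq power2_eq_square algebra_simps)
      then show "k z = (- G z / (z - c + 1)) / (z - p)" by (simp add: k_def)
    qed
    moreover have "residue (\<lambda>z. (- G z / (z - c + 1)) / (z - p)) p = - G p / (p - c + 1)"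
    proof (rule residue_simple[OF oS])
      show "p \<in> S" using e by (simp add: S_def p_def)
      have "z - c + 1 \<noteq> 0" if "z \<in> S" for z using that by (auto simp: S_def c_def complex_eq_iff)
      then show "(\<lambda>z. - G z / (z - c + 1)) holomorphic_on S" by (intro holomorphic_intros GS) auto
    qed
    moreover have "p - c + 1 = 2" by (simp add: p_def c_def complex_eq_iff)
    ultimately show ?thesis by simp
  qed
  have rect: "integral {e..e+Y} (\<lambda>x. k (Complex x (y0-Y))) + \<i> * integral {y0-Y..y0+Y} (\<lambda>y. k (Complex (e+Y) y))
    - integral {e..e+Y} (\<lambda>x. k (Complex x (y0+Y))) - \<i> * integral {y0-Y..y0+Y} (\<lambda>y. k (Complex e y))
    = 2 * pi * \<i> * (\<Sum>p\<in>{p}. residue k p)"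
    by (rule rectangle_residue_theorem[OF _ _ oS cS _ _ _ kh])
       (use Y e in \<open>auto simp: S_def p_def in_cbox_complex_iff in_box_complex_iff\<close>)
  define b t r l where "b = integral {e..e+Y} (\<lambda>x. k (Complex x (y0-Y)))"
    and "t = integral {e..e+Y} (\<lambda>x. k (Complex x (y0+Y)))"
    and "r = integral {y0-Y..y0+Y} (\<lambda>y. k (Complex (e+Y) y))"
    and "l = integral {y0-Y..y0+Y} (\<lambda>y. k (Complex e y))"
  have "b + \<i> * r - t - \<i> * l = - (pi * \<i> * G p)" using rect res by (simp add: b_def t_def r_def l_def)
  then have "\<i> * l = \<i> * (pi * G p + r) + (b - t)" by (simp add: algebra_simps)
  then have "\<i> * l = \<i> * (pi * G p + r - \<i> * (b - t))" by (simp add: algebra_simps)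
  then have l_eq: "l = pi * G p + r - \<i> * (b - t)" by simp
  have kb: "cmod (k z) \<le> 2 * B / Y\<^sup>2" if "e \<le> Re z" "Y \<le> cmod (z - c)" for z
  proof -
    have "Y\<^sup>2 \<le> cmod ((z - c)\<^sup>2)" using that Y by (simp add: norm_power power_mono)
    moreover have "4 \<le> Y\<^sup>2" using power_mono[of 2 Y 2] Y by simp
    ultimately have "Y\<^sup>2 / 2 \<le> cmod (1 - (z - c)\<^sup>2)"
      using norm_triangle_ineq3[of 1 "(z - c)\<^sup>2"] by simp
    then have "cmod (k z) \<le> B / (Y\<^sup>2 / 2)"
      unfolding k_def norm_divide using B[OF that(1)] Y B0 by (intro frac_le) auto
    then show ?thesis by (simp add: mult.commute)
  qed
  have cont: "continuous_on I (\<lambda>x. k (g x))" if "continuous_on I g" "\<And>x. x \<in> I \<Longrightarrow> g x \<in> S - {p}" for I :: "real set" and g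
    by (rule continuous_on_compose2[OF holomorphic_on_imp_continuous_on[OF kh] that(1)]) (use that(2) in force)
  have far: "Y \<le> cmod (Complex x (y0 - Y) - c)" "Y \<le> cmod (Complex x (y0 + Y) - c)" "Y \<le> cmod (Complex (e + Y) y - c)" for x y
    using abs_Im_le_cmod[of "Complex x (y0 - Y) - c"] abs_Im_le_cmod[of "Complex x (y0 + Y) - c"]
      abs_Re_le_cmod[of "Complex (e + Y) y - c"] Y by (auto simp: c_def)
  have inS: "Complex x y \<in> S" if "e \<le> x" for x y using that e by (auto simp: S_def)
  have "cmod b \<le> 2 * B / Y\<^sup>2 * (e + Y - e)" "cmod t \<le> 2 * B / Y\<^sup>2 * (e + Y - e)"
    "cmod r \<le> 2 * B / Y\<^sup>2 * (y0 + Y - (y0 - Y))"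
    unfolding b_def t_def r_def using Y
    by (intro norm_integral_le_length cont kb far continuous_intros; auto simp: p_def inS)+
  then have bd: "cmod b \<le> 2 * B / Y" "cmod t \<le> 2 * B / Y" "cmod r \<le> 4 * B / Y"
    using Y by (auto simp: power2_eq_square)
  have lint: "(\<lambda>y. k (Complex e y)) integrable_on {y0-Y..y0+Y}"
    by (intro integrable_continuous_interval cont continuous_intros) (auto simp: inS p_def)
  have kre: "Re (k (Complex e y)) = Re (G (Complex e y)) / (1 + (y - y0)\<^sup>2)" for y
  proof -
    have "1 - (Complex e y - c)\<^sup>2 = of_real (1 + (y - y0)\<^sup>2)"
      by (simp add: c_def complex_eq_iff power2_eq_square)
    then show ?thesis by (simp add: k_def del: of_real_add of_real_power)
  qed
  have Rl: "((\<lambda>y. Re (k (Complex e y))) has_integral Re l) {y0-Y..y0+Y}"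
    unfolding l_def using has_integral_linear[OF integrable_integral[OF lint] bounded_linear_Re] by (simp add: o_def)
  have k0: "0 \<le> Re (k (Complex e y))" for y
    unfolding kre using pos[of "Complex e y"] e by (auto intro!: divide_nonneg_pos add_pos_nonneg)
  have Gc: "continuous_on A (\<lambda>y. Re (G (Complex e y)))" for A
    by (intro continuous_intros continuous_on_compose2[OF holomorphic_on_imp_continuous_on[OF G]]) (use e in auto)
  have "?J / 2 = integral {y0-1..y0+1} (\<lambda>y. Re (G (Complex e y)) / 2)"
    by simp
  also have "\<dots> \<le> integral {y0-1..y0+1} (\<lambda>y. Re (k (Complex e y)))"
  proof (rule integral_le)
    show "(\<lambda>y. Re (k (Complex e y))) integrable_on {y0-1..y0+1}"
      using integrable_on_subinterval[OF has_integral_integrable[OF Rl]] Y by auto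
    fix y assume "y \<in> {y0-1..y0+1}"
    then have "(y - y0)\<^sup>2 \<le> 1\<^sup>2" by (intro power2_le_iff_abs_le[THEN iffD2]) auto
    then show "Re (G (Complex e y)) / 2 \<le> Re (k (Complex e y))"
      unfolding kre using pos[of "Complex e y"] e by (intro divide_left_mono) (auto intro!: mult_pos_pos add_pos_nonneg)
  qed (intro integrable_continuous_interval continuous_on_divide continuous_on_const Gc ballI; simp)
  also have "\<dots> \<le> integral {y0-Y..y0+Y} (\<lambda>y. Re (k (Complex e y)))"
    using Y k0 has_integral_integrable[OF Rl]
    by (intro integral_subset_le) (auto intro: integrable_on_subinterval)
  also have "\<dots> = Re l" using Rl by (rule integral_unique)
  also have "\<dots> \<le> pi * Re (G p) + (cmod r + cmod (b - t))"
    unfolding l_eq using complex_Re_le_cmod[of r] complex_Re_le_cmod[of "- \<i> * (b - t)"] by (simp add: norm_mult)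
  also have "\<dots> \<le> pi * Re (G p) + (4 * B / Y + (2 * B / Y + 2 * B / Y))"
    using bd norm_triangle_ineq4[of b t] by (intro add_left_mono) linarith
  finally show "?J \<le> 2 * pi * Re (G (Complex (e + 1) y0)) + 16 * B / Y" by (simp add: p_def)
qed

lemma summable_shifted_powr: "0 < \<alpha> \<Longrightarrow> summable (\<lambda>m. (1 + real m) powr (- 1 - \<alpha>))"
  using summable_real_powr_iff[of "-1-\<alpha>"] summable_Suc_iff[of "\<lambda>m. real m powr (-1-\<alpha>)"] by (simp add: add.commute)

text \<open>Only the averages of \<open>v\<close> over segments of fixed length are controlled, so the weight is replaced by its
maximum on each unit interval and the maxima are summed.\<close>

lemma integral_unit_bounded_weight:
  fixes v :: "real \<Rightarrow> real"
  assumes a: "0 < \<alpha>" and v: "continuous_on UNIV v" "\<And>y. 0 \<le> v y"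
    and A: "\<And>y0. integral {y0 - 1..y0 + 1} v \<le> A" and Y: "0 \<le> Y"
  shows "integral {-Y..Y} (\<lambda>y. v y * (1 + \<bar>y\<bar>) powr (- 1 - \<alpha>)) \<le> 2 * A * (\<Sum>m. (1 + real m) powr (- 1 - \<alpha>))"
proof -
  let ?w = "\<lambda>y::real. (1 + \<bar>y\<bar>) powr (- 1 - \<alpha>)"
  let ?Z = "\<Sum>m. (1 + real m) powr (- 1 - \<alpha>)"
  have A0: "0 \<le> A" using A[of 0] integral_nonneg[of v "{-1..1}"] v
    by (metis (no_types, lifting) add_0 diff_0 integrable_continuous_interval continuous_on_subset order_trans subset_UNIV)
  have half: "integral {0..real N} (\<lambda>y. u y * ?w y) \<le> A * ?Z"
    if u: "continuous_on UNIV u" "\<And>y. 0 \<le> u y" "\<And>y0. integral {y0 - 1..y0 + 1} u \<le> A" for u N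
  proof -
    have c: "continuous_on I (\<lambda>y. u y * ?w y)" for I
      by (intro continuous_intros continuous_on_subset[OF u(1)]) auto
    have "integral {0..real N} (\<lambda>y. u y * ?w y) \<le> (\<Sum>m<N. A * (1 + real m) powr (- 1 - \<alpha>))"
    proof (induction N)
      case (Suc N)
      have split: "integral {0..real (Suc N)} (\<lambda>y. u y * ?w y)
          = integral {0..real N} (\<lambda>y. u y * ?w y) + integral {real N..real (Suc N)} (\<lambda>y. u y * ?w y)"
        by (rule Henstock_Kurzweil_Integration.integral_combine[symmetric])
           (auto intro: integrable_continuous_interval c)
      have "integral {real N..real (Suc N)} (\<lambda>y. u y * ?w y)
          \<le> integral {real N..real (Suc N)} (\<lambda>y. (1 + real N) powr (- 1 - \<alpha>) * u y)"
      proof (rule integral_le)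
        fix y assume y: "y \<in> {real N..real (Suc N)}"
        then have "?w y \<le> (1 + real N) powr (- 1 - \<alpha>)" using a by (intro powr_mono2') auto
        then show "u y * ?w y \<le> (1 + real N) powr (- 1 - \<alpha>) * u y"
          using u(2)[of y] by (metis mult.commute mult_left_mono)
      qed (intro integrable_continuous_interval continuous_intros c continuous_on_subset[OF u(1)]; simp)+
      also have "\<dots> = (1 + real N) powr (- 1 - \<alpha>) * integral {real N..real (Suc N)} u" by simp
      also have "integral {real N..real (Suc N)} u \<le> A"
        by (rule order_trans[OF integral_subset_le u(3)[of "real N"]])
           (use u in \<open>auto intro!: integrable_continuous_interval intro: continuous_on_subset\<close>)
      finally have "integral {real N..real (Suc N)} (\<lambda>y. u y * ?w y) \<le> A * (1 + real N) powr (- 1 - \<alpha>)"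
        by (simp add: mult.commute)
      then show ?case using Suc split by simp
    qed simp
    also have "\<dots> = A * (\<Sum>m<N. (1 + real m) powr (- 1 - \<alpha>))" by (simp add: sum_distrib_left)
    also have "\<dots> \<le> A * ?Z"
      using A0 by (intro mult_left_mono sum_le_suminf summable_shifted_powr a) auto
    finally show ?thesis .
  qed
  obtain N :: nat where N: "Y \<le> real N" using real_arch_simple by blast
  have c: "continuous_on I (\<lambda>y. v y * ?w y)" for I
    by (intro continuous_intros continuous_on_subset[OF v(1)]) auto
  note ci = integrable_continuous_interval[OF c]
  have "integral {-Y..Y} (\<lambda>y. v y * ?w y) \<le> integral {- real N..real N} (\<lambda>y. v y * ?w y)"
    using N Y v(2) by (intro integral_subset_le ci) auto
  also have "\<dots> = integral {- real N..0} (\<lambda>y. v y * ?w y) + integral {0..real N} (\<lambda>y. v y * ?w y)"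
    by (rule Henstock_Kurzweil_Integration.integral_combine[symmetric]) (auto intro: ci)
  also have "integral {- real N..0} (\<lambda>y. v y * ?w y) = integral {- real N..-0} (\<lambda>y. (\<lambda>y. v (- y) * ?w y) (- y))" by simp
  also have "\<dots> = integral {0..real N} (\<lambda>y. v (- y) * ?w y)"
    using Henstock_Kurzweil_Integration.integral_reflect_real[of "real N" 0 "\<lambda>y. v (- y) * ?w y"] by simp
  also have "\<dots> \<le> A * ?Z"
  proof (rule half)
    show "continuous_on UNIV (\<lambda>y. v (- y))" by (rule continuous_on_compose2[OF v(1)]) (auto intro: continuous_intros)
    fix y0
    have "integral {y0 - 1..y0 + 1} (\<lambda>y. v (- y)) = integral {- y0 - 1..- y0 + 1} v"
      using Henstock_Kurzweil_Integration.integral_reflect_real[of "1 - y0" "- y0 - 1" v] by (simp add: algebra_simps)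
    then show "integral {y0 - 1..y0 + 1} (\<lambda>y. v (- y)) \<le> A" using A[of "- y0"] by simp
  qed (use v in auto)
  also have "integral {0..real N} (\<lambda>y. v y * ?w y) \<le> A * ?Z" by (rule half) (use v A in auto)
  finally show ?thesis by simp
qed

section \<open>The factor \<open>1 / (1 + I)\<close> near the imaginary axis\<close>

text \<open>The function \<open>S\<close> below is \<open>I\<^sub>n\<close> as a function of \<open>z\<close>, with \<open>p j\<close> in place of \<open>T/2 \<omega>\<^sub>j w(\<xi>\<^sub>j)\<close>.\<close>

locale damped_exp_sum =
  fixes p \<xi> :: "nat \<Rightarrow> real" and n :: nat and T :: real
  assumes p_nonneg: "j \<le> n \<Longrightarrow> 0 \<le> p j" and p_sum: "(\<Sum>j\<le>n. p j) \<le> 1"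
    and xi_pos: "j \<le> n \<Longrightarrow> 0 < \<xi> j" and xi_le: "j \<le> n \<Longrightarrow> \<xi> j \<le> T"
begin

definition S :: "complex \<Rightarrow> complex" where "S z = (\<Sum>j\<le>n. of_real (p j) * exp (- z * of_real (\<xi> j)))"
definition f :: "complex \<Rightarrow> complex" where "f z = inverse (1 + S z)"
definition \<sigma> :: real where "\<sigma> = Min (\<xi> ` {..n})"
definition f_bound :: "real \<Rightarrow> real" where "f_bound x = 1 / (1 - exp (- x * \<sigma>))"

lemma sigma: "0 < \<sigma>" "j \<le> n \<Longrightarrow> \<sigma> \<le> \<xi> j"
  unfolding \<sigma>_def using xi_pos by auto

lemma T_pos: "0 < T" using xi_pos[of 0] xi_le[of 0] by simp

lemma norm_S_le:
  assumes "x \<le> Re z" "0 \<le> x" shows "cmod (S z) \<le> exp (- x * \<sigma>)"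
proof -
  have "cmod (S z) \<le> (\<Sum>j\<le>n. p j * exp (- x * \<sigma>))"
    unfolding S_def
  proof (rule order_trans[OF norm_sum sum_mono])
    fix j assume j: "j \<in> {..n}"
    have "x * \<sigma> \<le> Re z * \<xi> j" using assms sigma j by (intro mult_mono) auto
    then show "cmod (of_real (p j) * exp (- z * of_real (\<xi> j))) \<le> p j * exp (- x * \<sigma>)"
      using p_nonneg j by (auto simp: norm_mult intro!: mult_left_mono)
  qed
  also have "\<dots> = (\<Sum>j\<le>n. p j) * exp (- x * \<sigma>)" by (simp add: sum_distrib_right)
  also have "\<dots> \<le> 1 * exp (- x * \<sigma>)" using p_sum by (intro mult_right_mono) auto
  finally show ?thesis by simp
qed

lemma norm_S_less_1:
  assumes "0 < Re z" shows "cmod (S z) < 1"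
  using norm_S_le[of "Re z" z] assms sigma(1) by (smt (verit) exp_less_one_iff mult_minus_left mult_pos_pos)

lemma one_plus_S_nonzero: "0 < Re z \<Longrightarrow> 1 + S z \<noteq> 0"
  using norm_S_less_1[of z] by (metis add.inverse_unique less_irrefl norm_minus_cancel norm_one)

lemma f_bound_pos: "0 < x \<Longrightarrow> 0 < f_bound x"
  using sigma(1) by (simp add: f_bound_def)

lemma norm_f_le:
  assumes "x \<le> Re z" "0 < x" shows "cmod (f z) \<le> f_bound x"
proof -
  have "cmod (S z) \<le> exp (- x * \<sigma>)" using norm_S_le assms by simp
  then have "1 - exp (- x * \<sigma>) \<le> cmod (1 + S z)" using norm_diff_ineq[of 1 "S z"] by simp
  moreover have "0 < 1 - exp (- x * \<sigma>)" using assms sigma(1) by simp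
  ultimately show ?thesis unfolding f_def f_bound_def norm_inverse by (simp add: inverse_eq_divide frac_le)
qed

lemma Re_f_nonneg: "0 < Re z \<Longrightarrow> 0 \<le> Re (f z)"
proof -
  assume "0 < Re z"
  then have "\<bar>Re (S z)\<bar> < 1" using norm_S_less_1[of z] abs_Re_le_cmod[of "S z"] by linarith
  then show ?thesis by (simp add: f_def)
qed

lemma f_holomorphic: "f holomorphic_on {z. 0 < Re z}"
  unfolding f_def[abs_def] using one_plus_S_nonzero unfolding S_def
  by (intro holomorphic_intros) auto

lemma f_cnj: "f (cnj z) = cnj (f z)"
  by (simp add: f_def S_def exp_cnj)

lemma Re_S_nonneg:
  assumes "\<bar>Im z\<bar> * T \<le> pi / 2" shows "0 \<le> Re (S z)"
  unfolding S_def Re_sum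
proof (rule sum_nonneg)
  fix j assume j: "j \<in> {..n}"
  have "\<bar>Im z * \<xi> j\<bar> \<le> \<bar>Im z\<bar> * T"
    using xi_pos[of j] xi_le[of j] j by (simp add: abs_mult mult_left_mono)
  then have "0 \<le> cos (Im z * \<xi> j)" using assms by (intro cos_ge_zero) auto
  then show "0 \<le> Re (of_real (p j) * exp (- z * of_real (\<xi> j)))"
    using p_nonneg j by (simp add: Re_exp)
qed

lemma norm_f_le_1: "\<bar>Im z\<bar> * T \<le> pi / 2 \<Longrightarrow> cmod (f z) \<le> 1" "\<bar>Im z\<bar> * T \<le> pi / 2 \<Longrightarrow> 1 \<le> cmod (1 + S z)"
proof -
  assume "\<bar>Im z\<bar> * T \<le> pi / 2"
  then show 1: "1 \<le> cmod (1 + S z)" using Re_S_nonneg[of z] complex_Re_le_cmod[of "1 + S z"] by simp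
  then show "cmod (f z) \<le> 1" by (simp add: f_def norm_inverse inverse_le_1_iff)
qed

text \<open>For \<open>\<bar>y\<bar> \<le> \<pi> / (2 T)\<close> all terms of \<open>S\<close> have nonnegative real part, so \<open>1 + S\<close> stays away from 0 uniformly
up to the imaginary axis, and \<open>f\<close> is Lipschitz there.\<close>

lemma f_near_real:
  assumes "0 < x" "\<bar>y\<bar> * T \<le> pi / 2"
  shows "cmod (f (Complex x y) - f (of_real x)) \<le> T * \<bar>y\<bar>"
proof -
  have "S (Complex x y) - S (of_real x) = (\<Sum>j\<le>n. of_real (p j * exp (- x * \<xi> j)) * (exp (\<i> * of_real (- y * \<xi> j)) - 1))"
    unfolding S_def sum_subtractf[symmetric]
    by (intro sum.cong refl) (simp add: Complex_eq algebra_simps exp_add exp_diff exp_minus divide_inverse exp_of_real[symmetric])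
  also have "cmod \<dots> \<le> (\<Sum>j\<le>n. p j * (T * \<bar>y\<bar>))"
  proof (rule order_trans[OF norm_sum sum_mono])
    fix j assume j: "j \<in> {..n}"
    have "cmod (exp (\<i> * of_real (- y * \<xi> j)) - 1) \<le> \<bar>- y * \<xi> j\<bar>"
    proof -
      have "cmod (exp (\<i> * of_real (- y * \<xi> j)) - 1) = cmod (cis (- y * \<xi> j) - cis 0)"
        by (simp add: cis_conv_exp)
      also have "\<dots> = 2 * \<bar>sin ((- y * \<xi> j) / 2)\<bar>"
        using dist_exp_i_1[of "- y * \<xi> j"] by (simp add: cis_conv_exp)
      also have "\<dots> \<le> \<bar>- y * \<xi> j\<bar>" using abs_sin_x_le_abs_x[of "(- y * \<xi> j) / 2"] by simp
      finally show ?thesis .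
    qed
    also have "\<dots> \<le> T * \<bar>y\<bar>"
      using xi_pos[of j] xi_le[of j] j mult_right_mono[of "\<xi> j" T "\<bar>y\<bar>"] by (simp add: abs_mult mult.commute)
    finally have "exp (- x * \<xi> j) * cmod (exp (\<i> * of_real (- y * \<xi> j)) - 1) \<le> 1 * (T * \<bar>y\<bar>)"
      using assms xi_pos[of j] j by (intro mult_mono) auto
    then have "p j * (exp (- x * \<xi> j) * cmod (exp (\<i> * of_real (- y * \<xi> j)) - 1)) \<le> p j * (1 * (T * \<bar>y\<bar>))"
      using p_nonneg j by (intro mult_left_mono) auto
    then show "cmod (of_real (p j * exp (- x * \<xi> j)) * (exp (\<i> * of_real (- y * \<xi> j)) - 1)) \<le> p j * (T * \<bar>y\<bar>)"
      using p_nonneg j by (simp add: norm_mult abs_mult mult.assoc)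
  qed
  also have "\<dots> = (\<Sum>j\<le>n. p j) * (T * \<bar>y\<bar>)" by (simp add: sum_distrib_right)
  also have "\<dots> \<le> 1 * (T * \<bar>y\<bar>)" using p_sum T_pos by (intro mult_right_mono) auto
  finally have d: "cmod (S (Complex x y) - S (of_real x)) \<le> T * \<bar>y\<bar>" by simp
  let ?a = "1 + S (Complex x y)" and ?b = "1 + S (of_real x)"
  have ab: "1 \<le> cmod ?a" "1 \<le> cmod ?b" using norm_f_le_1(2) assms by auto
  then have nz: "?a \<noteq> 0" "?b \<noteq> 0" by auto
  have "f (Complex x y) - f (of_real x) = - (?a - ?b) / (?a * ?b)"
    using nz by (simp add: f_def field_simps)
  also have "cmod \<dots> = cmod (?a - ?b) / (cmod ?a * cmod ?b)" by (simp add: norm_divide norm_mult norm_minus_commute)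
  also have "\<dots> \<le> cmod (?a - ?b) / 1"
    using ab mult_mono[of 1 "cmod ?a" 1 "cmod ?b"] by (intro divide_left_mono) auto
  finally show ?thesis using d by simp
qed

lemma integral_Re_f_le:
  assumes "0 < e"
  shows "integral {y0 - 1..y0 + 1} (\<lambda>y. Re (f (Complex e y)) + 1) \<le> 2 * pi * f_bound 1 + 2"
proof -
  have c: "continuous_on A (\<lambda>y. Re (f (Complex e y)))" for A
    by (intro continuous_intros continuous_on_compose2[OF holomorphic_on_imp_continuous_on[OF f_holomorphic]])
       (use assms in auto)
  have "integral {y0 - 1..y0 + 1} (\<lambda>y. Re (f (Complex e y)) + 1)
      = integral {y0 - 1..y0 + 1} (\<lambda>y. Re (f (Complex e y))) + integral {y0 - 1..y0 + 1} (\<lambda>y. 1)"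
    by (intro integral_add integrable_continuous_interval c continuous_intros)
  also have "integral {y0 - 1..y0 + 1} (\<lambda>y. Re (f (Complex e y))) \<le> 2 * pi * Re (f (Complex (e + 1) y0))"
    by (rule half_plane_harnack[OF f_holomorphic assms norm_f_le]) (use assms Re_f_nonneg in auto)
  also have "Re (f (Complex (e + 1) y0)) \<le> f_bound 1"
    using complex_Re_le_cmod[of "f (Complex (e + 1) y0)"] norm_f_le[of 1 "Complex (e + 1) y0"] assms by simp
  finally show ?thesis by simp
qed

lemma continuous_on_f_line: "0 < e \<Longrightarrow> continuous_on A (\<lambda>y. f (Complex e y))"
  by (intro continuous_on_compose2[OF holomorphic_on_imp_continuous_on[OF f_holomorphic]] continuous_intros) auto

text \<open>On the line \<open>Re z = e\<close> the reflected argument \<open>2 e - z\<close> is the conjugate of \<open>z\<close>, so the numerator is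
\<open>2 Re (f z - f e)\<close>. Near the real axis it is \<open>O(\<bar>y\<bar>)\<close>, which cancels the singularity of \<open>1 / z\<close>; elsewhere
\<open>Re f \<ge> 0\<close> suffices.\<close>

lemma symmetrized_le:
  assumes e: "0 < e"
  defines "C \<equiv> 2 * (1 + 1 / (pi / (2 * T))) + 2 * T * (1 + pi / (2 * T))"
  shows "cmod ((f (Complex e y) + f (2 * of_real e - Complex e y) - 2 * f (of_real e)) / Complex e y)
    \<le> C * ((Re (f (Complex e y)) + 1) / (1 + \<bar>y\<bar>))"
proof -
  define y1 where "y1 = pi / (2 * T)"
  have y1: "0 < y1" "C = 2 * (1 + 1 / y1) + 2 * T * (1 + y1)" using T_pos by (auto simp: y1_def C_def)
  let ?z = "Complex e y"
  define E where "E = f ?z + f (2 * of_real e - ?z) - 2 * f (of_real e)"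
  have R0: "0 \<le> Re (f ?z)" using Re_f_nonneg e by simp
  have "2 * of_real e - ?z = cnj ?z" by (simp add: complex_eq_iff)
  then have cj: "f (2 * of_real e - ?z) = cnj (f ?z)" by (simp only: f_cnj)
  have fr: "Im (f (of_real e)) = 0"
    using f_cnj[of "of_real e"] by (simp add: complex_eq_iff)
  have E: "E = of_real (2 * Re (f ?z - f (of_real e)))"
    using fr unfolding E_def cj by (simp add: complex_eq_iff)
  have zy: "\<bar>y\<bar> \<le> cmod ?z" "0 < cmod ?z" using abs_Im_le_cmod[of ?z] e by (auto simp: complex_eq_iff)
  have "cmod E / cmod ?z \<le> C * ((Re (f ?z) + 1) / (1 + \<bar>y\<bar>))"
  proof (cases "\<bar>y\<bar> \<le> y1")
    case True
    then have "\<bar>y\<bar> * T \<le> pi / 2" using T_pos by (simp add: y1_def field_simps)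
    from f_near_real[OF e this] have "cmod E \<le> 2 * (T * \<bar>y\<bar>)"
      unfolding E norm_of_real abs_mult using abs_Re_le_cmod[of "f ?z - f (of_real e)"] by simp
    also have "\<dots> \<le> 2 * T * cmod ?z" using zy T_pos by simp
    finally have "cmod E / cmod ?z \<le> 2 * T" using zy by (simp add: field_simps)
    also have "\<dots> = 2 * T * (1 + \<bar>y\<bar>) / (1 + \<bar>y\<bar>)" by simp
    also have "\<dots> \<le> 2 * T * (1 + y1) / (1 + \<bar>y\<bar>)" using True T_pos by (intro divide_right_mono mult_left_mono) auto
    also have "\<dots> \<le> C * (Re (f ?z) + 1) / (1 + \<bar>y\<bar>)"
      using y1 R0 T_pos mult_mono[of "2 * T * (1 + y1)" C 1 "Re (f ?z) + 1"] by (intro divide_right_mono) auto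
    finally show ?thesis by simp
  next
    case False
    have "\<bar>Re (f (of_real e))\<bar> \<le> 1" using abs_Re_le_cmod[of "f (of_real e)"] norm_f_le_1(1)[of "of_real e"] by simp
    then have "cmod E \<le> 2 * (Re (f ?z) + 1)" unfolding E norm_of_real minus_complex.sel abs_le_iff using R0 by auto
    moreover have "1 / cmod ?z \<le> (1 + 1 / y1) / (1 + \<bar>y\<bar>)"
    proof -
      have "1 + \<bar>y\<bar> \<le> \<bar>y\<bar> / y1 + \<bar>y\<bar>" using False y1(1) by (simp add: field_simps)
      also have "\<dots> = (1 + 1 / y1) * \<bar>y\<bar>" by (simp add: field_simps)
      also have "\<dots> \<le> (1 + 1 / y1) * cmod ?z" using zy y1(1) by (intro mult_left_mono) auto
      finally show ?thesis using zy(2) by (simp add: field_simps)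
    qed
    ultimately have "cmod E * (1 / cmod ?z) \<le> 2 * (Re (f ?z) + 1) * ((1 + 1 / y1) / (1 + \<bar>y\<bar>))"
      using R0 y1(1) by (intro mult_mono) auto
    also have "\<dots> = 2 * (1 + 1 / y1) * ((Re (f ?z) + 1) / (1 + \<bar>y\<bar>))"
      by (simp only: times_divide_eq_right times_divide_eq_left mult_ac)
    also have "\<dots> \<le> C * ((Re (f ?z) + 1) / (1 + \<bar>y\<bar>))"
      using y1 R0 T_pos by (intro mult_right_mono) auto
    finally show ?thesis by simp
  qed
  then show ?thesis by (simp add: E_def norm_divide)
qed

text \<open>The point is that \<open>C\<close> depends neither on \<open>e\<close> nor on \<open>g\<close>, although \<open>f\<close> can be unbounded near the
imaginary axis; the term that depends on \<open>e\<close> disappears as \<open>Y\<close> grows. Split \<open>f\<close> into its symmetrization about the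
line, which is controlled by the local integrals of \<open>Re f\<close>, and the function
\<open>2 f e - f (2 e - z)\<close>, which is holomorphic and bounded to the left. For the latter the line is moved to
\<open>Re z = -\<eta>\<close>, across the simple pole at 0.\<close>

lemma boundary_line_bound:
  assumes a: "0 < \<alpha>" and eta: "0 < \<eta>" "\<eta> < r"
  shows "\<exists>C\<ge>0. \<forall>g e \<kappa> Y. g holomorphic_on {z. -r < Re z \<and> Re z < r} \<longrightarrow> 0 < e \<longrightarrow> e < r \<longrightarrow> 0 < Y \<longrightarrow>
      (\<forall>z. -\<eta> \<le> Re z \<longrightarrow> Re z \<le> e \<longrightarrow> cmod (g z) \<le> \<kappa> * (1 + \<bar>Im z\<bar>) powr (-\<alpha>)) \<longrightarrow>
      cmod (integral {-Y..Y} (\<lambda>y. f (Complex e y) * g (Complex e y) / Complex e y))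
        \<le> C * \<kappa> + 2 * (\<eta> + e) * ((2 + f_bound e) * \<kappa> / Y)"
proof -
  define C1 where "C1 = 2 * (1 + 1 / (pi / (2 * T))) + 2 * T * (1 + pi / (2 * T))"
  define Z where "Z = (\<Sum>m. (1 + real m) powr (- 1 - \<alpha>))"
  define C2 where "C2 = (2 + f_bound \<eta>) * (1 + 1 / \<eta>)"
  define C where "C = C1 * (2 * (2 * pi * f_bound 1 + 2) * Z) + 6 * pi + C2 * (2 * 2 * Z)"
  have C1: "0 \<le> C1" using T_pos by (auto simp: C1_def intro!: add_nonneg_nonneg)
  have Z: "0 \<le> Z" unfolding Z_def by (intro suminf_nonneg summable_shifted_powr a) auto
  have C2: "0 \<le> C2" using f_bound_pos[OF eta(1)] eta by (auto simp: C2_def)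
  have C0: "0 \<le> C" unfolding C_def using C1 Z C2 f_bound_pos[of 1] by (intro add_nonneg_nonneg mult_nonneg_nonneg) auto
  have main: "cmod (integral {-Y..Y} (\<lambda>y. f (Complex e y) * g (Complex e y) / Complex e y))
        \<le> C * \<kappa> + 2 * (\<eta> + e) * ((2 + f_bound e) * \<kappa> / Y)"
    if g: "g holomorphic_on {z. -r < Re z \<and> Re z < r}" and e: "0 < e" "e < r" and Y: "0 < Y"
      and gb: "\<And>z. -\<eta> \<le> Re z \<Longrightarrow> Re z \<le> e \<Longrightarrow> cmod (g z) \<le> \<kappa> * (1 + \<bar>Im z\<bar>) powr (-\<alpha>)" for g e \<kappa> Y
  proof -
    have k0: "0 \<le> \<kappa>" using order_trans[OF norm_ge_zero gb[of 0]] eta e by simp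
    define w where "w y = (1 + \<bar>y\<bar>) powr (- 1 - \<alpha>)" for y :: real
    have ww: "(1 + \<bar>y\<bar>) powr (-\<alpha>) / (1 + \<bar>y\<bar>) = w y" for y
    proof -
      have "- 1 - \<alpha> = - \<alpha> - 1" by simp
      then have "w y = (1 + \<bar>y\<bar>) powr (-\<alpha> - 1)" by (simp only: w_def)
      then show ?thesis by (simp add: powr_diff)
    qed
    define c where "c = (of_real e :: complex)"
    have fc: "cmod (f c) \<le> 1" "cmod (f (2 * c)) \<le> 1" using norm_f_le_1(1) by (auto simp: c_def)
    define H where "H z = (2 * f c - f (2 * c - z)) * g z" for z
    \<comment> \<open>On \<open>U\<close> the reflected point \<open>2 e - z\<close> stays in the right half plane, so that \<open>H\<close> is holomorphic.\<close>
    define U where "U = {z. -r < Re z} \<inter> {z. Re z < min r (2 * e)}"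
    have oU: "open U" unfolding U_def by (intro open_Int open_Collect_less continuous_intros)
    have cU: "convex U" unfolding U_def by (intro convex_Int convex_halfspace_Re_lt convex_halfspace_Re_gt)
    have fU: "(\<lambda>z. f (2 * c - z)) holomorphic_on U"
      by (rule holomorphic_on_compose_gen[unfolded o_def, OF _ f_holomorphic])
        (auto intro!: holomorphic_intros simp: U_def c_def)
    have HU: "H holomorphic_on U"
      unfolding H_def[abs_def] by (intro holomorphic_intros fU holomorphic_on_subset[OF g]) (auto simp: U_def)
    have kU: "(\<lambda>z. H z / z) holomorphic_on U - {0}"
      by (intro holomorphic_intros holomorphic_on_subset[OF HU]) auto
    have U0: "0 \<in> U" using eta e by (auto simp: U_def)
    have rect: "integral {-\<eta>..e} (\<lambda>x. H (Complex x (-Y)) / Complex x (-Y)) + \<i> * integral {-Y..Y} (\<lambda>y. H (Complex e y) / Complex e y)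
        - integral {-\<eta>..e} (\<lambda>x. H (Complex x Y) / Complex x Y) - \<i> * integral {-Y..Y} (\<lambda>y. H (Complex (-\<eta>) y) / Complex (-\<eta>) y)
        = 2 * pi * \<i> * (\<Sum>p\<in>{0}. residue (\<lambda>z. H z / z) p)"
      by (rule rectangle_residue_theorem[OF _ _ oU cU _ _ _ kU])
         (use Y e eta in \<open>auto simp: U_def in_cbox_complex_iff in_box_complex_iff\<close>)
    have res: "residue (\<lambda>z. H z / z) 0 = H 0" using residue_simple[OF oU U0 HU] by simp
    define b t R l where "b = integral {-\<eta>..e} (\<lambda>x. H (Complex x (-Y)) / Complex x (-Y))"
      and "t = integral {-\<eta>..e} (\<lambda>x. H (Complex x Y) / Complex x Y)"
      and "R = integral {-Y..Y} (\<lambda>y. H (Complex e y) / Complex e y)"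
      and "l = integral {-Y..Y} (\<lambda>y. H (Complex (-\<eta>) y) / Complex (-\<eta>) y)"
    have "b + \<i> * R - t - \<i> * l = 2 * pi * \<i> * H 0" using rect res by (simp add: b_def t_def R_def l_def)
    then have "\<i> * R = \<i> * (2 * pi * H 0 + l - \<i> * (t - b))" by (simp add: algebra_simps)
    then have R_eq: "R = 2 * pi * H 0 + l - \<i> * (t - b)" by simp
    have H0: "cmod (H 0) \<le> 3 * \<kappa>"
    proof -
      have "cmod (2 * f c - f (2 * c)) \<le> 3"
        using norm_triangle_ineq4[of "2 * f c" "f (2 * c)"] fc by (simp add: norm_mult)
      moreover have "cmod (g 0) \<le> \<kappa>" using gb[of 0] eta e by simp
      ultimately show ?thesis unfolding H_def norm_mult using mult_mono[of _ 3 "cmod (g 0)" \<kappa>] by simp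
    qed
    have Hb: "cmod (H z) \<le> (2 + f_bound x) * (\<kappa> * (1 + \<bar>Im z\<bar>) powr (-\<alpha>))"
      if "-\<eta> \<le> Re z" "Re z \<le> e" "0 < x" "x \<le> Re (2 * c - z)" for z x
    proof -
      have "cmod (2 * f c - f (2 * c - z)) \<le> 2 + f_bound x"
        using norm_triangle_ineq4[of "2 * f c" "f (2 * c - z)"] fc norm_f_le[OF that(4,3)] by (simp add: norm_mult)
      then show ?thesis unfolding H_def norm_mult using gb[OF that(1,2)] f_bound_pos[OF that(3)]
        by (intro mult_mono) auto
    qed
    have cont: "continuous_on I (\<lambda>x. H (u x) / u x)" if "continuous_on I u" "\<And>x. x \<in> I \<Longrightarrow> u x \<in> U - {0}" for I :: "real set" and u
      using continuous_on_compose2[OF holomorphic_on_imp_continuous_on[OF kU] that(1)] that(2) by force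
    have horiz: "cmod (integral {-\<eta>..e} (\<lambda>x. H (Complex x y) / Complex x y)) \<le> (2 + f_bound e) * \<kappa> / Y * (e - - \<eta>)"
      if y: "\<bar>y\<bar> = Y" for y
    proof (rule norm_integral_le_length)
      show "continuous_on {-\<eta>..e} (\<lambda>x. H (Complex x y) / Complex x y)"
        by (intro cont continuous_intros) (use y Y e eta in \<open>auto simp: U_def complex_eq_iff\<close>)
      fix x assume x: "x \<in> {-\<eta>..e}"
      have "cmod (H (Complex x y)) \<le> (2 + f_bound e) * (\<kappa> * (1 + \<bar>Im (Complex x y)\<bar>) powr (-\<alpha>))"
        using x e by (intro Hb) (auto simp: c_def)
      also have "\<dots> \<le> (2 + f_bound e) * (\<kappa> * 1)"
      proof -
        have "1 + \<bar>y\<bar> \<noteq> 0" by linarith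
        then have "(1 + \<bar>y\<bar>) powr (-\<alpha>) \<le> 1" using a powr_mono[of "-\<alpha>" 0 "1 + \<bar>y\<bar>"] by simp
        then show ?thesis using f_bound_pos[OF e(1)] k0 by (intro mult_left_mono) auto
      qed
      finally show "cmod (H (Complex x y) / Complex x y) \<le> (2 + f_bound e) * \<kappa> / Y"
        unfolding norm_divide using y Y abs_Im_le_cmod[of "Complex x y"] f_bound_pos[OF e(1)] k0
        by (intro frac_le) auto
    qed (use e eta in auto)
    have wint: "integral {-Y..Y} w \<le> 2 * 2 * Z"
      using integral_unit_bounded_weight[OF a, of "\<lambda>_. 1" 2 Y] Y by (simp add: Z_def w_def[abs_def])
    have wc: "continuous_on A w" for A unfolding w_def by (intro continuous_intros) auto
    have lb: "cmod l \<le> C2 * \<kappa> * (2 * 2 * Z)"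
    proof -
      have "cmod l \<le> integral {-Y..Y} (\<lambda>y. C2 * \<kappa> * w y)"
        unfolding l_def
      proof (rule integral_norm_bound_integral)
        show "(\<lambda>y. H (Complex (-\<eta>) y) / Complex (-\<eta>) y) integrable_on {-Y..Y}"
          by (intro integrable_continuous_interval cont continuous_intros) (use Y e eta in \<open>auto simp: U_def complex_eq_iff\<close>)
        fix y assume "y \<in> {-Y..Y}"
        let ?z = "Complex (-\<eta>) y"
        have z: "\<eta> \<le> cmod ?z" "\<bar>y\<bar> \<le> cmod ?z" using abs_Re_le_cmod[of ?z] abs_Im_le_cmod[of ?z] eta by auto
        have z1: "1 / cmod ?z \<le> (1 + 1 / \<eta>) / (1 + \<bar>y\<bar>)"
        proof -
          have "1 + \<bar>y\<bar> \<le> cmod ?z / \<eta> + cmod ?z" using z eta by (intro add_mono) auto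
          also have "\<dots> = (1 + 1 / \<eta>) * cmod ?z" by (simp add: field_simps)
          finally have le: "1 + \<bar>y\<bar> \<le> (1 + 1 / \<eta>) * cmod ?z" .
          have "0 < cmod ?z" "0 < 1 + \<bar>y\<bar>" using z eta by linarith+
          moreover have "1 / c \<le> K / s" if "s \<le> K * c" "0 < c" "0 < s" for c K s :: real
            using that by (simp add: field_simps)
          ultimately show ?thesis using le by blast
        qed
        have "cmod (H ?z) * (1 / cmod ?z) \<le> ((2 + f_bound \<eta>) * (\<kappa> * (1 + \<bar>y\<bar>) powr (-\<alpha>))) * ((1 + 1 / \<eta>) / (1 + \<bar>y\<bar>))"
          using z1 Hb[of ?z \<eta>] eta e k0 f_bound_pos[OF eta(1)] by (intro mult_mono) (auto simp: c_def)
        also have "\<dots> = C2 * \<kappa> * ((1 + \<bar>y\<bar>) powr (-\<alpha>) / (1 + \<bar>y\<bar>))" by (simp add: C2_def)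
        finally show "cmod (H ?z / ?z) \<le> C2 * \<kappa> * w y" unfolding ww by (simp add: norm_divide)
      qed (intro integrable_continuous_interval continuous_intros wc)
      also have "\<dots> = C2 * \<kappa> * integral {-Y..Y} w" by simp
      also have "\<dots> \<le> C2 * \<kappa> * (2 * 2 * Z)" using wint C2 k0 by (intro mult_left_mono) auto
      finally show ?thesis .
    qed
    \<comment> \<open>The symmetrized part; \<open>H z / z\<close> is the rest.\<close>
    define E where "E y = (f (Complex e y) + f (2 * c - Complex e y) - 2 * f c) / Complex e y * g (Complex e y)" for y
    have gc: "continuous_on A (\<lambda>y. g (Complex e y))" for A
      by (intro continuous_on_compose2[OF holomorphic_on_imp_continuous_on[OF g]] continuous_intros) (use e eta in auto)
    have fc2: "continuous_on A (\<lambda>y. f (2 * c - Complex e y))" for A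
      by (intro continuous_on_compose2[OF holomorphic_on_imp_continuous_on[OF f_holomorphic]] continuous_intros) (use e in \<open>auto simp: c_def\<close>)
    have ze: "Complex e y \<noteq> 0" for y using e by (simp add: complex_eq_iff)
    have Ec: "continuous_on A E" for A
      unfolding E_def[abs_def] using ze by (intro continuous_intros gc fc2 continuous_on_f_line e) auto
    have Rf: "continuous_on A (\<lambda>y. Re (f (Complex e y)) + 1)" for A
      by (intro continuous_intros continuous_on_f_line e)
    have R0: "0 \<le> Re (f (Complex e y)) + 1" for y using Re_f_nonneg[of "Complex e y"] e by simp
    have Eb: "cmod (integral {-Y..Y} E) \<le> C1 * \<kappa> * (2 * (2 * pi * f_bound 1 + 2) * Z)"
    proof -
      have "cmod (integral {-Y..Y} E) \<le> integral {-Y..Y} (\<lambda>y. C1 * \<kappa> * ((Re (f (Complex e y)) + 1) * w y))"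
      proof (rule integral_norm_bound_integral)
        fix y
        have "cmod (E y) \<le> C1 * ((Re (f (Complex e y)) + 1) / (1 + \<bar>y\<bar>)) * (\<kappa> * (1 + \<bar>y\<bar>) powr (-\<alpha>))"
          unfolding E_def norm_mult c_def
        proof (rule mult_mono)
          show "cmod ((f (Complex e y) + f (2 * of_real e - Complex e y) - 2 * f (of_real e)) / Complex e y)
            \<le> C1 * ((Re (f (Complex e y)) + 1) / (1 + \<bar>y\<bar>))"
            unfolding C1_def by (rule symmetrized_le[OF e(1)])
          show "cmod (g (Complex e y)) \<le> \<kappa> * (1 + \<bar>y\<bar>) powr (-\<alpha>)" using gb[of "Complex e y"] e eta by simp
        qed (use C1 R0 in auto)
        also have "\<dots> = C1 * \<kappa> * ((Re (f (Complex e y)) + 1) * ((1 + \<bar>y\<bar>) powr (-\<alpha>) / (1 + \<bar>y\<bar>)))" by simp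
        finally show "cmod (E y) \<le> C1 * \<kappa> * ((Re (f (Complex e y)) + 1) * w y)" unfolding ww .
      qed (intro integrable_continuous_interval continuous_intros wc Ec Rf)+
      also have "\<dots> = C1 * \<kappa> * integral {-Y..Y} (\<lambda>y. (Re (f (Complex e y)) + 1) * w y)" by simp
      also have "\<dots> \<le> C1 * \<kappa> * (2 * (2 * pi * f_bound 1 + 2) * Z)"
        using integral_unit_bounded_weight[OF a Rf R0 integral_Re_f_le[OF e(1)], of Y] Y C1 k0
        by (intro mult_left_mono) (auto simp: Z_def w_def)
      finally show ?thesis .
    qed
    have "integral {-Y..Y} (\<lambda>y. f (Complex e y) * g (Complex e y) / Complex e y)
        = integral {-Y..Y} (\<lambda>y. E y + H (Complex e y) / Complex e y)"
      by (rule arg_cong[of _ _ "integral _"]) (auto simp: fun_eq_iff E_def H_def add_divide_distrib diff_divide_distrib algebra_simps)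
    also have "\<dots> = integral {-Y..Y} E + R"
      unfolding R_def by (intro integral_add integrable_continuous_interval Ec cont continuous_intros)
        (use e eta ze in \<open>auto simp: U_def\<close>)
    also have "cmod \<dots> \<le> cmod (integral {-Y..Y} E) + (2 * pi * cmod (H 0) + cmod l + (cmod t + cmod b))"
    proof -
      have "cmod R \<le> cmod (2 * pi * H 0) + cmod l + cmod (\<i> * (t - b))"
        unfolding R_eq using norm_triangle_ineq4[of "2 * pi * H 0 + l" "\<i> * (t - b)"] norm_triangle_ineq[of "2 * pi * H 0" l] by linarith
      moreover have "cmod (\<i> * (t - b)) \<le> cmod t + cmod b" using norm_triangle_ineq4[of t b] by (simp add: norm_mult)
      ultimately show ?thesis using norm_triangle_ineq[of "integral {-Y..Y} E" R] by (simp add: norm_mult)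
    qed
    also have "\<dots> \<le> C1 * \<kappa> * (2 * (2 * pi * f_bound 1 + 2) * Z) + (2 * pi * (3 * \<kappa>) + C2 * \<kappa> * (2 * 2 * Z)
        + ((2 + f_bound e) * \<kappa> / Y * (e - - \<eta>) + (2 + f_bound e) * \<kappa> / Y * (e - - \<eta>)))"
      using Eb H0 lb horiz[of Y] horiz[of "-Y"] Y by (intro add_mono mult_left_mono) (auto simp: t_def b_def)
    also have "\<dots> = C * \<kappa> + 2 * (\<eta> + e) * ((2 + f_bound e) * \<kappa> / Y)"
      by (simp add: C_def algebra_simps add_divide_distrib)
    finally show ?thesis .
  qed
  show ?thesis
  proof (intro exI[of _ C] conjI allI impI)
    fix g :: "complex \<Rightarrow> complex" and e \<kappa> Y :: real
    assume "g holomorphic_on {z. -r < Re z \<and> Re z < r}" "0 < e" "e < r" "0 < Y"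
      and "\<forall>z. -\<eta> \<le> Re z \<longrightarrow> Re z \<le> e \<longrightarrow> cmod (g z) \<le> \<kappa> * (1 + \<bar>Im z\<bar>) powr (-\<alpha>)"
    then show "cmod (integral {-Y..Y} (\<lambda>y. f (Complex e y) * g (Complex e y) / Complex e y))
        \<le> C * \<kappa> + 2 * (\<eta> + e) * ((2 + f_bound e) * \<kappa> / Y)"
      by (intro main) simp_all
  qed (rule C0)
qed

end

section \<open>Sinc quadrature for exponentially decaying integrands\<close>

lemma integral_exp_abs_le:
  assumes a: "0 < (\<alpha>::real)" and X: "0 \<le> X"
  shows "integral {-X..X} (\<lambda>x. exp (- \<alpha> * \<bar>x\<bar>)) \<le> 2 / \<alpha>"
proof -
  have c: "continuous_on A (\<lambda>x. exp (- \<alpha> * \<bar>x\<bar>))" for A by (intro continuous_intros)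
  have "((\<lambda>x. exp (- \<alpha> * x)) has_integral (- exp (- \<alpha> * X) / \<alpha> - (- exp (- \<alpha> * 0) / \<alpha>))) {0..X}"
    using a X by (intro fundamental_theorem_of_calculus)
      (auto intro!: derivative_eq_intros simp flip: has_real_derivative_iff_has_vector_derivative)
  then have p: "((\<lambda>x. exp (- \<alpha> * \<bar>x\<bar>)) has_integral (1 - exp (- \<alpha> * X)) / \<alpha>) {0..X}"
    by (rule has_integral_eq_rhs[OF has_integral_eq[rotated]]) (auto simp: diff_divide_distrib)
  have "integral {-X..X} (\<lambda>x. exp (- \<alpha> * \<bar>x\<bar>))
      = integral {-X..0} (\<lambda>x. exp (- \<alpha> * \<bar>x\<bar>)) + integral {0..X} (\<lambda>x. exp (- \<alpha> * \<bar>x\<bar>))"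
    using X by (intro Henstock_Kurzweil_Integration.integral_combine[symmetric] integrable_continuous_interval c) auto
  also have "integral {-X..0} (\<lambda>x. exp (- \<alpha> * \<bar>x\<bar>)) = integral {0..X} (\<lambda>x. exp (- \<alpha> * \<bar>x\<bar>))"
    using Henstock_Kurzweil_Integration.integral_reflect_real[of X 0 "\<lambda>x. exp (- \<alpha> * \<bar>x\<bar>)"] by simp
  also have "\<dots> = (1 - exp (- \<alpha> * X)) / \<alpha>" using p by (rule integral_unique)
  also have "\<dots> + \<dots> \<le> 1 / \<alpha> + 1 / \<alpha>"
    using a by (intro add_mono divide_right_mono) auto
  finally show ?thesis by simp
qed

lemma norm_integral_exp_abs_le:
  fixes f :: "real \<Rightarrow> 'a::banach"
  assumes "0 < \<alpha>" "0 \<le> X" "continuous_on {-X..X} f" "0 \<le> B"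
    and "\<And>x. norm (f x) \<le> B * exp (- \<alpha> * \<bar>x\<bar>)"
  shows "norm (integral {-X..X} f) \<le> 2 * B / \<alpha>"
proof -
  have "norm (integral {-X..X} f) \<le> integral {-X..X} (\<lambda>x. B * exp (- \<alpha> * \<bar>x\<bar>))"
    using assms by (intro integral_norm_bound_integral integrable_continuous_interval continuous_intros) auto
  also have "\<dots> = B * integral {-X..X} (\<lambda>x. exp (- \<alpha> * \<bar>x\<bar>))" by simp
  also have "\<dots> \<le> B * (2 / \<alpha>)" using assms integral_exp_abs_le by (intro mult_left_mono) auto
  finally show ?thesis by (simp add: mult.commute)
qed

lemma exp_abs_integrable:
  assumes a: "0 < (\<alpha>::real)" shows "(\<lambda>x. exp (- \<alpha> * \<bar>x\<bar>)) integrable_on UNIV"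
proof -
  have p: "(\<lambda>x. exp (- \<alpha> * \<bar>x\<bar>)) integrable_on {0..}"
    by (rule integrable_eq[OF has_integral_integrable[OF has_integral_exp_minus_to_infinity[OF a, of 0]]]) auto
  then have "(\<lambda>x. exp (- \<alpha> * \<bar>x\<bar>)) absolutely_integrable_on {0..}"
    by (rule nonnegative_absolutely_integrable_1) simp
  then have "(\<lambda>x. exp (- \<alpha> * \<bar>- x\<bar>)) absolutely_integrable_on {..0}"
    using has_absolute_integral_reflect_real[of "{..0}" "{0..}" "\<lambda>x. exp (- \<alpha> * \<bar>x\<bar>)"] by auto
  then have "(\<lambda>x. exp (- \<alpha> * \<bar>x\<bar>)) integrable_on {..0}"
    using absolutely_integrable_on_def by auto
  then have "(\<lambda>x. exp (- \<alpha> * \<bar>x\<bar>)) integrable_on ({..0} \<union> {0..})"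
    using p by (rule integrable_Un') (auto intro: negligible_subset[of "{0}"])
  moreover have "{..0} \<union> {0..} = (UNIV :: real set)" by auto
  ultimately show ?thesis by simp
qed

text \<open>The range need not be separable, so this uses gauge integrals: for them integrability on bounded
intervals and an integrable bound of the norm suffice.\<close>

lemma exp_decay_integrable:
  fixes f :: "real \<Rightarrow> 'a::banach"
  assumes a: "0 < \<alpha>" and c: "continuous_on UNIV f" and B: "\<And>x. norm (f x) \<le> B * exp (- \<alpha> * \<bar>x\<bar>)"
  shows "f integrable_on UNIV"
proof (rule integrable_on_all_intervals_integrable_bound)
  show "(\<lambda>x. if x \<in> UNIV then f x else 0) integrable_on cbox u v" for u v
    using integrable_continuous[OF continuous_on_subset[OF c]] by simp
  show "(\<lambda>x. B * exp (- \<alpha> * \<bar>x\<bar>)) integrable_on UNIV"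
    using integrable_on_cmult_left[OF exp_abs_integrable[OF a], of B] by simp
qed (use B in auto)

lemma has_integral_symmetric_limit:
  fixes f :: "real \<Rightarrow> 'a::banach"
  assumes f: "(f has_integral I) UNIV" and X: "filterlim X at_top sequentially"
  shows "(\<lambda>M. integral {-X M..X M} f) \<longlonglongrightarrow> I"
proof (rule LIMSEQ_I)
  fix e :: real assume "0 < e"
  with f obtain B where B: "0 < B" "\<And>a b. ball 0 B \<subseteq> cbox a b \<Longrightarrow> norm (integral (cbox a b) f - I) < e"
    unfolding has_integral_alt'[of f I UNIV] by auto
  have "\<forall>\<^sub>F M in sequentially. B \<le> X M" using X by (simp add: filterlim_at_top)
  then have "\<forall>\<^sub>F M in sequentially. norm (integral {-X M..X M} f - I) < e"
  proof eventually_elim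
    case (elim M)
    have "ball 0 B \<subseteq> cbox (- X M) (X M)" using elim by (auto simp: abs_less_iff)
    from B(2)[OF this] show ?case by simp
  qed
  then show "\<exists>no. \<forall>M\<ge>no. norm (integral {-X M..X M} f - I) < e" by (simp add: eventually_sequentially)
qed

lemma sum_geometric_tail_le:
  assumes a: "0 < \<alpha>" and h: "0 < h"
  shows "h * (\<Sum>k\<in>{N<..M}. exp (- \<alpha> * (real k * h))) \<le> exp (- \<alpha> * (real N * h)) / \<alpha>"
proof (cases "N \<le> M")
  case True
  have "h * (\<Sum>k\<in>{N<..M}. exp (- \<alpha> * (real k * h))) \<le> (exp (- \<alpha> * (real N * h)) - exp (- \<alpha> * (real M * h))) / \<alpha>"
    using True
  proof (induction M rule: dec_induct)
    case (step M)
    have "{N<..Suc M} = insert (Suc M) {N<..M}" using step by auto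
    then have "h * (\<Sum>k\<in>{N<..Suc M}. exp (- \<alpha> * (real k * h)))
        = h * exp (- \<alpha> * (real (Suc M) * h)) + h * (\<Sum>k\<in>{N<..M}. exp (- \<alpha> * (real k * h)))"
      by (simp add: distrib_left)
    moreover have "h * exp (- \<alpha> * (real (Suc M) * h)) \<le> (exp (- \<alpha> * (real M * h)) - exp (- \<alpha> * (real (Suc M) * h))) / \<alpha>"
    proof -
      have "exp (- \<alpha> * (real M * h)) = exp (\<alpha> * h) * exp (- \<alpha> * (real (Suc M) * h))"
        by (simp add: exp_add[symmetric] algebra_simps)
      moreover have "1 + \<alpha> * h \<le> exp (\<alpha> * h)" by (rule exp_ge_add_one_self)
      then have "(1 + \<alpha> * h) * exp (- \<alpha> * (real (Suc M) * h)) \<le> exp (\<alpha> * h) * exp (- \<alpha> * (real (Suc M) * h))"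
        by (intro mult_right_mono) auto
      ultimately show ?thesis using a by (simp add: field_simps)
    qed
    ultimately show ?case using step.IH by (simp add: diff_divide_distrib)
  qed simp
  also have "\<dots> \<le> exp (- \<alpha> * (real N * h)) / \<alpha>" using a by (intro divide_right_mono) auto
  finally show ?thesis .
qed (use a in auto)

lemma sum_int_tail_le:
  fixes F :: "real \<Rightarrow> 'a::real_normed_vector"
  assumes a: "0 < \<alpha>" and h: "0 < h" and B: "0 \<le> B"
    and F: "\<And>x. real N * h \<le> \<bar>x\<bar> \<Longrightarrow> norm (F x) \<le> B * exp (- \<alpha> * \<bar>x\<bar>)" and NM: "N \<le> M"
  shows "norm (h *\<^sub>R (\<Sum>k=-int M..int M. F (of_int k * h)) - h *\<^sub>R (\<Sum>k=-int N..int N. F (of_int k * h)))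
    \<le> 2 * B * exp (- \<alpha> * (real N * h)) / \<alpha>"
proof -
  let ?K = "{N<..M}"
  let ?G = "\<lambda>k. F (of_int k * h)"
  have split: "{-int M..int M} = {-int N..int N} \<union> (int ` ?K \<union> (\<lambda>k. - int k) ` ?K)"
  proof (intro equalityI subsetI)
    fix k assume k: "k \<in> {-int M..int M}"
    show "k \<in> {-int N..int N} \<union> (int ` ?K \<union> (\<lambda>k. - int k) ` ?K)"
    proof (cases "\<bar>k\<bar> \<le> int N")
      case False
      then have "nat \<bar>k\<bar> \<in> ?K" "k = int (nat \<bar>k\<bar>) \<or> k = - int (nat \<bar>k\<bar>)" using k by auto
      then show ?thesis by blast
    qed auto
  qed (use NM in auto)
  have "(\<Sum>k=-int M..int M. ?G k) = (\<Sum>k=-int N..int N. ?G k) + ((\<Sum>k\<in>int ` ?K. ?G k) + (\<Sum>k\<in>(\<lambda>k. - int k) ` ?K. ?G k))"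
    unfolding split by (subst sum.union_disjoint, auto)+
  also have "(\<Sum>k\<in>int ` ?K. ?G k) = (\<Sum>k\<in>?K. F (real k * h))"
    by (subst sum.reindex) (auto simp: inj_on_def)
  also have "(\<Sum>k\<in>(\<lambda>k. - int k) ` ?K. ?G k) = (\<Sum>k\<in>?K. F (- (real k * h)))"
    by (subst sum.reindex) (auto simp: inj_on_def)
  finally have "h *\<^sub>R (\<Sum>k=-int M..int M. ?G k) - h *\<^sub>R (\<Sum>k=-int N..int N. ?G k)
    = h *\<^sub>R (\<Sum>k\<in>?K. F (real k * h)) + h *\<^sub>R (\<Sum>k\<in>?K. F (- (real k * h)))"
    by (simp add: scaleR_add_right)
  also have "norm \<dots> \<le> h * (\<Sum>k\<in>?K. B * exp (- \<alpha> * (real k * h))) + h * (\<Sum>k\<in>?K. B * exp (- \<alpha> * (real k * h)))"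
  proof (rule norm_triangle_mono)
    have b: "norm (F x) \<le> B * exp (- \<alpha> * (real k * h))" if "k \<in> ?K" "\<bar>x\<bar> = real k * h" for x k
      using F[of x] that h by (simp add: mult_right_mono)
    have "norm (\<Sum>k\<in>?K. F (real k * h)) \<le> (\<Sum>k\<in>?K. B * exp (- \<alpha> * (real k * h)))"
      "norm (\<Sum>k\<in>?K. F (- (real k * h))) \<le> (\<Sum>k\<in>?K. B * exp (- \<alpha> * (real k * h)))"
      by (rule sum_norm_le, rule b; use h in simp)+
    then show "norm (h *\<^sub>R (\<Sum>k\<in>?K. F (real k * h))) \<le> h * (\<Sum>k\<in>?K. B * exp (- \<alpha> * (real k * h)))"
      "norm (h *\<^sub>R (\<Sum>k\<in>?K. F (- (real k * h)))) \<le> h * (\<Sum>k\<in>?K. B * exp (- \<alpha> * (real k * h)))"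
      using h by (simp_all add: mult_left_mono)
  qed
  also have "\<dots> = 2 * B * (h * (\<Sum>k\<in>?K. exp (- \<alpha> * (real k * h))))"
    by (simp add: sum_distrib_left mult_ac)
  also have "\<dots> \<le> 2 * B * (exp (- \<alpha> * (real N * h)) / \<alpha>)"
    using B by (intro mult_left_mono sum_geometric_tail_le a h) auto
  finally show ?thesis by simp
qed

text \<open>The bound for the lower line is a hypothesis of its own, with a vanishing error for each finite
rectangle, because on the imaginary axis it does not follow from a pointwise bound.\<close>

lemma sinc_quadrature_error:
  fixes F :: "complex \<Rightarrow> complex"
  assumes a: "0 < \<alpha>" and h: "0 < h" and d: "0 < d" "d < D"
    and F: "F holomorphic_on {\<zeta>. \<bar>Im \<zeta>\<bar> < D}"
    and B: "\<And>x y. \<bar>y\<bar> \<le> d \<Longrightarrow> cmod (F (Complex x y)) \<le> B * exp (- \<alpha> * \<bar>x\<bar>)"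
    and low: "\<And>M::nat. cmod (integral {-(M + 1/2) * h..(M + 1/2) * h}
      (\<lambda>x. F (Complex x (-d)) / (sinc_exp h (Complex x (-d)) - 1))) \<le> \<Lambda> + B2 * exp (- \<alpha> * ((M + 1/2) * h))"
    and up: "\<And>x. cmod (F (Complex x d)) \<le> B' * exp (- \<alpha> * \<bar>x\<bar>)"
    and Bt: "0 \<le> Bt" "\<And>x. real N * h \<le> \<bar>x\<bar> \<Longrightarrow> cmod (F (of_real x)) \<le> Bt * exp (- \<alpha> * \<bar>x\<bar>)"
    and I: "((\<lambda>x. F (of_real x)) has_integral I) UNIV"
  shows "cmod (I - h * (\<Sum>k=-int N..int N. F (of_real (of_int k * h))))
    \<le> \<Lambda> + 2 * B' / \<alpha> / (exp (2 * pi * d / h) - 1) + 2 * Bt * exp (- \<alpha> * (real N * h)) / \<alpha>"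
proof -
  define X where "X M = (real M + 1/2) * h" for M :: nat
  define q where "q = exp (2 * pi * d / h)"
  have q: "1 < q" using d h by (simp add: q_def)
  have B'0: "0 \<le> B'" using order_trans[OF norm_ge_zero up[of 0]] by simp
  have X0: "0 < X M" for M using h by (simp add: X_def)
  have Xlim: "filterlim X at_top sequentially"
    unfolding X_def[abs_def] by (intro filterlim_at_top_mult_tendsto_pos[OF tendsto_const h]
      filterlim_tendsto_add_at_top[OF tendsto_const filterlim_real_sequentially, of "1/2", simplified add.commute[of "1/2"]])
  let ?up = "\<lambda>x. F (Complex x d) * sinc_exp h (Complex x d) / (1 - sinc_exp h (Complex x d))"
  have upb: "cmod (?up x) \<le> B' / (q - 1) * exp (- \<alpha> * \<bar>x\<bar>)" for x
  proof -
    have n: "cmod (sinc_exp h (Complex x d)) = 1 / q" by (simp add: norm_sinc_exp q_def exp_minus inverse_eq_divide)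
    have "1 - 1 / q \<le> cmod (1 - sinc_exp h (Complex x d))"
      using norm_triangle_ineq2[of 1 "sinc_exp h (Complex x d)"] n by simp
    then have "cmod (?up x) \<le> (B' * exp (- \<alpha> * \<bar>x\<bar>)) * (1 / q) / (1 - 1 / q)"
      unfolding norm_divide norm_mult n using up[of x] q B'0 by (intro frac_le mult_right_mono) auto
    also have "\<dots> = B' / (q - 1) * exp (- \<alpha> * \<bar>x\<bar>)" using q by (simp add: field_simps)
    finally show ?thesis .
  qed
  have upc: "continuous_on A ?up" for A
  proof -
    have "sinc_exp h (Complex x d) \<noteq> 1" for x
      using norm_sinc_exp[of h "Complex x d"] d h by (auto simp: divide_less_0_iff)
    moreover have "continuous_on A (\<lambda>x. F (Complex x d))"
      by (intro continuous_on_compose2[OF holomorphic_on_imp_continuous_on[OF F]] continuous_intros) (use d in auto)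
    moreover have "continuous_on A (\<lambda>x. sinc_exp h (Complex x d))"
      unfolding sinc_exp_def using h by (intro continuous_intros) auto
    ultimately show ?thesis by (intro continuous_intros) (auto simp: eq_commute[of 1])
  qed
  have upi: "cmod (integral {-X M..X M} ?up) \<le> 2 * (B' / (q - 1)) / \<alpha>" for M
    using X0[of M] q B'0 by (intro norm_integral_exp_abs_le a upc upb) auto
  define J where "J M = integral {-X M..X M} (\<lambda>x. F (of_real x))" for M
  define T where "T M = h * (\<Sum>k=-int M..int M. F (of_real (of_int k * h)))" for M
  have quad: "cmod (T M - J M) \<le> \<Lambda> + B2 * exp (- \<alpha> * X M) + 2 * B' / \<alpha> / (q - 1) + 6 * d * (B * exp (- \<alpha> * X M))" for M
  proof -
    have "cmod (T M - J M) \<le> cmod (integral {-X M..X M} (\<lambda>x. F (Complex x (-d)) / (sinc_exp h (Complex x (-d)) - 1)))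
      + cmod (integral {-X M..X M} ?up) + 6 * d * (B * exp (- \<alpha> * X M))"
      unfolding T_def J_def X_def
    proof (rule sinc_rectangle[OF h d F])
      show "cmod (F (Complex x y)) \<le> B * exp (- \<alpha> * ((real M + 1 / 2) * h))"
        if "\<bar>x\<bar> = (real M + 1 / 2) * h" "\<bar>y\<bar> \<le> d" for x y
        using B[OF that(2), of x] unfolding that(1) .
    qed
    then show ?thesis using low[of M] upi[of M] by (simp add: X_def field_simps)
  qed
  have tail: "cmod (T M - T N) \<le> 2 * Bt * exp (- \<alpha> * (real N * h)) / \<alpha>" if "N \<le> M" for M
    using sum_int_tail_le[OF a h Bt that] by (simp add: T_def scaleR_conv_of_real)
  have "cmod (I - T N) \<le> \<Lambda> + 2 * B' / \<alpha> / (q - 1) + 2 * Bt * exp (- \<alpha> * (real N * h)) / \<alpha>"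
  proof (rule LIMSEQ_le_const)
    have J: "J \<longlonglongrightarrow> I" unfolding J_def[abs_def] by (rule has_integral_symmetric_limit[OF I Xlim])
    have e0: "(\<lambda>M. exp (- \<alpha> * X M)) \<longlonglongrightarrow> 0"
      using a by (intro filterlim_compose[OF exp_at_bot] filterlim_tendsto_neg_mult_at_bot[OF tendsto_const _ Xlim]) auto
    have "(\<lambda>M. cmod (I - J M) + (\<Lambda> + B2 * exp (- \<alpha> * X M) + 2 * B' / \<alpha> / (q - 1) + 6 * d * (B * exp (- \<alpha> * X M)))
        + 2 * Bt * exp (- \<alpha> * (real N * h)) / \<alpha>) \<longlonglongrightarrow> cmod (I - I) + (\<Lambda> + B2 * 0 + 2 * B' / \<alpha> / (q - 1) + 6 * d * (B * 0))
        + 2 * Bt * exp (- \<alpha> * (real N * h)) / \<alpha>"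
      by (intro tendsto_intros J e0)
    then show "(\<lambda>M. cmod (I - J M) + (\<Lambda> + B2 * exp (- \<alpha> * X M) + 2 * B' / \<alpha> / (q - 1) + 6 * d * (B * exp (- \<alpha> * X M)))
        + 2 * Bt * exp (- \<alpha> * (real N * h)) / \<alpha>) \<longlonglongrightarrow> \<Lambda> + 2 * B' / \<alpha> / (q - 1) + 2 * Bt * exp (- \<alpha> * (real N * h)) / \<alpha>"
      by simp
    have "cmod (I - T N) \<le> cmod (I - J M) + cmod (T M - J M) + cmod (T M - T N)" for M
      using norm_triangle_ineq4[of "I - J M" "T M - J M"] norm_triangle_ineq[of "I - J M - (T M - J M)" "T M - T N"]
      by (simp add: algebra_simps)
    then show "\<exists>n. \<forall>M\<ge>n. cmod (I - T N) \<le> cmod (I - J M) + (\<Lambda> + B2 * exp (- \<alpha> * X M) + 2 * B' / \<alpha> / (q - 1) + 6 * d * (B * exp (- \<alpha> * X M)))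
        + 2 * Bt * exp (- \<alpha> * (real N * h)) / \<alpha>"
      using quad tail by (intro exI[of _ N] allI impI) (meson add_mono order_refl order_trans)
  qed
  then show ?thesis by (simp add: T_def q_def)
qed

section \<open>The integrand along hyperbolas\<close>

lemma Re_Im_cos_Complex:
  "cos (Complex a b) = Complex (cos a * cosh b) (- (sin a * sinh b))"
  by (simp add: complex_eq_iff Re_cos Im_cos cosh_def sinh_def exp_minus field_simps)

lemma Re_Im_sin_Complex:
  "sin (Complex a b) = Complex (sin a * cosh b) (cos a * sinh b)"
  by (simp add: complex_eq_iff Re_sin Im_sin cosh_def sinh_def exp_minus field_simps)

lemma cosh_le_abs_sinh_add_1: "cosh x \<le> \<bar>sinh x\<bar> + (1::real)"
proof -
  have "cosh x - sinh x = exp (- x)" "cosh x + sinh x = exp x"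
    by (simp_all add: cosh_def sinh_def field_simps)
  then show ?thesis
    by (cases "0 \<le> x") (smt (verit) exp_le_one_iff sinh_real_nonneg_iff sinh_real_nonpos_iff)+
qed

lemma exp_abs_le_cosh: "exp \<bar>x\<bar> / 2 \<le> cosh (x::real)"
  by (cases "0 \<le> x") (auto simp: cosh_def)

text \<open>The bound \<open>2 \<beta> - \<phi> \<le> \<pi> / 2\<close> says that the strip \<open>\<bar>Im \<zeta>\<bar> < \<Delta> = \<beta> - \<phi>\<close> is mapped into the right half plane;
equality is the case \<open>\<rho>\<^sub>1 = 0\<close>.\<close>

locale hyperbola = damped_exp_sum p \<xi> n T for p \<xi> :: "nat \<Rightarrow> real" and n T +
  fixes R \<phi> \<beta> \<alpha> :: real
  assumes R_pos: "0 < R" and phi_pos: "0 < \<phi>" and phi_less: "\<phi> < \<beta>" and beta_le: "2 * \<beta> - \<phi> \<le> pi / 2"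
    and alpha: "0 < \<alpha>" "\<alpha> < 1"
begin

definition U :: "complex set" where "U = sector_compl (R * cos \<phi>) \<phi>"
definition \<Delta> :: real where "\<Delta> = \<beta> - \<phi>"
definition Z :: "complex \<Rightarrow> complex" where "Z \<zeta> = of_real R * cos (of_real \<beta> + \<i> * \<zeta>)"
definition Z' :: "complex \<Rightarrow> complex" where "Z' \<zeta> = - (\<i> * of_real R * sin (of_real \<beta> + \<i> * \<zeta>))"
definition scalar_integrand :: "(complex \<Rightarrow> complex) \<Rightarrow> real \<Rightarrow> complex \<Rightarrow> complex" where
  "scalar_integrand B t \<zeta> = 1 / (2 * of_real pi * \<i>) * exp (- Z \<zeta> * of_real t) * f (Z \<zeta>) * Z' \<zeta> * (B (Z \<zeta>) / Z \<zeta>)"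
text \<open>\<open>B\<close> stands for \<open>z \<psi> ((z - A)\<^sup>-\<^sup>1 u) - \<psi> u\<close> with a functional \<open>\<psi>\<close>. Unlike \<open>B z / z\<close> it is holomorphic at 0, and
the constant \<open>C0\<close> will be a multiple of the norm of \<open>A\<^sup>\<alpha> u\<close>.\<close>

definition resolvent_symbol :: "(complex \<Rightarrow> complex) \<Rightarrow> real \<Rightarrow> bool" where
  "resolvent_symbol B C0 \<longleftrightarrow> B holomorphic_on U \<and> 0 \<le> C0 \<and> (\<forall>z\<in>U. cmod (B z) \<le> C0) \<and>
    (\<forall>z\<in>U. - Re z \<le> \<bar>Im z\<bar> \<longrightarrow> z \<noteq> 0 \<longrightarrow> cmod (B z) \<le> C0 * cmod z powr (-\<alpha>))"

lemma Delta_pos: "0 < \<Delta>" using phi_less by (simp add: \<Delta>_def)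

lemma beta_bounds: "0 < \<beta>" "\<beta> < pi / 2" "\<phi> < pi / 2" "\<beta> + \<Delta> \<le> pi / 2"
  using phi_pos phi_less beta_le by (auto simp: \<Delta>_def)

lemma cos_phi_pos: "0 < cos \<phi>" "0 < cos \<beta>"
  using beta_bounds phi_pos by (auto intro!: cos_gt_zero_pi)

lemma arg_Complex: "of_real \<beta> + \<i> * Complex x y = Complex (\<beta> - y) x"
  by (simp add: complex_eq_iff)

lemma Z_Complex: "Z (Complex x y) = Complex (R * cos (\<beta> - y) * cosh x) (- (R * sin (\<beta> - y) * sinh x))"
  by (simp add: Z_def arg_Complex Re_Im_cos_Complex complex_eq_iff)

text \<open>The branch of angle \<open>\<gamma> > \<phi>\<close> avoids the sector of angle \<open>\<phi>\<close>: by \<open>cosh x \<le> \<bar>sinh x\<bar> + 1\<close> and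
\<open>cos \<gamma> < cos \<phi>\<close> the claim reduces to \<open>tan \<phi> cos \<gamma> \<le> sin \<gamma>\<close>.\<close>

lemma hyperbola_in_U:
  assumes "\<phi> < \<gamma>" "\<gamma> \<le> pi / 2"
  shows "Complex (R * cos \<gamma> * cosh x) (- (R * sin \<gamma> * sinh x)) \<in> U"
proof -
  have c: "0 \<le> cos \<gamma>" "cos \<gamma> < cos \<phi>" "0 < cos \<phi>"
    using assms phi_pos cos_phi_pos by (auto intro!: cos_ge_zero cos_monotone_0_pi)
  have s: "0 \<le> sin \<gamma>" using assms phi_pos by (intro sin_ge_zero) auto
  have tp: "0 < tan \<phi>" using phi_pos beta_bounds by (intro tan_gt_zero)
  have "0 \<le> sin (\<gamma> - \<phi>)" using assms phi_pos by (intro sin_ge_zero) auto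
  then have "sin \<phi> * cos \<gamma> \<le> sin \<gamma> * cos \<phi>" by (simp add: sin_diff mult.commute)
  then have tc: "tan \<phi> * cos \<gamma> \<le> sin \<gamma>" using c by (simp add: tan_def field_simps)
  have "cos \<gamma> * cosh x \<le> cos \<gamma> * (\<bar>sinh x\<bar> + 1)"
    using c cosh_le_abs_sinh_add_1 by (intro mult_left_mono) auto
  then have "cos \<gamma> * cosh x - cos \<phi> < cos \<gamma> * \<bar>sinh x\<bar>" using c by (simp add: distrib_left)
  then have "tan \<phi> * (cos \<gamma> * cosh x - cos \<phi>) < tan \<phi> * (cos \<gamma> * \<bar>sinh x\<bar>)" using tp by simp
  also have "\<dots> \<le> sin \<gamma> * \<bar>sinh x\<bar>" using tc mult_right_mono[OF tc, of "\<bar>sinh x\<bar>"] by (simp add: mult.assoc)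
  finally have "R * (tan \<phi> * (cos \<gamma> * cosh x - cos \<phi>)) < R * (sin \<gamma> * \<bar>sinh x\<bar>)" using R_pos by simp
  then show ?thesis using R_pos s by (simp add: U_def sector_compl_def abs_mult algebra_simps)
qed

lemma Z_in_U: "\<bar>y\<bar> < \<Delta> \<Longrightarrow> Z (Complex x y) \<in> U"
  unfolding Z_Complex using beta_le by (intro hyperbola_in_U) (auto simp: \<Delta>_def)

lemma cos_angle_pos: "\<bar>y\<bar> < \<Delta> \<Longrightarrow> 0 < cos (\<beta> - y)"
  using beta_bounds phi_pos by (intro cos_gt_zero_pi) (auto simp: \<Delta>_def)

lemma Re_Z_pos: "\<bar>y\<bar> < \<Delta> \<Longrightarrow> 0 < Re (Z (Complex x y))"
  unfolding Z_Complex using cos_angle_pos[of y] R_pos by simp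

lemma norm_Z'_le: "cmod (Z' (Complex x y)) \<le> R * cosh x"
proof -
  have "(cmod (sin (Complex (\<beta> - y) x)))\<^sup>2 = (sin (\<beta> - y))\<^sup>2 * (cosh x)\<^sup>2 + (cos (\<beta> - y))\<^sup>2 * (sinh x)\<^sup>2"
    by (simp add: Re_Im_sin_Complex cmod_power2 power_mult_distrib)
  also have "\<dots> \<le> (sin (\<beta> - y))\<^sup>2 * (cosh x)\<^sup>2 + (cos (\<beta> - y))\<^sup>2 * (cosh x)\<^sup>2"
    by (intro add_left_mono mult_left_mono) (auto simp: cosh_square_eq)
  also have "\<dots> = (cosh x)\<^sup>2" by (simp add: distrib_right[symmetric])
  finally have "cmod (sin (Complex (\<beta> - y) x)) \<le> cosh x" by (rule power2_le_imp_le) simp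
  then show ?thesis using R_pos by (simp add: Z'_def arg_Complex norm_mult)
qed

text \<open>The factor \<open>z' / z\<close> costs at most \<open>1 / k\<close>, and \<open>\<bar>z\<bar> powr (-\<alpha>)\<close> turns into exponential decay because \<open>\<bar>z\<bar>\<close> grows
like \<open>exp \<bar>x\<bar>\<close>. The lower bounds for \<open>\<bar>z\<bar>\<close> and \<open>Re z\<close> are separate parameters: near the imaginary axis the
second one is much smaller.\<close>

lemma norm_integrand_le:
  assumes B: "resolvent_symbol B C0" and y: "\<bar>y\<bar> < \<Delta>"
    and k: "0 < k" "k * (R * cosh x) \<le> cmod (Z (Complex x y))"
    and e: "0 < e" "e \<le> Re (Z (Complex x y))"
  shows "cmod (scalar_integrand B t (Complex x y))
    \<le> exp (- (Re (Z (Complex x y)) * t)) * (f_bound e * (C0 * ((R * k / 2) powr (-\<alpha>) / k) * exp (- \<alpha> * \<bar>x\<bar>)))"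
proof -
  let ?z = "Z (Complex x y)"
  have z0: "0 < cmod ?z" using e by (metis Re_Z_pos y complex_Re_le_cmod less_le_trans)
  have C0: "0 \<le> C0" using B by (simp add: resolvent_symbol_def)
  have ch: "0 < cosh x" by simp
  have Bz: "cmod (B ?z) \<le> C0 * cmod ?z powr (-\<alpha>)"
    using B Z_in_U[OF y, of x] Re_Z_pos[OF y, of x] z0 by (auto simp: resolvent_symbol_def)
  have pw: "cmod ?z powr (-\<alpha>) \<le> (R * k / 2) powr (-\<alpha>) * exp (- \<alpha> * \<bar>x\<bar>)"
  proof -
    have "R * k * (exp \<bar>x\<bar> / 2) \<le> R * k * cosh x"
      using exp_abs_le_cosh[of x] k R_pos by (intro mult_left_mono) auto
    also have "\<dots> \<le> cmod ?z" using k(2) by (simp add: mult_ac)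
    finally have "R * k / 2 * exp \<bar>x\<bar> \<le> cmod ?z" by simp
    then have "cmod ?z powr (-\<alpha>) \<le> ((R * k / 2) * exp \<bar>x\<bar>) powr (-\<alpha>)"
      using k R_pos alpha by (intro powr_mono2') auto
    also have "\<dots> = (R * k / 2) powr (-\<alpha>) * exp \<bar>x\<bar> powr (-\<alpha>)"
      by (rule powr_mult)
    finally show ?thesis by (simp add: exp_powr_real mult.commute)
  qed
  have zz: "cmod (Z' (Complex x y)) / cmod ?z \<le> 1 / k"
  proof -
    have "cmod (Z' (Complex x y)) * k \<le> R * cosh x * k" using norm_Z'_le k by (intro mult_right_mono) auto
    also have "\<dots> \<le> cmod ?z" using k by (simp add: mult_ac)
    finally show ?thesis using z0 k by (simp add: field_simps)
  qed
  have pi1: "cmod (1 / (2 * of_real pi * \<i>)) \<le> 1"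
    using pi_ge_two by (simp add: norm_divide norm_mult)
  have "cmod (scalar_integrand B t (Complex x y)) = cmod (1 / (2 * of_real pi * \<i>)) * (exp (- (Re ?z * t)) *
      (cmod (f ?z) * (cmod (B ?z) * (cmod (Z' (Complex x y)) / cmod ?z))))"
    by (simp add: scalar_integrand_def norm_mult norm_divide)
  also have "\<dots> \<le> 1 * (exp (- (Re ?z * t)) * (f_bound e * ((C0 * ((R * k / 2) powr (-\<alpha>) * exp (- \<alpha> * \<bar>x\<bar>))) * (1 / k))))"
    using pi1 norm_f_le[OF e(2,1)] f_bound_pos[OF e(1)] C0 k zz
      order_trans[OF Bz mult_left_mono[OF pw C0]]
    by (intro mult_mono mult_nonneg_nonneg) auto
  finally show ?thesis by (simp add: mult_ac)
qed

lemma Z_holomorphic [holomorphic_intros]: "Z holomorphic_on A" "Z' holomorphic_on A"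
  unfolding Z_def[abs_def] Z'_def[abs_def] by (intro holomorphic_intros)+

lemma integrand_holomorphic:
  assumes "resolvent_symbol B C0" shows "scalar_integrand B t holomorphic_on {\<zeta>. \<bar>Im \<zeta>\<bar> < \<Delta>}"
proof -
  let ?S = "{\<zeta>. \<bar>Im \<zeta>\<bar> < \<Delta>}"
  have zU: "Z \<zeta> \<in> U" "0 < Re (Z \<zeta>)" if "\<zeta> \<in> ?S" for \<zeta>
    using Z_in_U[of "Im \<zeta>" "Re \<zeta>"] Re_Z_pos[of "Im \<zeta>" "Re \<zeta>"] that by auto
  have 1: "(\<lambda>\<zeta>. f (Z \<zeta>)) holomorphic_on ?S"
    by (rule holomorphic_on_compose_gen[unfolded o_def, OF _ f_holomorphic]) (use zU in \<open>auto intro: holomorphic_intros\<close>)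
  have 2: "(\<lambda>\<zeta>. B (Z \<zeta>)) holomorphic_on ?S"
    by (rule holomorphic_on_compose_gen[unfolded o_def, where t = U]) (use zU assms in \<open>auto intro: holomorphic_intros simp: resolvent_symbol_def\<close>)
  have "Z \<zeta> \<noteq> 0" if "\<zeta> \<in> ?S" for \<zeta> using zU(2)[OF that] by auto
  then show ?thesis unfolding scalar_integrand_def[abs_def] by (intro holomorphic_intros 1 2) auto
qed

text \<open>The constant in the decay estimate on the lines with \<open>cos (\<beta> - y) \<ge> k\<close>.\<close>

definition K :: "real \<Rightarrow> real" where "K k = f_bound (R * k) * ((R * k / 2) powr (-\<alpha>) / k)"

lemma K_nonneg: "0 < k \<Longrightarrow> 0 \<le> K k"
  using f_bound_pos[of "R * k"] R_pos by (simp add: K_def)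

lemma norm_integrand_strip_le:
  assumes B: "resolvent_symbol B C0" and y: "\<bar>y\<bar> < \<Delta>" and k: "0 < k" "k \<le> cos (\<beta> - y)" and t: "0 \<le> t"
  shows "cmod (scalar_integrand B t (Complex x y)) \<le> exp (- (R * k * cosh x * t)) * (K k * C0) * exp (- \<alpha> * \<bar>x\<bar>)"
proof -
  have re: "R * k * cosh x \<le> Re (Z (Complex x y))"
    unfolding Z_Complex using k R_pos by (simp add: mult_left_mono mult_right_mono)
  have "R * k * 1 \<le> R * k * cosh x" using k R_pos cosh_real_ge_1[of x] by (intro mult_left_mono) auto
  then have e: "R * k \<le> Re (Z (Complex x y))" using re by simp
  have "k * (R * cosh x) \<le> cmod (Z (Complex x y))"
    using re complex_Re_le_cmod[of "Z (Complex x y)"] by (simp add: mult_ac)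
  from norm_integrand_le[OF B y k(1) this _ e, of t]
  have "cmod (scalar_integrand B t (Complex x y)) \<le> exp (- (Re (Z (Complex x y)) * t)) *
      (f_bound (R * k) * (C0 * ((R * k / 2) powr (-\<alpha>) / k) * exp (- \<alpha> * \<bar>x\<bar>)))"
    using k R_pos by simp
  also have "\<dots> \<le> exp (- (R * k * cosh x * t)) * (f_bound (R * k) * (C0 * ((R * k / 2) powr (-\<alpha>) / k) * exp (- \<alpha> * \<bar>x\<bar>)))"
    using re t f_bound_pos[of "R * k"] k R_pos B by (intro mult_right_mono) (auto simp: resolvent_symbol_def mult_right_mono)
  finally show ?thesis by (simp add: K_def mult_ac)
qed

lemma norm_integrand_strip_le':
  assumes B: "resolvent_symbol B C0" and y: "\<bar>y\<bar> < \<Delta>" and k: "0 < k" "k \<le> cos (\<beta> - y)" and t: "0 \<le> t"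
  shows "cmod (scalar_integrand B t (Complex x y)) \<le> K k * C0 * exp (- \<alpha> * \<bar>x\<bar>)"
proof -
  have "exp (- (R * k * cosh x * t)) * (K k * C0 * exp (- \<alpha> * \<bar>x\<bar>)) \<le> 1 * (K k * C0 * exp (- \<alpha> * \<bar>x\<bar>))"
    using R_pos k t K_nonneg[OF k(1)] B by (intro mult_right_mono) (auto simp: resolvent_symbol_def)
  then show ?thesis using norm_integrand_strip_le[OF assms, of x] by (simp add: mult.assoc)
qed

text \<open>The cost of cutting the sum at \<open>x = N h\<close>. The factor with \<open>cosh\<close> yields the term \<open>exp (- c\<^sub>1 t a\<^sub>I N / 2)\<close>
of (ii).\<close>

definition tail_bound :: "real \<Rightarrow> real \<Rightarrow> real \<Rightarrow> real" where
  "tail_bound C0 t x = 2 * K (cos \<beta>) * C0 * exp (- (R * cos \<beta> * cosh x * t)) * exp (- \<alpha> * x) / \<alpha>"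

lemma discretization_generic:
  assumes B: "resolvent_symbol B C0" and t: "0 \<le> t" and h: "0 < h" and d: "0 < d" "d < \<Delta>"
    and low: "\<And>M::nat. cmod (integral {-(M + 1/2) * h..(M + 1/2) * h}
      (\<lambda>x. scalar_integrand B t (Complex x (-d)) / (sinc_exp h (Complex x (-d)) - 1))) \<le> \<Lambda> + B2 * exp (- \<alpha> * ((M + 1/2) * h))"
    and I: "((\<lambda>x. scalar_integrand B t (of_real x)) has_integral I) UNIV"
  shows "cmod (I - h * (\<Sum>k=-int N..int N. scalar_integrand B t (of_real (of_int k * h))))
    \<le> \<Lambda> + 2 * (K (cos \<beta>) * C0) / \<alpha> / (exp (2 * pi * d / h) - 1) + tail_bound C0 t (real N * h)"
proof -
  have C0: "0 \<le> C0" using B by (simp add: resolvent_symbol_def)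
  have bd: "\<beta> + d < pi / 2" using d beta_bounds by simp
  define k where "k = cos (\<beta> + d)"
  have k: "0 < k" unfolding k_def using bd d beta_bounds by (intro cos_gt_zero_pi) auto
  have kc: "k \<le> cos (\<beta> - y)" if "\<bar>y\<bar> \<le> d" for y
    unfolding k_def using that bd d beta_bounds phi_pos by (intro cos_monotone_0_pi_le) (auto simp: \<Delta>_def)
  have tl: "cmod (scalar_integrand B t (of_real x)) \<le> (K (cos \<beta>) * C0 * exp (- (R * cos \<beta> * cosh (real N * h) * t))) * exp (- \<alpha> * \<bar>x\<bar>)"
    if x: "real N * h \<le> \<bar>x\<bar>" for x
  proof -
    have "cosh (real N * h) \<le> cosh \<bar>x\<bar>" using x h by (subst cosh_real_nonneg_le_iff) auto
    then have "R * cos \<beta> * cosh (real N * h) * t \<le> R * cos \<beta> * cosh x * t"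
      using R_pos cos_phi_pos t by (intro mult_right_mono mult_left_mono) auto
    then have "exp (- (R * cos \<beta> * cosh x * t)) * (K (cos \<beta>) * C0) * exp (- \<alpha> * \<bar>x\<bar>)
      \<le> exp (- (R * cos \<beta> * cosh (real N * h) * t)) * (K (cos \<beta>) * C0) * exp (- \<alpha> * \<bar>x\<bar>)"
      using K_nonneg cos_phi_pos C0 by (intro mult_right_mono) auto
    moreover have "of_real x = Complex x 0" by (simp add: complex_eq_iff)
    ultimately show ?thesis
      using norm_integrand_strip_le[OF B, of 0 "cos \<beta>" t x] Delta_pos cos_phi_pos t by (simp add: mult_ac)
  qed
  have up: "cmod (scalar_integrand B t (Complex x d)) \<le> K (cos \<beta>) * C0 * exp (- \<alpha> * \<bar>x\<bar>)" for x
    using d t beta_bounds cos_phi_pos phi_pos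
    by (intro norm_integrand_strip_le'[OF B]) (auto intro!: cos_monotone_0_pi_le simp: \<Delta>_def)
  have "cmod (I - h * (\<Sum>k=-int N..int N. scalar_integrand B t (of_real (of_int k * h))))
    \<le> \<Lambda> + 2 * (K (cos \<beta>) * C0) / \<alpha> / (exp (2 * pi * d / h) - 1)
       + 2 * (K (cos \<beta>) * C0 * exp (- (R * cos \<beta> * cosh (real N * h) * t))) * exp (- \<alpha> * (real N * h)) / \<alpha>"
  proof (rule sinc_quadrature_error[OF alpha(1) h d integrand_holomorphic[OF B] _ low up _ tl I])
    show "cmod (scalar_integrand B t (Complex x y)) \<le> K k * C0 * exp (- \<alpha> * \<bar>x\<bar>)" if "\<bar>y\<bar> \<le> d" for x y
      using that d k kc t by (intro norm_integrand_strip_le'[OF B]) auto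
    show "0 \<le> K (cos \<beta>) * C0 * exp (- (R * cos \<beta> * cosh (real N * h) * t))"
      using K_nonneg cos_phi_pos C0 by auto
  qed
  then show ?thesis by (simp add: tail_bound_def mult_ac)
qed

lemma norm_div_sinc_exp_le:
  assumes "0 < h" "0 < d" "cmod w \<le> A" "Im \<zeta> \<le> - d"
  shows "cmod (w / (sinc_exp h \<zeta> - 1)) \<le> A / (exp (2 * pi * d / h) - 1)"
proof -
  have "exp (2 * pi * d / h) \<le> cmod (sinc_exp h \<zeta>)"
  proof -
    have "2 * pi * d / h \<le> 2 * pi * (- Im \<zeta>) / h"
      using assms by (intro divide_right_mono mult_left_mono) auto
    then show ?thesis by (simp add: norm_sinc_exp)
  qed
  then have "exp (2 * pi * d / h) - 1 \<le> cmod (sinc_exp h \<zeta> - 1)"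
    using norm_triangle_ineq2[of "sinc_exp h \<zeta>" 1] by simp
  then show ?thesis unfolding norm_divide using assms order_trans[OF norm_ge_zero assms(3)]
    by (intro frac_le) auto
qed

lemma sinc_exp_ne_1: "0 < h \<Longrightarrow> Im \<zeta> \<noteq> 0 \<Longrightarrow> sinc_exp h \<zeta> \<noteq> 1"
  using norm_sinc_exp[of h \<zeta>] by auto

lemma continuous_on_sinc_exp: "continuous_on A (sinc_exp h)"
  unfolding sinc_exp_def[abs_def] by (cases "h = 0") (auto intro!: continuous_intros)

lemma lower_line_simple:
  assumes B: "resolvent_symbol B C0" and t: "0 \<le> t" and h: "0 < h" and d: "0 < d" "d < \<Delta>"
    and k: "0 < k" "k \<le> cos (\<beta> + d)"
  shows "cmod (integral {-(real M + 1/2) * h..(real M + 1/2) * h}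
      (\<lambda>x. scalar_integrand B t (Complex x (-d)) / (sinc_exp h (Complex x (-d)) - 1)))
    \<le> 2 * (K k * C0) / \<alpha> / (exp (2 * pi * d / h) - 1)"
proof -
  let ?A = "K k * C0 / (exp (2 * pi * d / h) - 1)"
  have C0: "0 \<le> C0" using B by (simp add: resolvent_symbol_def)
  have q: "1 < exp (2 * pi * d / h)" using d h by simp
  have "cmod (integral {-((real M + 1/2) * h)..(real M + 1/2) * h}
      (\<lambda>x. scalar_integrand B t (Complex x (-d)) / (sinc_exp h (Complex x (-d)) - 1))) \<le> 2 * ?A / \<alpha>"
  proof (rule norm_integral_exp_abs_le[OF alpha(1)])
    show "continuous_on {-((real M + 1/2) * h)..(real M + 1/2) * h} (\<lambda>x. scalar_integrand B t (Complex x (-d)) / (sinc_exp h (Complex x (-d)) - 1))"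
      using sinc_exp_ne_1[OF h] d
      by (intro continuous_intros continuous_on_compose2[OF holomorphic_on_imp_continuous_on[OF integrand_holomorphic[OF B]]]
          continuous_on_compose2[OF continuous_on_sinc_exp[of UNIV]]) auto
    fix x
    have "cmod (scalar_integrand B t (Complex x (-d))) \<le> K k * C0 * exp (- \<alpha> * \<bar>x\<bar>)"
      using d k t by (intro norm_integrand_strip_le'[OF B]) auto
    from norm_div_sinc_exp_le[OF h d(1) this, of "Complex x (-d)"]
    show "cmod (scalar_integrand B t (Complex x (-d)) / (sinc_exp h (Complex x (-d)) - 1)) \<le> ?A * exp (- \<alpha> * \<bar>x\<bar>)" by simp
  qed (use h C0 K_nonneg[OF k(1)] q in auto)
  then show ?thesis unfolding mult_minus_left by (simp add: mult_ac)
qed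

end

section \<open>The lower line when the strip ends on the imaginary axis\<close>

lemma integral_of_primitive:
  fixes P :: "complex \<Rightarrow> complex" and \<gamma> :: "real \<Rightarrow> complex"
  assumes "a \<le> b" and S: "open S"
    and P: "\<And>z. z \<in> S \<Longrightarrow> (P has_field_derivative G z) (at z)"
    and g: "\<And>y. y \<in> {a..b} \<Longrightarrow> \<gamma> y \<in> S" "\<And>y. y \<in> {a..b} \<Longrightarrow> (\<gamma> has_vector_derivative \<gamma>' y) (at y)"
  shows "integral {a..b} (\<lambda>y. \<gamma>' y * G (\<gamma> y)) = P (\<gamma> b) - P (\<gamma> a)"
proof -
  have "((\<lambda>y. \<gamma>' y * G (\<gamma> y)) has_integral (P \<circ> \<gamma>) b - (P \<circ> \<gamma>) a) {a..b}"
  proof (rule fundamental_theorem_of_calculus[OF assms(1)])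
    fix y assume y: "y \<in> {a..b}"
    show "((P \<circ> \<gamma>) has_vector_derivative \<gamma>' y * G (\<gamma> y)) (at y within {a..b})"
      by (rule has_vector_derivative_at_within[OF field_vector_diff_chain_at[OF g(2)[OF y] P[OF g(1)[OF y]]]])
  qed
  then show ?thesis by (simp add: integral_unique)
qed

context hyperbola
begin

text \<open>The inverse of \<open>Z\<close>; it lets straight lines in the \<open>z\<close>-plane be used as paths in the strip.\<close>

definition zeta_of :: "complex \<Rightarrow> complex" where
  "zeta_of z = - \<i> * (Arccos (z / of_real R) - of_real \<beta>)"

lemma Arccos_domain:
  assumes "\<bar>Re z\<bar> < R" shows "\<bar>Re (z / of_real R)\<bar> < 1"
  using assms R_pos by (simp add: abs_less_iff field_simps)

lemma Z_zeta_of: "Z (zeta_of z) = z"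
  using R_pos by (simp add: Z_def zeta_of_def algebra_simps)

lemma Im_zeta_of: "Im (zeta_of z) = \<beta> - Re (Arccos (z / of_real R))"
  by (simp add: zeta_of_def)

lemma zeta_of_Z:
  assumes "0 < \<beta> - Im \<zeta>" "\<beta> - Im \<zeta> < pi" shows "zeta_of (Z \<zeta>) = \<zeta>"
proof -
  have "Arccos (Z \<zeta> / of_real R) = of_real \<beta> + \<i> * \<zeta>"
    unfolding Z_def using R_pos assms by (auto intro!: Arccos_unique)
  then show ?thesis by (simp add: zeta_of_def algebra_simps)
qed

text \<open>The real part of the arccosine is the angle of the hyperbola through \<open>z\<close>, and to the left of the vertical
line through the vertex of the hyperbola of angle \<open>\<gamma>\<close> only larger angles occur.\<close>

lemma Re_Arccos_ge:
  assumes z: "\<bar>Re z\<bar> < R" and \<gamma>: "0 \<le> \<gamma>" "\<gamma> \<le> pi / 2" and le: "Re z \<le> R * cos \<gamma>"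
  shows "\<gamma> \<le> Re (Arccos (z / of_real R))"
proof (rule ccontr)
  let ?\<theta> = "Arccos (z / of_real R)"
  assume neg: "\<not> \<gamma> \<le> Re ?\<theta>"
  have th: "0 < Re ?\<theta>" "Re ?\<theta> < pi" using Arccos_bounds[OF Arccos_domain[OF z]] by auto
  have "Re (cos ?\<theta>) = cos (Re ?\<theta>) * cosh (Im ?\<theta>)"
    using arg_cong[OF Re_Im_cos_Complex[of "Re ?\<theta>" "Im ?\<theta>"], of Re] by simp
  then have re: "Re z / R = cos (Re ?\<theta>) * cosh (Im ?\<theta>)" by simp
  have c: "cos \<gamma> < cos (Re ?\<theta>)" "0 \<le> cos \<gamma>"
    using neg th \<gamma> by (auto intro!: cos_monotone_0_pi cos_ge_zero)
  have "cos (Re ?\<theta>) * 1 \<le> cos (Re ?\<theta>) * cosh (Im ?\<theta>)"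
    using c cosh_real_ge_1 by (intro mult_left_mono) auto
  also have "\<dots> \<le> cos \<gamma>" using le R_pos by (simp add: re[symmetric] field_simps)
  finally show False using c by simp
qed

lemma Re_Arccos_gt:
  assumes "\<bar>Re z\<bar> < R" "Re z < R * cos \<beta>"
  shows "\<beta> < Re (Arccos (z / of_real R))"
proof -
  have "\<beta> \<le> Re (Arccos (z / of_real R))"
    using assms beta_bounds by (intro Re_Arccos_ge) auto
  moreover have "Re (Arccos (z / of_real R)) \<noteq> \<beta>"
  proof
    let ?\<theta> = "Arccos (z / of_real R)"
    assume b: "Re ?\<theta> = \<beta>"
    have "Re (cos ?\<theta>) = cos (Re ?\<theta>) * cosh (Im ?\<theta>)"
      using arg_cong[OF Re_Im_cos_Complex[of "Re ?\<theta>" "Im ?\<theta>"], of Re] by simp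
    then have "Re z / R = cos \<beta> * cosh (Im ?\<theta>)" by (simp add: b)
    moreover have "cos \<beta> * 1 \<le> cos \<beta> * cosh (Im ?\<theta>)"
      using cos_phi_pos cosh_real_ge_1 by (intro mult_left_mono) auto
    ultimately have "R * cos \<beta> \<le> Re z" using R_pos by (simp add: field_simps)
    then show False using assms by simp
  qed
  ultimately show ?thesis by simp
qed

text \<open>On the lower line itself the integrand has no bound that is uniform in \<open>d\<close>. In the strip it has a
primitive, so the path may be replaced by two short vertical segments and the preimage of the line
\<open>Re z = e\<close> through the vertex of the hyperbola \<open>Im \<zeta> = -d\<close>. The segments contribute \<open>O(exp (-\<alpha> X))\<close>, and
\<open>boundary_line_bound\<close> applies to the line. The kernel \<open>1 / (sinc_exp h \<zeta> - 1)\<close> is part of the function \<open>g\<close>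
there, and its modulus on \<open>Re z \<le> e\<close> is at most \<open>1 / (exp (2 \<pi> d / h) - 1)\<close>.\<close>

lemma lower_line_imaginary_axis:
  assumes right: "\<beta> + \<Delta> = pi / 2" and t: "0 \<le> t"
  shows "\<exists>C\<ge>0. \<forall>B C0 h d. resolvent_symbol B C0 \<longrightarrow> 0 < h \<longrightarrow> 0 < d \<longrightarrow> d < \<Delta> \<longrightarrow> R * cos (\<beta> + d) < 1 \<longrightarrow>
      (\<exists>B2. \<forall>M::nat. cmod (integral {-(real M + 1/2) * h..(real M + 1/2) * h}
          (\<lambda>x. scalar_integrand B t (Complex x (-d)) / (sinc_exp h (Complex x (-d)) - 1)))
        \<le> C * C0 / (exp (2 * pi * d / h) - 1) + B2 * exp (- \<alpha> * ((real M + 1/2) * h)))"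
proof -
  \<comment> \<open>In \<open>\<bar>Re z\<bar> < r\<close> the resolvent is regular and \<open>z\<close> lies to the left of the hyperbola \<open>Im \<zeta> = 0\<close>, where the
    kernel has its poles; \<open>r \<le> 1\<close> lets \<open>\<bar>Im z\<bar> > 1\<close> imply the angle condition on \<open>z\<close>.\<close>
  define r where "r = min 1 (R * cos \<beta>)"
  define \<eta> where "\<eta> = r / 2"
  have r: "0 < r" "r \<le> 1" "r \<le> R * cos \<beta>" using R_pos cos_phi_pos by (auto simp: r_def)
  have rR: "r < R"
  proof -
    have "cos \<beta> < 1" using beta_bounds cos_monotone_0_pi[of 0 \<beta>] by simp
    then have "R * cos \<beta> < R * 1" using R_pos by (intro mult_strict_left_mono)
    then show ?thesis using r by simp
  qed
  have eta: "0 < \<eta>" "\<eta> < r" using r by (auto simp: \<eta>_def)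
  have "\<exists>C\<ge>0. \<forall>g e \<kappa> Y. g holomorphic_on {z. -r < Re z \<and> Re z < r} \<longrightarrow> 0 < e \<longrightarrow> e < r \<longrightarrow> 0 < Y \<longrightarrow>
      (\<forall>z. -\<eta> \<le> Re z \<longrightarrow> Re z \<le> e \<longrightarrow> cmod (g z) \<le> \<kappa> * (1 + \<bar>Im z\<bar>) powr (-\<alpha>)) \<longrightarrow>
      cmod (integral {-Y..Y} (\<lambda>y. f (Complex e y) * g (Complex e y) / Complex e y))
        \<le> C * \<kappa> + 2 * (\<eta> + e) * ((2 + f_bound e) * \<kappa> / Y)"
    by (rule boundary_line_bound[OF alpha(1) eta])
  then obtain C1 where C1: "0 \<le> C1" and line: "\<forall>g e \<kappa> Y. g holomorphic_on {z. -r < Re z \<and> Re z < r} \<longrightarrow> 0 < e \<longrightarrow> e < r \<longrightarrow> 0 < Y \<longrightarrow>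
      (\<forall>z. -\<eta> \<le> Re z \<longrightarrow> Re z \<le> e \<longrightarrow> cmod (g z) \<le> \<kappa> * (1 + \<bar>Im z\<bar>) powr (-\<alpha>)) \<longrightarrow>
      cmod (integral {-Y..Y} (\<lambda>y. f (Complex e y) * g (Complex e y) / Complex e y))
        \<le> C1 * \<kappa> + 2 * (\<eta> + e) * ((2 + f_bound e) * \<kappa> / Y)"
    by (elim exE conjE) (rule that)
  define C where "C = C1 * (2 * exp (\<eta> * t))"
  have C0: "0 \<le> C" using C1 by (simp add: C_def)
  have main: "\<exists>B2. \<forall>M::nat. cmod (integral {-(real M + 1/2) * h..(real M + 1/2) * h}
          (\<lambda>x. scalar_integrand B t (Complex x (-d)) / (sinc_exp h (Complex x (-d)) - 1)))
        \<le> C * C0 / (exp (2 * pi * d / h) - 1) + B2 * exp (- \<alpha> * ((real M + 1/2) * h))"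
    if B: "resolvent_symbol B C0" and h: "0 < h" and d: "0 < d" "d < \<Delta>" and d1: "R * cos (\<beta> + d) < 1" for B C0 h d
  proof -
    have C0: "0 \<le> C0" using B by (simp add: resolvent_symbol_def)
    define e where "e = R * cos (\<beta> + d)"
    have e: "0 < e" "e < r"
    proof -
      have "0 < cos (\<beta> + d)" using d right beta_bounds by (intro cos_gt_zero_pi) auto
      then show "0 < e" using R_pos by (simp add: e_def)
      have "cos (\<beta> + d) < cos \<beta>" using d right beta_bounds by (intro cos_monotone_0_pi) auto
      then show "e < r" using R_pos d1 by (simp add: e_def r_def)
    qed
    define q1 where "q1 = exp (2 * pi * d / h) - 1"
    have q1: "0 < q1" using d h by (simp add: q1_def)
    define G where "G \<zeta> = scalar_integrand B t \<zeta> / (sinc_exp h \<zeta> - 1)" for \<zeta>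
    define S where "S = {\<zeta>. - \<Delta> < Im \<zeta>} \<inter> {\<zeta>. Im \<zeta> < 0}"
    have oS: "open S" unfolding S_def by (intro open_Int open_Collect_less continuous_intros)
    have cS: "convex S" unfolding S_def by (intro convex_Int convex_halfspace_Im_lt convex_halfspace_Im_gt)
    have Gh: "G holomorphic_on S" unfolding G_def[abs_def]
    proof (intro holomorphic_intros)
      show "scalar_integrand B t holomorphic_on S" by (rule holomorphic_on_subset[OF integrand_holomorphic[OF B]]) (auto simp: S_def)
      show "sinc_exp h holomorphic_on S" unfolding sinc_exp_def[abs_def] using h by (intro holomorphic_intros) auto
      show "sinc_exp h \<zeta> - 1 \<noteq> 0" if "\<zeta> \<in> S" for \<zeta> using sinc_exp_ne_1[OF h, of \<zeta>] that by (auto simp: S_def)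
    qed
    obtain P where P': "\<And>z. z \<in> S \<Longrightarrow> (P has_field_derivative G z) (at z within S)"
      using holomorphic_convex_primitive'[OF cS oS Gh] by blast
    have P: "(P has_field_derivative G z) (at z)" if "z \<in> S" for z
      using P'[OF that] at_within_open[OF that oS] by simp
    define g where "g z = exp (- z * of_real t) * B z / ((sinc_exp h (zeta_of z) - 1) * (2 * of_real pi))" for z
    define \<kappa> where "\<kappa> = 2 * exp (\<eta> * t) * C0 / q1"
    have k0: "0 \<le> \<kappa>" using C0 q1 by (simp add: \<kappa>_def)
    have dom: "\<bar>Re z\<bar> < R" "Re z < R * cos \<beta>" "z \<in> U" if "-r < Re z" "Re z < r" for z
    proof -
      show "\<bar>Re z\<bar> < R" "Re z < R * cos \<beta>" using that r rR by auto
      have "cos \<beta> < cos \<phi>" using phi_less phi_pos beta_bounds by (intro cos_monotone_0_pi) auto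
      then have "R * cos \<beta> < R * cos \<phi>" using R_pos by simp
      then have "Re z - R * cos \<phi> < 0" using that r by linarith
      moreover have "0 < tan \<phi>" using phi_pos beta_bounds by (intro tan_gt_zero)
      ultimately have "tan \<phi> * (Re z - R * cos \<phi>) < 0" by (simp add: mult_pos_neg)
      then show "z \<in> U" by (simp add: U_def sector_compl_def)
    qed
    have gh: "g holomorphic_on {z. -r < Re z \<and> Re z < r}"
    proof -
      let ?V = "{z. -r < Re z \<and> Re z < r}"
      have A: "(\<lambda>z. Arccos (z / of_real R)) holomorphic_on ?V"
      proof (rule holomorphic_on_compose_gen[where g = Arccos and f = "\<lambda>z. z / of_real R" and t = "{z. \<bar>Re z\<bar> < 1}", unfolded o_def])
        show "Arccos holomorphic_on {z. \<bar>Re z\<bar> < 1}" by (rule holomorphic_on_Arccos) auto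
        show "(\<lambda>z. z / of_real R) ` ?V \<subseteq> {z. \<bar>Re z\<bar> < 1}"
        proof (rule image_subsetI)
          fix z assume "z \<in> ?V"
          then have "\<bar>Re (z / of_real R)\<bar> < 1" by (intro Arccos_domain dom(1)) auto
          then show "z / of_real R \<in> {z. \<bar>Re z\<bar> < 1}" by (rule CollectI)
        qed
        show "(\<lambda>z. z / of_real R) holomorphic_on ?V" by (intro holomorphic_intros) (use R_pos in auto)
      qed
      define AR where "AR z = Arccos (z / of_real R)" for z
      have A': "AR holomorphic_on ?V" using A by (simp add: AR_def[abs_def])
      have "(\<lambda>z. exp (2 * pi * \<i> * (- \<i> * (AR z - of_real \<beta>)) / h)) holomorphic_on ?V"
        by (intro holomorphic_intros A') (use h in auto)
      then have q: "(\<lambda>z. sinc_exp h (zeta_of z)) holomorphic_on ?V"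
        by (simp add: sinc_exp_def zeta_of_def AR_def)
      have n: "sinc_exp h (zeta_of z) - 1 \<noteq> 0" if "z \<in> ?V" for z
        using sinc_exp_ne_1[OF h, of "zeta_of z"] Re_Arccos_gt[of z] dom(1,2)[of z] that by (auto simp: Im_zeta_of)
      have Bh: "B holomorphic_on ?V"
        by (rule holomorphic_on_subset[of B U]) (use B dom(3) in \<open>auto simp: resolvent_symbol_def\<close>)
      define Q where "Q z = sinc_exp h (zeta_of z)" for z
      have Qh: "Q holomorphic_on ?V" using q by (simp add: Q_def[abs_def])
      have "(\<lambda>z. exp (- z * of_real t) * B z / ((Q z - 1) * (2 * of_real pi))) holomorphic_on ?V"
        by (intro holomorphic_intros Qh Bh) (use n in \<open>auto simp: Q_def\<close>)
      then show ?thesis by (simp add: g_def[abs_def] Q_def)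
    qed
    have gb: "cmod (g z) \<le> \<kappa> * (1 + \<bar>Im z\<bar>) powr (-\<alpha>)" if z: "-\<eta> \<le> Re z" "Re z \<le> e" for z
    proof -
      have zr: "-r < Re z" "Re z < r" using z eta e by auto
      note dz = dom[OF zr]
      have "\<beta> + d \<le> Re (Arccos (z / of_real R))"
        using dz d right beta_bounds z by (intro Re_Arccos_ge) (auto simp: e_def)
      then have im: "Im (zeta_of z) \<le> - d" by (simp add: Im_zeta_of)
      have Bz: "cmod (B z) \<le> C0 * (2 * (1 + \<bar>Im z\<bar>) powr (-\<alpha>))"
      proof (cases "\<bar>Im z\<bar> \<le> 1")
        case True
        \<comment> \<open>The factor 2 absorbs \<open>2 powr \<alpha>\<close>, so that one bound covers all of the strip.\<close>
        have "1 = 2 * 2 powr (-1::real)" by (simp add: powr_minus)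
        also have "\<dots> \<le> 2 * 2 powr (-\<alpha>)" using alpha by (intro mult_left_mono powr_mono) auto
        also have "\<dots> \<le> 2 * (1 + \<bar>Im z\<bar>) powr (-\<alpha>)"
          using True alpha by (intro mult_left_mono powr_mono2') auto
        finally have "C0 * 1 \<le> C0 * (2 * (1 + \<bar>Im z\<bar>) powr (-\<alpha>))" using C0 by (intro mult_left_mono) auto
        moreover have "cmod (B z) \<le> C0" using B dz by (simp add: resolvent_symbol_def)
        ultimately show ?thesis by simp
      next
        case False
        define a where "a = \<bar>Im z\<bar>"
        have a: "1 < a" "a \<le> cmod z" using False abs_Im_le_cmod[of z] by (simp_all add: a_def)
        then have le: "(1 + \<bar>Im z\<bar>) / 2 \<le> cmod z" unfolding a_def[symmetric] by simp
        have "- Re z \<le> a" using a(1) zr(1) r(2) by linarith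
        then have "- Re z \<le> \<bar>Im z\<bar>" "z \<noteq> 0" using a by (auto simp: a_def)
        then have "cmod (B z) \<le> C0 * cmod z powr (-\<alpha>)" using B dz by (simp add: resolvent_symbol_def)
        also have "\<dots> \<le> C0 * ((1 + \<bar>Im z\<bar>) / 2) powr (-\<alpha>)"
          using le C0 alpha by (intro mult_left_mono powr_mono2') auto
        also have "((1 + \<bar>Im z\<bar>) / 2) powr (-\<alpha>) = 2 powr \<alpha> * (1 + \<bar>Im z\<bar>) powr (-\<alpha>)"
        proof -
          have "((1 + \<bar>Im z\<bar>) / 2) powr (-\<alpha>) = (1 + \<bar>Im z\<bar>) powr (-\<alpha>) / 2 powr (-\<alpha>)"
            by (rule powr_divide)
          then show ?thesis by (simp only: powr_minus[of 2 \<alpha>] divide_inverse inverse_inverse_eq mult.commute)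
        qed
        also have "C0 * \<dots> \<le> C0 * (2 powr 1 * (1 + \<bar>Im z\<bar>) powr (-\<alpha>))"
          using C0 alpha by (intro mult_left_mono mult_right_mono powr_mono) auto
        finally show ?thesis by simp
      qed
      have ex: "cmod (exp (- z * of_real t)) \<le> exp (\<eta> * t)"
        using mult_right_mono[OF z(1) t] by simp
      have "cmod (exp (- z * of_real t) * B z / (2 * of_real pi)) \<le> exp (\<eta> * t) * (C0 * (2 * (1 + \<bar>Im z\<bar>) powr (-\<alpha>))) / 1"
        unfolding norm_divide norm_mult[of "exp _"] using ex Bz C0 pi_ge_two by (intro frac_le mult_mono) auto
      from norm_div_sinc_exp_le[OF h d(1) this im]
      show ?thesis unfolding g_def \<kappa>_def q1_def by (simp add: mult_ac)
    qed
    \<comment> \<open>\<open>k\<close> compares \<open>sinh\<close> with \<open>cosh\<close> on \<open>X \<ge> h / 2\<close>. It may depend on \<open>h\<close>, since it enters only the terms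
      that vanish for large \<open>X\<close>.\<close>
    define k where "k = tanh (h / 2)"
    have k: "0 < k" using h by (simp add: k_def)
    have sinh_ge: "k * cosh X \<le> sinh X" if "h / 2 \<le> X" for X
    proof -
      have "tanh (h / 2) \<le> tanh X" using that by (simp add: tanh_real_le_iff)
      then show ?thesis by (simp add: k_def tanh_def field_simps)
    qed
    define D1 where "D1 = f_bound e * (C0 * ((R * k / 2) powr (-\<alpha>) / k)) / q1"
    define D2 where "D2 = 2 * (\<eta> + e) * ((2 + f_bound e) * \<kappa>) * (2 / (R * sin \<beta> * k))"
    have sb: "0 < sin \<beta>" using beta_bounds by (intro sin_gt_zero) auto
    have "cmod (integral {-((real M + 1/2) * h)..(real M + 1/2) * h} (\<lambda>x. G (Complex x (-d))))
        \<le> C * C0 / q1 + (2 * \<Delta> * D1 + D2) * exp (- \<alpha> * ((real M + 1/2) * h))" for M :: nat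
    proof -
      define X where "X = (real M + 1/2) * h"
      have X: "h / 2 \<le> X" "0 < X" using h by (auto simp: X_def distrib_right intro!: add_nonneg_pos)
      have ch: "1 \<le> cosh X" by (rule cosh_real_ge_1)
      \<comment> \<open>\<open>\<gamma>\<close> is the angle for which \<open>Re z = e\<close> at the abscissae \<open>\<plusminus> X\<close>.\<close>
      define \<gamma> where "\<gamma> = arccos (e / (R * cosh X))"
      have eR: "e / (R * cosh X) \<le> cos (\<beta> + d)" "0 < e / (R * cosh X)"
      proof -
        have "e / (R * cosh X) \<le> e / (R * 1)"
          using e R_pos ch by (intro divide_left_mono mult_left_mono) auto
        then show "e / (R * cosh X) \<le> cos (\<beta> + d)" using R_pos by (simp add: e_def)
        show "0 < e / (R * cosh X)" using e R_pos by simp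
      qed
      have eR1: "e / (R * cosh X) \<le> 1" using eR(1) cos_le_one[of "\<beta> + d"] by linarith
      have cg: "cos \<gamma> = e / (R * cosh X)" unfolding \<gamma>_def by (rule cos_arccos) (use eR eR1 in linarith)+
      have g_lt: "\<gamma> < pi / 2"
        unfolding \<gamma>_def using arccos_less_arccos[of 0 "e / (R * cosh X)", OF _ eR(2) eR1] by (simp only: arccos_0)
      have g_ge: "\<beta> + d \<le> \<gamma>"
      proof -
        have "arccos (cos (\<beta> + d)) \<le> \<gamma>"
          unfolding \<gamma>_def by (rule arccos_le_arccos) (use eR cos_le_one[of "\<beta> + d"] in linarith)+
        moreover have "arccos (cos (\<beta> + d)) = \<beta> + d"
          by (rule arccos_cos) (use d right beta_bounds pi_gt_zero in linarith)+
        ultimately show ?thesis by simp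
      qed
      define Y where "Y = R * sin \<gamma> * sinh X"
      have sg: "sin \<beta> \<le> sin \<gamma>" using g_ge g_lt d beta_bounds by (intro sin_monotone_2pi_le) auto
      have Yge: "R * sin \<beta> * k * (exp X / 2) \<le> Y"
      proof -
        have "k * (exp X / 2) \<le> k * cosh X" using exp_abs_le_cosh[of X] k X by (intro mult_left_mono) auto
        also have "\<dots> \<le> sinh X" by (rule sinh_ge[OF X(1)])
        finally have "R * sin \<beta> * (k * (exp X / 2)) \<le> R * sin \<gamma> * sinh X"
          using R_pos sb sg k by (intro mult_mono mult_left_mono) auto
        then show ?thesis by (simp add: Y_def mult.assoc)
      qed
      have "0 < R * sin \<beta> * k * (exp X / 2)" using R_pos sb k by (intro mult_pos_pos) auto
      then have Ypos: "0 < Y" using Yge by (rule less_le_trans)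
      have Rcg: "R * cos \<gamma> * cosh X = e" unfolding cg using R_pos by simp
      have ends: "Z (Complex X (\<beta> - \<gamma>)) = Complex e (-Y)" "Z (Complex (-X) (\<beta> - \<gamma>)) = Complex e Y"
        using Rcg by (simp_all add: Z_Complex Y_def)
      have zends: "zeta_of (Complex e (-Y)) = Complex X (\<beta> - \<gamma>)" "zeta_of (Complex e Y) = Complex (-X) (\<beta> - \<gamma>)"
      proof -
        have "0 < \<gamma>" "\<gamma> < pi" using g_ge g_lt d beta_bounds by linarith+
        then show "zeta_of (Complex e (-Y)) = Complex X (\<beta> - \<gamma>)" "zeta_of (Complex e Y) = Complex (-X) (\<beta> - \<gamma>)"
          unfolding ends[symmetric] by (intro zeta_of_Z; simp)+
      qed
      have inS: "zeta_of (Complex e y) \<in> S" for y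
      proof -
        let ?\<theta> = "Arccos (Complex e y / of_real R)"
        have re: "\<bar>Re (Complex e y)\<bar> < R" using e rR by simp
        have "\<beta> < Re ?\<theta>" using re e r by (intro Re_Arccos_gt) auto
        moreover have "Re ?\<theta> < pi / 2"
        proof -
          have "Re (cos ?\<theta>) = cos (Re ?\<theta>) * cosh (Im ?\<theta>)"
            using arg_cong[OF Re_Im_cos_Complex[of "Re ?\<theta>" "Im ?\<theta>"], of Re] by simp
          then have "cos (Re ?\<theta>) * cosh (Im ?\<theta>) = e / R" by simp
          then have "0 < cos (Re ?\<theta>) * cosh (Im ?\<theta>)" using e(1) R_pos by simp
          then have c: "0 < cos (Re ?\<theta>)" using cosh_real_pos by (rule zero_less_mult_pos2)
          have th: "0 < Re ?\<theta> \<and> Re ?\<theta> < pi" by (rule Arccos_bounds[OF Arccos_domain[OF re]])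
          show ?thesis
          proof (rule ccontr)
            assume "\<not> Re ?\<theta> < pi / 2"
            then have "cos (Re ?\<theta>) \<le> cos (pi / 2)"
              by (intro cos_monotone_0_pi_le) (use th pi_gt_zero in linarith)+
            then show False using c unfolding cos_pi_half by linarith
          qed
        qed
        ultimately have "- \<Delta> < \<beta> - Re ?\<theta>" "\<beta> - Re ?\<theta> < 0" using right by linarith+
        then show ?thesis by (simp add: S_def Im_zeta_of)
      qed
      define \<theta>' where "\<theta>' y = - 1 / (of_real R * sin (Arccos (Complex e y / of_real R)))" for y
      have dz: "((\<lambda>y. zeta_of (Complex e y)) has_vector_derivative \<theta>' y) (at y)" for y
      proof -
        have re: "\<bar>Re (Complex e y)\<bar> < R" using e rR by simp
        have f1: "((\<lambda>y. Complex e y / of_real R) has_vector_derivative (\<i> / of_real R)) (at y)"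
          unfolding Complex_eq using R_pos by (auto intro!: derivative_eq_intros simp: has_vector_derivative_def scaleR_conv_of_real algebra_simps)
        have f2: "(Arccos has_field_derivative - inverse (sin (Arccos (Complex e y / of_real R)))) (at (Complex e y / of_real R))"
          using Arccos_domain[OF re] by (intro has_field_derivative_Arccos) auto
        from field_vector_diff_chain_at[OF f1 f2]
        have "((\<lambda>y. Arccos (Complex e y / of_real R)) has_vector_derivative
            (\<i> / of_real R * - inverse (sin (Arccos (Complex e y / of_real R))))) (at y)" by (simp add: o_def)
        then have "((\<lambda>y. - \<i> * (Arccos (Complex e y / of_real R) - of_real \<beta>)) has_vector_derivative
            (- \<i> * (\<i> / of_real R * - inverse (sin (Arccos (Complex e y / of_real R))) - 0))) (at y)"
          by (intro has_vector_derivative_mult_right has_vector_derivative_diff has_vector_derivative_const)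
        then show ?thesis by (simp add: zeta_of_def \<theta>'_def divide_inverse mult_ac)
      qed
      have sin_nz: "sin (Arccos (Complex e y / of_real R)) \<noteq> 0" for y
      proof
        let ?\<theta> = "Arccos (Complex e y / of_real R)"
        assume "sin ?\<theta> = 0"
        then have "Re (sin ?\<theta>) = 0" by simp
        moreover have "0 < sin (Re ?\<theta>)"
          using Arccos_bounds[OF Arccos_domain[of "Complex e y"]] e rR by (intro sin_gt_zero) auto
        ultimately show False
          using arg_cong[OF Re_Im_sin_Complex[of "Re ?\<theta>" "Im ?\<theta>"], of Re] by simp
      qed
      have integrand: "\<theta>' y * G (zeta_of (Complex e y)) = f (Complex e y) * g (Complex e y) / Complex e y" for y
      proof -
        let ?s = "sin (Arccos (Complex e y / of_real R))"
        have "Z' (zeta_of (Complex e y)) = - (\<i> * of_real R * ?s)" by (simp add: Z'_def zeta_of_def algebra_simps)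
        then have az: "\<theta>' y * Z' (zeta_of (Complex e y)) = \<i>" using sin_nz[of y] R_pos by (simp add: \<theta>'_def field_simps)
        have alg: "a * (c * x * v * zp * w / s) = (a * zp) * (c * x * v * w / s)" for a c x v zp w s :: complex
          by (simp add: mult_ac)
        have alg': "\<i> * (1 / (2 * of_real pi * \<i>) * x * v * (w / z) / s) = v * (x * w / (s * (2 * of_real pi))) / z" for x v w z s :: complex
          by (cases "s = 0"; cases "z = 0"; simp add: mult_ac)
        have "\<theta>' y * G (zeta_of (Complex e y)) = (\<theta>' y * Z' (zeta_of (Complex e y))) * (1 / (2 * of_real pi * \<i>) *
            exp (- Complex e y * of_real t) * f (Complex e y) * (B (Complex e y) / Complex e y) / (sinc_exp h (zeta_of (Complex e y)) - 1))"
          unfolding G_def scalar_integrand_def Z_zeta_of by (rule alg)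
        also have "\<dots> = f (Complex e y) * g (Complex e y) / Complex e y"
          unfolding az g_def by (rule alg')
        finally show ?thesis .
      qed
      have line_int: "P (Complex (-X) (\<beta> - \<gamma>)) - P (Complex X (\<beta> - \<gamma>))
          = integral {-Y..Y} (\<lambda>y. f (Complex e y) * g (Complex e y) / Complex e y)"
        using integral_of_primitive[OF _ oS P inS dz, of "-Y" Y] Ypos unfolding integrand zends by simp
      have hor_int: "integral {-X..X} (\<lambda>x. G (Complex x (-d))) = P (Complex X (-d)) - P (Complex (-X) (-d))"
      proof -
        have "integral {-X..X} (\<lambda>x. 1 * G (Complex x (-d))) = P (Complex X (-d)) - P (Complex (-X) (-d))"
          by (rule integral_of_primitive[OF _ oS P])
             (use X d in \<open>auto simp: S_def Complex_eq intro!: derivative_eq_intros\<close>)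
        then show ?thesis by simp
      qed
      have vert: "cmod (P (Complex x (-d)) - P (Complex x (\<beta> - \<gamma>))) \<le> D1 * exp (- \<alpha> * X) * \<Delta>"
        if x: "\<bar>x\<bar> = X" for x
      proof -
        let ?seg = "closed_segment (Complex x (-d)) (Complex x (\<beta> - \<gamma>))"
        have seg: "Re \<zeta> = x \<and> \<beta> - \<gamma> \<le> Im \<zeta> \<and> Im \<zeta> \<le> - d" if "\<zeta> \<in> ?seg" for \<zeta>
          using that g_ge by (auto simp: closed_segment_same_Re closed_segment_eq_real_ivl split: if_splits)
        have segS: "?seg \<subseteq> S" using seg d g_lt right by (force simp: S_def)
        have "cmod (P (Complex x (-d)) - P (Complex x (\<beta> - \<gamma>))) \<le> D1 * exp (- \<alpha> * X) * cmod (Complex x (-d) - Complex x (\<beta> - \<gamma>))"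
        proof (rule field_differentiable_bound[of ?seg])
          fix \<zeta> assume z: "\<zeta> \<in> ?seg"
          show "(P has_field_derivative G \<zeta>) (at \<zeta> within ?seg)"
            using P segS z by (auto intro: has_field_derivative_at_within)
          define y where "y = Im \<zeta>"
          have zeq: "\<zeta> = Complex x y" and y: "\<beta> - \<gamma> \<le> y" "y \<le> - d" using seg[OF z] by (auto simp: y_def complex_eq_iff)
          have ylt: "\<bar>y\<bar> < \<Delta>" using y d g_lt right by auto
          have cx: "cosh x = cosh X" using x by (auto simp: abs_if split: if_splits)
          have sx: "\<bar>sinh x\<bar> = sinh X" using x X by (auto simp: abs_if split: if_splits)
          have "cos \<gamma> \<le> cos (\<beta> - y)" using y d g_lt beta_bounds by (intro cos_monotone_0_pi_le) auto
          then have "R * cos \<gamma> * cosh X \<le> R * cos (\<beta> - y) * cosh X" using R_pos by (intro mult_right_mono mult_left_mono) auto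
          then have re: "e \<le> Re (Z (Complex x y))" using Rcg by (simp add: Z_Complex cx)
          have nz: "k * (R * cosh x) \<le> cmod (Z (Complex x y))"
          proof (rule power2_le_imp_le)
            have "(k * (R * cosh x))\<^sup>2 = R\<^sup>2 * (k * cosh X)\<^sup>2" by (simp add: cx power_mult_distrib)
            also have "\<dots> \<le> R\<^sup>2 * (sinh X)\<^sup>2"
              using sinh_ge[OF X(1)] k by (intro mult_left_mono power_mono) auto
            also have "(sinh X)\<^sup>2 = (sinh x)\<^sup>2" using sx by (metis power2_abs)
            also have "R\<^sup>2 * (sinh x)\<^sup>2 \<le> R\<^sup>2 * ((cos (\<beta> - y))\<^sup>2 * (cosh x)\<^sup>2 + (sin (\<beta> - y))\<^sup>2 * (sinh x)\<^sup>2)"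
            proof (rule mult_left_mono)
              have "(sinh x)\<^sup>2 = ((cos (\<beta> - y))\<^sup>2 + (sin (\<beta> - y))\<^sup>2) * (sinh x)\<^sup>2" by simp
              also have "\<dots> = (cos (\<beta> - y))\<^sup>2 * (sinh x)\<^sup>2 + (sin (\<beta> - y))\<^sup>2 * (sinh x)\<^sup>2"
                by (rule distrib_right)
              also have "\<dots> \<le> (cos (\<beta> - y))\<^sup>2 * (cosh x)\<^sup>2 + (sin (\<beta> - y))\<^sup>2 * (sinh x)\<^sup>2"
                by (intro add_right_mono mult_left_mono) (auto simp: cosh_square_eq)
              finally show "(sinh x)\<^sup>2 \<le> (cos (\<beta> - y))\<^sup>2 * (cosh x)\<^sup>2 + (sin (\<beta> - y))\<^sup>2 * (sinh x)\<^sup>2" .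
            qed simp
            also have "\<dots> = (cmod (Z (Complex x y)))\<^sup>2"
              by (simp add: Z_Complex cmod_power2 power_mult_distrib algebra_simps)
            finally show "(k * (R * cosh x))\<^sup>2 \<le> (cmod (Z (Complex x y)))\<^sup>2" .
          qed simp
          have "cmod (scalar_integrand B t (Complex x y)) \<le> exp (- (Re (Z (Complex x y)) * t)) * (f_bound e * (C0 * ((R * k / 2) powr (-\<alpha>) / k) * exp (- \<alpha> * \<bar>x\<bar>)))"
            by (rule norm_integrand_le[OF B ylt k nz e(1) re])
          also have "\<dots> \<le> 1 * (f_bound e * (C0 * ((R * k / 2) powr (-\<alpha>) / k) * exp (- \<alpha> * \<bar>x\<bar>)))"
            using Re_Z_pos[OF ylt, of x] t f_bound_pos[OF e(1)] C0 k by (intro mult_right_mono) auto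
          finally have "cmod (scalar_integrand B t \<zeta>) \<le> f_bound e * (C0 * ((R * k / 2) powr (-\<alpha>) / k)) * exp (- \<alpha> * X)"
            using x by (simp add: zeq mult.assoc)
          from norm_div_sinc_exp_le[OF h d(1) this, of \<zeta>]
          show "cmod (G \<zeta>) \<le> D1 * exp (- \<alpha> * X)"
            using y by (simp add: G_def D1_def q1_def zeq)
        qed auto
        also have "cmod (Complex x (-d) - Complex x (\<beta> - \<gamma>)) = \<bar>\<gamma> - \<beta> - d\<bar>"
          by (simp add: cmod_def)
        also have "D1 * exp (- \<alpha> * X) * \<bar>\<gamma> - \<beta> - d\<bar> \<le> D1 * exp (- \<alpha> * X) * \<Delta>"
          using g_ge g_lt right d f_bound_pos[OF e(1)] C0 k q1 by (intro mult_left_mono) (auto simp: D1_def)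
        finally show ?thesis .
      qed
      have main: "cmod (P (Complex (-X) (\<beta> - \<gamma>)) - P (Complex X (\<beta> - \<gamma>))) \<le> C1 * \<kappa> + D2 * exp (- \<alpha> * X)"
      proof -
        have "1 / Y \<le> 1 / (R * sin \<beta> * k * (exp X / 2))"
          using Yge R_pos sb k by (intro divide_left_mono) (auto intro!: mult_pos_pos Ypos)
        also have "\<dots> = 2 / (R * sin \<beta> * k) * exp (- X)" by (simp add: exp_minus field_simps)
        also have "\<dots> \<le> 2 / (R * sin \<beta> * k) * exp (- \<alpha> * X)"
          using R_pos sb k alpha X by (intro mult_left_mono) auto
        finally have Yinv: "1 / Y \<le> 2 / (R * sin \<beta> * k) * exp (- \<alpha> * X)" .
        have "2 * (\<eta> + e) * ((2 + f_bound e) * \<kappa> / Y) = 2 * (\<eta> + e) * ((2 + f_bound e) * \<kappa>) * (1 / Y)" by simp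
        also have "\<dots> \<le> 2 * (\<eta> + e) * ((2 + f_bound e) * \<kappa>) * (2 / (R * sin \<beta> * k) * exp (- \<alpha> * X))"
          using Yinv eta e f_bound_pos[OF e(1)] k0 by (intro mult_left_mono) auto
        also have "\<dots> = D2 * exp (- \<alpha> * X)" by (simp add: D2_def)
        finally show ?thesis unfolding line_int using line[rule_format, OF gh e Ypos gb] by linarith
      qed
      have "cmod (integral {-X..X} (\<lambda>x. G (Complex x (-d)))) \<le> cmod (P (Complex X (-d)) - P (Complex X (\<beta> - \<gamma>)))
         + cmod (P (Complex (-X) (-d)) - P (Complex (-X) (\<beta> - \<gamma>))) + cmod (P (Complex (-X) (\<beta> - \<gamma>)) - P (Complex X (\<beta> - \<gamma>)))"
        unfolding hor_int
        using norm_triangle_ineq4[of "P (Complex X (-d)) - P (Complex X (\<beta> - \<gamma>)) - (P (Complex (-X) (-d)) - P (Complex (-X) (\<beta> - \<gamma>)))" "P (Complex (-X) (\<beta> - \<gamma>)) - P (Complex X (\<beta> - \<gamma>))"]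
          norm_triangle_ineq4[of "P (Complex X (-d)) - P (Complex X (\<beta> - \<gamma>))" "P (Complex (-X) (-d)) - P (Complex (-X) (\<beta> - \<gamma>))"]
        by (simp add: algebra_simps)
      also have "\<dots> \<le> D1 * exp (- \<alpha> * X) * \<Delta> + D1 * exp (- \<alpha> * X) * \<Delta> + (C1 * \<kappa> + D2 * exp (- \<alpha> * X))"
        using vert[of X] vert[of "-X"] X main by (intro add_mono) auto
      also have "\<dots> = C * C0 / q1 + (2 * \<Delta> * D1 + D2) * exp (- \<alpha> * X)"
        by (simp add: C_def \<kappa>_def algebra_simps)
      finally show ?thesis by (simp add: X_def)
    qed
    then show ?thesis unfolding G_def q1_def mult_minus_left by blast
  qed
  show ?thesis by (rule exI[of _ C], intro conjI allI impI C0, rule main)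
qed

end

section \<open>Error bounds for the quadrature\<close>

lemma le_of_left_limit:
  fixes E A G D h :: real
  assumes h: "0 < h" and D: "0 < D" and ev: "\<forall>\<^sub>F d in at_left D. E \<le> A / (exp (2 * pi * d / h) - 1) + G"
  shows "E \<le> A / (exp (2 * pi * D / h) - 1) + G"
proof (rule tendsto_lowerbound[OF _ ev])
  have "exp (2 * pi * D / h) - 1 \<noteq> 0" using h D by simp
  then have "((\<lambda>d. A / (exp (2 * pi * d / h) - 1) + G) \<longlongrightarrow> A / (exp (2 * pi * D / h) - 1) + G) (at D)"
    using h by (intro tendsto_intros) auto
  then show "((\<lambda>d. A / (exp (2 * pi * d / h) - 1) + G) \<longlongrightarrow> A / (exp (2 * pi * D / h) - 1) + G) (at_left D)"
    by (rule filterlim_mono) (auto intro: at_le)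
qed simp

context hyperbola
begin

lemma discretization_inside:
  assumes d: "0 < d" "d < \<Delta>"
  shows "\<exists>C\<ge>0. \<forall>B C0 h N I t. resolvent_symbol B C0 \<longrightarrow> 0 \<le> t \<longrightarrow> 0 < h \<longrightarrow>
    ((\<lambda>x. scalar_integrand B t (of_real x)) has_integral I) UNIV \<longrightarrow>
    cmod (I - h * (\<Sum>k=-int N..int N. scalar_integrand B t (of_real (of_int k * h))))
      \<le> C * C0 / (exp (2 * pi * d / h) - 1) + tail_bound C0 t (real N * h)"
proof -
  define k where "k = cos (\<beta> + d)"
  have k: "0 < k" unfolding k_def using d beta_bounds by (intro cos_gt_zero_pi) auto
  define C where "C = 2 * K k / \<alpha> + 2 * K (cos \<beta>) / \<alpha>"
  have C: "0 \<le> C" using K_nonneg k cos_phi_pos alpha by (simp add: C_def)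
  have main: "cmod (I - h * (\<Sum>k=-int N..int N. scalar_integrand B t (of_real (of_int k * h))))
      \<le> C * C0 / (exp (2 * pi * d / h) - 1) + tail_bound C0 t (real N * h)"
    if B: "resolvent_symbol B C0" and t: "0 \<le> t" and h: "0 < h" and I: "((\<lambda>x. scalar_integrand B t (of_real x)) has_integral I) UNIV" for B C0 h N I t
  proof -
    have low: "cmod (integral {-(M + 1/2) * h..(M + 1/2) * h}
      (\<lambda>x. scalar_integrand B t (Complex x (-d)) / (sinc_exp h (Complex x (-d)) - 1)))
       \<le> 2 * (K k * C0) / \<alpha> / (exp (2 * pi * d / h) - 1) + 0 * exp (- \<alpha> * ((M + 1/2) * h))" for M :: nat
      using lower_line_simple[OF B t h d k] by (simp add: k_def)
    have "2 * (K k * C0) / \<alpha> / (exp (2 * pi * d / h) - 1) + 2 * (K (cos \<beta>) * C0) / \<alpha> / (exp (2 * pi * d / h) - 1)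
      = C * C0 / (exp (2 * pi * d / h) - 1)"
      by (simp add: C_def add_divide_distrib distrib_left distrib_right)
    then show ?thesis using discretization_generic[OF B t h d low I, of N] by simp
  qed
  show ?thesis by (rule exI[of _ C], intro conjI allI impI C, rule main)
qed

text \<open>The constant does not depend on \<open>d\<close>, so the width \<open>d\<close> can tend to that of the full strip.\<close>

lemma discretization_full:
  assumes t: "0 \<le> t"
  shows "\<exists>C\<ge>0. \<forall>B C0 h N I. resolvent_symbol B C0 \<longrightarrow> 0 < h \<longrightarrow>
    ((\<lambda>x. scalar_integrand B t (of_real x)) has_integral I) UNIV \<longrightarrow>
    cmod (I - h * (\<Sum>k=-int N..int N. scalar_integrand B t (of_real (of_int k * h))))
      \<le> C * C0 / (exp (2 * pi * \<Delta> / h) - 1) + tail_bound C0 t (real N * h)"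
proof -
  have "\<exists>C\<ge>0. \<exists>d0<\<Delta>. \<forall>B C0 h d. resolvent_symbol B C0 \<longrightarrow> 0 < h \<longrightarrow> 0 < d \<longrightarrow> d0 < d \<longrightarrow> d < \<Delta> \<longrightarrow>
      (\<exists>B2. \<forall>M::nat. cmod (integral {-(real M + 1/2) * h..(real M + 1/2) * h}
          (\<lambda>x. scalar_integrand B t (Complex x (-d)) / (sinc_exp h (Complex x (-d)) - 1)))
        \<le> C * C0 / (exp (2 * pi * d / h) - 1) + B2 * exp (- \<alpha> * ((real M + 1/2) * h)))"
  proof (cases "\<beta> + \<Delta> = pi / 2")
    case False
    define k where "k = cos (\<beta> + \<Delta>)"
    have k: "0 < k" unfolding k_def using False beta_bounds Delta_pos by (intro cos_gt_zero_pi) auto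
    have "cmod (integral {-(real M + 1/2) * h..(real M + 1/2) * h}
          (\<lambda>x. scalar_integrand B t (Complex x (-d)) / (sinc_exp h (Complex x (-d)) - 1)))
        \<le> 2 * K k / \<alpha> * C0 / (exp (2 * pi * d / h) - 1) + 0 * exp (- \<alpha> * ((real M + 1/2) * h))"
      if "resolvent_symbol B C0" "0 < h" "0 < d" "d < \<Delta>" for B C0 h d and M :: nat
    proof -
      have "k \<le> cos (\<beta> + d)" unfolding k_def using that beta_bounds by (intro cos_monotone_0_pi_le) auto
      from lower_line_simple[OF that(1) t that(2-4) k this, of M] show ?thesis by (simp add: mult_ac)
    qed
    moreover have "0 \<le> 2 * K k / \<alpha>" using K_nonneg[OF k] alpha by simp
    ultimately show ?thesis using Delta_pos by (intro exI[of _ "2 * K k / \<alpha>"] conjI exI[of _ 0]) blast+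
  next
    case True
    obtain C where C: "0 \<le> C" and low: "\<forall>B C0 h d. resolvent_symbol B C0 \<longrightarrow> 0 < h \<longrightarrow> 0 < d \<longrightarrow> d < \<Delta> \<longrightarrow> R * cos (\<beta> + d) < 1 \<longrightarrow>
      (\<exists>B2. \<forall>M::nat. cmod (integral {-(real M + 1/2) * h..(real M + 1/2) * h}
          (\<lambda>x. scalar_integrand B t (Complex x (-d)) / (sinc_exp h (Complex x (-d)) - 1)))
        \<le> C * C0 / (exp (2 * pi * d / h) - 1) + B2 * exp (- \<alpha> * ((real M + 1/2) * h)))"
      using lower_line_imaginary_axis[OF True t] by (elim exE conjE) (rule that)
    have "((\<lambda>d. R * cos (\<beta> + d)) \<longlongrightarrow> R * cos (\<beta> + \<Delta>)) (at_left \<Delta>)" by (intro tendsto_intros)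
    moreover have "R * cos (\<beta> + \<Delta>) < 1" unfolding True by simp
    ultimately have "\<forall>\<^sub>F d in at_left \<Delta>. R * cos (\<beta> + d) < 1" by (rule order_tendstoD)
    then obtain d0 where d0: "d0 < \<Delta>" "\<And>d. d0 < d \<Longrightarrow> d < \<Delta> \<Longrightarrow> R * cos (\<beta> + d) < 1"
      unfolding eventually_at_left_field by blast
    show ?thesis
      by (rule exI[of _ C], rule conjI[OF C], rule exI[of _ d0], intro conjI d0(1) allI impI, rule low[rule_format]) (use d0(2) in auto)
  qed
  then obtain C1 d0 where C1: "0 \<le> C1" and d0: "d0 < \<Delta>" and low: "\<forall>B C0 h d. resolvent_symbol B C0 \<longrightarrow> 0 < h \<longrightarrow> 0 < d \<longrightarrow> d0 < d \<longrightarrow> d < \<Delta> \<longrightarrow>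
      (\<exists>B2. \<forall>M::nat. cmod (integral {-(real M + 1/2) * h..(real M + 1/2) * h}
          (\<lambda>x. scalar_integrand B t (Complex x (-d)) / (sinc_exp h (Complex x (-d)) - 1)))
        \<le> C1 * C0 / (exp (2 * pi * d / h) - 1) + B2 * exp (- \<alpha> * ((real M + 1/2) * h)))"
    by (elim exE conjE) (rule that)
  define C where "C = C1 + 2 * K (cos \<beta>) / \<alpha>"
  have C: "0 \<le> C" using C1 K_nonneg cos_phi_pos alpha by (simp add: C_def)
  have main: "cmod (I - h * (\<Sum>k=-int N..int N. scalar_integrand B t (of_real (of_int k * h))))
      \<le> C * C0 / (exp (2 * pi * \<Delta> / h) - 1) + tail_bound C0 t (real N * h)"
    if B: "resolvent_symbol B C0" and h: "0 < h" and I: "((\<lambda>x. scalar_integrand B t (of_real x)) has_integral I) UNIV" for B C0 h N I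
  proof (rule le_of_left_limit[OF h Delta_pos])
    have "max 0 d0 < \<Delta>" using d0 Delta_pos by simp
    then have "\<forall>\<^sub>F d in at_left \<Delta>. max 0 d0 < d \<and> d < \<Delta>" unfolding eventually_at_left_field by blast
    then show "\<forall>\<^sub>F d in at_left \<Delta>. cmod (I - h * (\<Sum>k=-int N..int N. scalar_integrand B t (of_real (of_int k * h))))
      \<le> C * C0 / (exp (2 * pi * d / h) - 1) + tail_bound C0 t (real N * h)"
    proof eventually_elim
      case (elim d)
      then have d: "0 < d" "d0 < d" "d < \<Delta>" by auto
      obtain B2 where B2: "\<forall>M::nat. cmod (integral {-(real M + 1/2) * h..(real M + 1/2) * h}
          (\<lambda>x. scalar_integrand B t (Complex x (-d)) / (sinc_exp h (Complex x (-d)) - 1)))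
        \<le> C1 * C0 / (exp (2 * pi * d / h) - 1) + B2 * exp (- \<alpha> * ((real M + 1/2) * h))"
        using low[rule_format, OF B h d] by (elim exE) (rule that)
      have "C1 * C0 / (exp (2 * pi * d / h) - 1) + 2 * (K (cos \<beta>) * C0) / \<alpha> / (exp (2 * pi * d / h) - 1)
        = C * C0 / (exp (2 * pi * d / h) - 1)"
        by (simp add: C_def add_divide_distrib distrib_left distrib_right)
      then show ?case using discretization_generic[OF B t h d(1,3) B2[rule_format] I, of N] by simp
    qed
  qed
  show ?thesis by (rule exI[of _ C], intro conjI allI impI C, rule main)
qed

definition vector_integrand :: "'a::complex_banach set \<Rightarrow> ('a \<Rightarrow> 'a) \<Rightarrow> 'a \<Rightarrow> real \<Rightarrow> real \<Rightarrow> 'a" where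
  "vector_integrand D A u t x = (1 / (2 * of_real pi * \<i>) * exp (- Z (of_real x) * of_real t) * f (Z (of_real x)) * Z' (of_real x)) *\<^sub>C
     (resolvent D A (Z (of_real x)) u - (1 / Z (of_real x)) *\<^sub>C u)"

text \<open>A functional \<open>\<psi>\<close> that attains the norm of the error commutes with the integral and the sum and reduces the
claim to a scalar integrand of the kind treated above.\<close>

lemma operator_error:
  fixes D :: "'a::complex_banach set"
  assumes SP: "strongly_positive D A (R * cos \<phi>) \<phi>"
  shows "\<exists>C\<ge>0. \<forall>v h N t e. 0 \<le> t \<longrightarrow> 0 < h \<longrightarrow>
    (\<forall>B C0 I. resolvent_symbol B C0 \<longrightarrow> ((\<lambda>x. scalar_integrand B t (of_real x)) has_integral I) UNIV \<longrightarrow>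
       cmod (I - h * (\<Sum>k=-int N..int N. scalar_integrand B t (of_real (of_int k * h)))) \<le> C0 * e) \<longrightarrow>
    norm (integral UNIV (vector_integrand D A (neg_frac_power D A \<alpha> v) t)
       - h *\<^sub>R (\<Sum>k=-int N..int N. vector_integrand D A (neg_frac_power D A \<alpha> v) t (of_int k * h))) \<le> C * norm v * e"
proof -
  have lin: "linear_operator D A" using SP by (simp add: strongly_positive_def)
  obtain M where M: "0 \<le> M"
    and rs: "\<And>z. z \<in> U \<Longrightarrow> z \<in> resolvent_set D A"
    and bd: "\<And>z x. z \<in> U \<Longrightarrow> norm (resolvent D A z x) \<le> M / (1 + cmod z) * norm x"
    using strongly_positiveD[OF SP] unfolding U_def by blast
  obtain C1 where C1: "0 \<le> C1"
    and n1: "\<And>v. norm (neg_frac_power D A \<alpha> v) \<le> C1 * norm v"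
    and n2: "\<And>v z. z \<in> U \<Longrightarrow> - Re z \<le> \<bar>Im z\<bar> \<Longrightarrow> z \<noteq> 0 \<Longrightarrow>
      norm (z *\<^sub>C resolvent D A z (neg_frac_power D A \<alpha> v) - neg_frac_power D A \<alpha> v)
        \<le> C1 * cmod z powr (-\<alpha>) * norm v"
    using neg_frac_power_bounds[OF SP alpha] unfolding U_def by blast
  have bd': "norm (resolvent D A z x) \<le> M * norm x" if "z \<in> U" for z x
  proof -
    have "M / (1 + cmod z) \<le> M / 1" using M by (intro divide_left_mono) (auto intro!: add_pos_nonneg)
    then show ?thesis using bd[OF that, of x] mult_right_mono[of "M / (1 + cmod z)" M "norm x"] by simp
  qed
  define C where "C = (M + 1) * C1"
  have C: "0 \<le> C" "C1 \<le> C" using M C1 by (auto simp: C_def distrib_right)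
  have main: "norm (integral UNIV (vector_integrand D A (neg_frac_power D A \<alpha> v) t)
       - h *\<^sub>R (\<Sum>k=-int N..int N. vector_integrand D A (neg_frac_power D A \<alpha> v) t (of_int k * h))) \<le> C * norm v * e"
    if t: "0 \<le> t" and h: "0 < h" and err: "\<forall>B C0 I. resolvent_symbol B C0 \<longrightarrow> ((\<lambda>x. scalar_integrand B t (of_real x)) has_integral I) UNIV \<longrightarrow>
       cmod (I - h * (\<Sum>k=-int N..int N. scalar_integrand B t (of_real (of_int k * h)))) \<le> C0 * e" for v h N t e
  proof -
    define u where "u = neg_frac_power D A \<alpha> v"
    define F where "F = vector_integrand D A u t"
    have zr: "Z (of_real x) \<in> U" "0 < Re (Z (of_real x))" for x
    proof -
      have "of_real x = Complex x 0" by (simp add: complex_eq_iff)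
      then show "Z (of_real x) \<in> U" "0 < Re (Z (of_real x))"
        using Z_in_U[of 0 x] Re_Z_pos[of 0 x] Delta_pos by simp_all
    qed
    have z0: "Z (of_real x) \<noteq> 0" for x using zr(2)[of x] by auto
    have adm: "resolvent_symbol (\<lambda>z. z * \<psi> (resolvent D A z u) - \<psi> u) (C * norm v)"
      and integrand_eq: "\<psi> (F x) = scalar_integrand (\<lambda>z. z * \<psi> (resolvent D A z u) - \<psi> u) t (of_real x)"
      if \<psi>: "bounded_linear \<psi>" "\<And>c x. \<psi> (c *\<^sub>C x) = c * \<psi> x" "\<And>x. cmod (\<psi> x) \<le> norm x" for \<psi> :: "'a \<Rightarrow> complex" and x
    proof -
      have eq: "z * \<psi> (resolvent D A z u) - \<psi> u = \<psi> (z *\<^sub>C resolvent D A z u - u)" for z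
        by (simp add: linear_diff[OF bounded_linear.linear[OF \<psi>(1)]] \<psi>(2))
      show "resolvent_symbol (\<lambda>z. z * \<psi> (resolvent D A z u) - \<psi> u) (C * norm v)"
        unfolding resolvent_symbol_def
      proof (intro conjI ballI impI)
        show "(\<lambda>z. z * \<psi> (resolvent D A z u) - \<psi> u) holomorphic_on U"
          by (intro holomorphic_intros resolvent_holomorphic_on[OF lin M rs bd' \<psi>(1,2)])
        fix z assume z: "z \<in> U"
        have "norm (z *\<^sub>C resolvent D A z u - u) \<le> cmod z * (M / (1 + cmod z) * norm u) + norm u"
          using mult_left_mono[OF bd[OF z, of u] norm_ge_zero[of z]] norm_triangle_ineq4[of "z *\<^sub>C resolvent D A z u" u]
          unfolding norm_scaleC by linarith
        also have "cmod z * (M / (1 + cmod z) * norm u) = cmod z / (1 + cmod z) * (M * norm u)" by simp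
        also have "\<dots> \<le> 1 * (M * norm u)"
        proof (rule mult_right_mono)
          show "cmod z / (1 + cmod z) \<le> 1" using norm_ge_zero[of z] by (subst divide_le_eq_1_pos) linarith+
        qed (use M in auto)
        finally have "norm (z *\<^sub>C resolvent D A z u - u) \<le> (M + 1) * norm u" by (simp add: distrib_right)
        also have "\<dots> \<le> (M + 1) * (C1 * norm v)" using n1[of v] M by (intro mult_left_mono) (auto simp: u_def)
        finally show "cmod (z * \<psi> (resolvent D A z u) - \<psi> u) \<le> C * norm v"
          unfolding eq using order_trans[OF \<psi>(3)] by (simp add: C_def mult.assoc)
      next
        fix z assume z: "z \<in> U" "- Re z \<le> \<bar>Im z\<bar>" "z \<noteq> 0"
        have "norm (z *\<^sub>C resolvent D A z u - u) \<le> C1 * cmod z powr (-\<alpha>) * norm v"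
          unfolding u_def by (rule n2[OF z])
        also have "\<dots> \<le> C * cmod z powr (-\<alpha>) * norm v" using C by (intro mult_right_mono) auto
        finally show "cmod (z * \<psi> (resolvent D A z u) - \<psi> u) \<le> C * norm v * cmod z powr (-\<alpha>)"
          unfolding eq using order_trans[OF \<psi>(3)] by (simp add: mult_ac)
      qed (use C in auto)
      show "\<psi> (F x) = scalar_integrand (\<lambda>z. z * \<psi> (resolvent D A z u) - \<psi> u) t (of_real x)"
        using z0[of x] by (simp add: F_def vector_integrand_def scalar_integrand_def \<psi>(2) linear_diff[OF bounded_linear.linear[OF \<psi>(1)]] diff_divide_distrib)
    qed
    have Fb: "norm (F x) \<le> (K (cos \<beta>) * (C * norm v)) * exp (- \<alpha> * \<bar>x\<bar>)" for x
    proof -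
      obtain \<psi> where \<psi>: "bounded_linear \<psi>" "\<And>c y. \<psi> (c *\<^sub>C y) = c * \<psi> y" "\<And>y. cmod (\<psi> y) \<le> norm y"
        "\<psi> (F x) = of_real (norm (F x))" using norming_functional[of "F x"] by blast
      have "norm (F x) = cmod (\<psi> (F x))" by (simp add: \<psi>(4))
      also have "\<dots> = cmod (scalar_integrand (\<lambda>z. z * \<psi> (resolvent D A z u) - \<psi> u) t (Complex x 0))"
        by (simp add: integrand_eq[OF \<psi>(1-3)] complex_of_real_def)
      also have "\<dots> \<le> K (cos \<beta>) * (C * norm v) * exp (- \<alpha> * \<bar>x\<bar>)"
        using Delta_pos cos_phi_pos t by (intro norm_integrand_strip_le' adm[OF \<psi>(1-3)]) auto
      finally show ?thesis .
    qed
    have Zc: "continuous_on A' (\<lambda>x. Z (of_real x))" "continuous_on A' (\<lambda>x. Z' (of_real x))" for A' :: "real set"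
      unfolding Z_def Z'_def by (intro continuous_intros)+
    have fc: "continuous_on UNIV (\<lambda>x. f (Z (of_real x)))"
      by (rule continuous_on_compose2[OF holomorphic_on_imp_continuous_on[OF f_holomorphic] Zc(1)]) (use zr in auto)
    have rc: "continuous_on UNIV (\<lambda>x. resolvent D A (Z (of_real x)) u)"
      by (rule continuous_on_compose2[OF resolvent_continuous_on[OF lin M rs bd'] Zc(1)]) (use zr in auto)
    have Fc: "continuous_on UNIV F"
      unfolding F_def vector_integrand_def using z0
      by (intro bounded_bilinear.continuous_on[OF bounded_bilinear_scaleC] continuous_intros fc rc Zc) auto
    have Fi: "F integrable_on UNIV" by (rule exp_decay_integrable[OF alpha(1) Fc Fb])
    define E where "E = integral UNIV F - h *\<^sub>R (\<Sum>k=-int N..int N. F (of_int k * h))"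
    obtain \<psi> where \<psi>: "bounded_linear \<psi>" "\<And>c y. \<psi> (c *\<^sub>C y) = c * \<psi> y" "\<And>y. cmod (\<psi> y) \<le> norm y"
      "\<psi> E = of_real (norm E)" using norming_functional[of E] by blast
    note \<psi>l = bounded_linear.linear[OF \<psi>(1)]
    have "((\<lambda>x. \<psi> (F x)) has_integral \<psi> (integral UNIV F)) UNIV"
      using has_integral_linear[OF integrable_integral[OF Fi] \<psi>(1)] by (simp add: o_def)
    then have I: "((\<lambda>x. scalar_integrand (\<lambda>z. z * \<psi> (resolvent D A z u) - \<psi> u) t (of_real x)) has_integral \<psi> (integral UNIV F)) UNIV"
      by (simp only: integrand_eq[OF \<psi>(1-3)])
    have "\<psi> E = \<psi> (integral UNIV F) - h * (\<Sum>k=-int N..int N. scalar_integrand (\<lambda>z. z * \<psi> (resolvent D A z u) - \<psi> u) t (of_real (of_int k * h)))"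
      unfolding E_def linear_diff[OF \<psi>l] linear_scale[OF \<psi>l] linear_sum[OF \<psi>l] integrand_eq[OF \<psi>(1-3)]
      by (simp add: scaleR_conv_of_real)
    then have "cmod (\<psi> E) \<le> C * norm v * e" using err[rule_format, OF adm[OF \<psi>(1-3)] I] by simp
    then show ?thesis using \<psi>(4) by (simp add: E_def F_def u_def)
  qed
  show ?thesis by (rule exI[of _ C], intro conjI allI impI C(1), rule main)
qed

end

section \<open>The two step sizes\<close>

lemma inverse_exp_minus_1_le:
  fixes x x0 :: real
  assumes "0 < x0" "x0 \<le> x"
  shows "1 / (exp x - 1) \<le> exp (- x) / (1 - exp (- x0))"
proof -
  have "exp (- x) \<le> exp (- x0)" "exp (- x0) < 1" using assms by auto
  moreover have "exp x - 1 = (1 - exp (- x)) / exp (- x)" by (simp add: exp_minus field_simps)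
  ultimately show ?thesis by (auto intro!: divide_left_mono mult_pos_pos)
qed

lemma le_two_powr: "2 \<le> c \<Longrightarrow> c \<le> 2 powr (c - 1)" for c :: real
proof -
  assume c: "2 \<le> c"
  have "c = 2 * (1 + (c - 2) / 2)" by (simp add: field_simps)
  also have "\<dots> \<le> 2 * (1 + (c - 2) * ln 2)"
    using c ln2_ge_two_thirds mult_left_mono[of "1/2" "ln 2" "c - 2"] by (intro mult_left_mono add_left_mono) auto
  also have "\<dots> \<le> 2 * exp ((c - 2) * ln 2)" by (intro mult_left_mono exp_ge_add_one_self) auto
  also have "exp ((c - 2) * ln 2) = 2 powr (c - 2)" by (simp add: powr_def)
  also have "2 * 2 powr (c - 2) = 2 powr (c - 1)" using powr_add[of 2 1 "c - 2"] by simp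
  finally show ?thesis .
qed

text \<open>This is where the lower bound on the constant \<open>c\<^sub>1\<close> of the second step size is needed:
\<open>N powr c \<ge> c N\<close> for all \<open>N \<ge> 2\<close> reduces to \<open>2 powr (c - 1) \<ge> c\<close>.\<close>

lemma cosh_ln_ge:
  fixes c :: real and N :: nat
  assumes "2 \<le> c" "2 \<le> N"
  shows "c * real N / 2 \<le> cosh (c * ln (real N))"
proof -
  have "c \<le> 2 powr (c - 1)" using le_two_powr assms by blast
  also have "\<dots> \<le> real N powr (c - 1)" using assms by (intro powr_mono2) auto
  finally have "c * real N \<le> real N powr (c - 1) * real N" using assms by (intro mult_right_mono) auto
  also have "\<dots> = real N powr c" using powr_add[of "real N" "c - 1" 1] assms by simp
  also have "\<dots> = exp (c * ln (real N))" using assms by (simp add: powr_def)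
  also have "\<dots> \<le> 2 * cosh (c * ln (real N))" by (simp add: cosh_def)
  finally show ?thesis by simp
qed

theorem theorem1:
  fixes D :: "'a::complex_banach set" and A :: "'a \<Rightarrow> 'a"
    and \<rho>\<^sub>0 \<phi> \<rho>\<^sub>1 T \<alpha> :: real and w :: "real \<Rightarrow> real" and n :: nat
  assumes "0 < T"
    and "strongly_positive D A \<rho>\<^sub>0 \<phi>"
    and "0 \<le> \<rho>\<^sub>1" "\<rho>\<^sub>1 < \<rho>\<^sub>0"
    and "0 < \<alpha>" "\<alpha> < 1"
    and "continuous_on {0..T} w"
    and "\<forall>s\<in>{0..T}. 0 \<le> w s"
    and "C_norm T w \<le> 1 / T"
  shows
    "(\<forall>\<delta>. 0 < \<delta> \<and> \<delta> < d1 \<rho>\<^sub>0 \<phi> \<rho>\<^sub>1 \<longrightarrow>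
        (\<exists>c. \<forall>u0 \<in> frac_power_dom D A \<alpha>. \<forall>N::nat. \<forall>t\<ge>0.
           let d = d1 \<rho>\<^sub>0 \<phi> \<rho>\<^sub>1 - \<delta>;
               h = sqrt (pi * d1 \<rho>\<^sub>0 \<phi> \<rho>\<^sub>1 / (\<alpha> * (real N + 1)))
           in norm (u_n D A \<rho>\<^sub>0 \<phi> \<rho>\<^sub>1 T w n u0 t - u_nN D A \<rho>\<^sub>0 \<phi> \<rho>\<^sub>1 T w n u0 h N t)
              \<le> c / \<alpha> * exp (- sqrt (pi * d * \<alpha> * (real N + 1))) * norm (frac_power D A \<alpha> u0)))
     \<and>
     (\<exists>c\<^sub>0>0. \<forall>c\<^sub>1\<ge>c\<^sub>0. \<forall>t>0.
        (\<exists>c. \<forall>u0 \<in> frac_power_dom D A \<alpha>. \<forall>N::nat. 2 \<le> N \<longrightarrow>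
           (let h = c\<^sub>1 * ln (real N) / real N
            in norm (u_n D A \<rho>\<^sub>0 \<phi> \<rho>\<^sub>1 T w n u0 t - u_nN D A \<rho>\<^sub>0 \<phi> \<rho>\<^sub>1 T w n u0 h N t)
               \<le> c * (exp (- (pi * d1 \<rho>\<^sub>0 \<phi> \<rho>\<^sub>1 * real N / (c\<^sub>1 * ln (real N))))
                      + exp (- (c\<^sub>1 * t * aI \<rho>\<^sub>0 \<phi> \<rho>\<^sub>1 * real N / 2) - c\<^sub>1 * \<alpha> * ln (real N)))
                 * norm (frac_power D A \<alpha> u0))))"
proof -
  have T: "0 < T" by fact
  have SP: "strongly_positive D A \<rho>\<^sub>0 \<phi>" by fact
  have ph: "0 < \<rho>\<^sub>0" "0 < \<phi>" "\<phi> < pi / 2" using SP by (auto simp: strongly_positive_def)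
  have cp: "0 < cos \<phi>" using ph by (intro cos_gt_zero_pi) auto
  define R where "R = \<rho>\<^sub>0 / cos \<phi>"
  have R: "0 < R" "R * cos \<phi> = \<rho>\<^sub>0" using ph cp by (auto simp: R_def)
  have Rsqrt: "sqrt (\<rho>\<^sub>0\<^sup>2 + (b0 \<rho>\<^sub>0 \<phi>)\<^sup>2) = R"
  proof (rule real_sqrt_unique)
    have "R\<^sup>2 = \<rho>\<^sub>0\<^sup>2 * (((cos \<phi>)\<^sup>2 + (sin \<phi>)\<^sup>2) / (cos \<phi>)\<^sup>2)" by (simp add: R_def power_divide)
    also have "\<dots> = \<rho>\<^sub>0\<^sup>2 + (b0 \<rho>\<^sub>0 \<phi>)\<^sup>2"
      using cp by (simp add: b0_def tan_def power_mult_distrib power_divide add_divide_distrib distrib_left del: sin_cos_squared_add sin_cos_squared_add2)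
    finally show "R\<^sup>2 = \<rho>\<^sub>0\<^sup>2 + (b0 \<rho>\<^sub>0 \<phi>)\<^sup>2" .
  qed (use R in simp)
  define d where "d = d1 \<rho>\<^sub>0 \<phi> \<rho>\<^sub>1"
  define \<beta> where "\<beta> = d / 2 + \<phi>"
  have d_eq: "d = arccos (\<rho>\<^sub>1 / R) - \<phi>" by (simp add: d_def d1_def Rsqrt)
  have rr: "0 \<le> \<rho>\<^sub>1 / R" "\<rho>\<^sub>1 / R < cos \<phi>" using assms R by (auto simp: field_simps)
  have dpos: "0 < d"
  proof -
    have "arccos (cos \<phi>) < arccos (\<rho>\<^sub>1 / R)" by (rule arccos_less_arccos) (use rr in \<open>auto intro: order_trans[of _ 0]\<close>)
    then show ?thesis using ph by (simp add: d_eq arccos_cos)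
  qed
  have dle: "\<phi> + d \<le> pi / 2"
  proof -
    have "\<rho>\<^sub>1 / R \<le> 1" using rr(2) cos_le_one[of \<phi>] by linarith
    then have "arccos (\<rho>\<^sub>1 / R) \<le> arccos 0" by (intro arccos_le_arccos) (use rr(1) in auto)
    then show ?thesis by (simp add: d_eq)
  qed
  define p where "p j = T / 2 * gauss_weight n j * w (scaled_node T n j)" for j
  define \<xi> where "\<xi> j = scaled_node T n j" for j
  have xi: "0 < \<xi> j" "\<xi> j < T" if "j \<le> n" for j
  proof -
    have "-1 < gauss_node n j" "gauss_node n j < 1" using gauss_node_bounds[OF that] by auto
    then have "0 < T / 2 * (gauss_node n j + 1)" "T / 2 * (gauss_node n j + 1) < T / 2 * 2"
      using T by (auto intro!: mult_pos_pos mult_strict_left_mono)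
    then show "0 < \<xi> j" "\<xi> j < T" by (simp_all add: \<xi>_def scaled_node_def)
  qed
  have w_le: "w s \<le> 1 / T" if "s \<in> {0..T}" for s
  proof -
    have "compact ((\<lambda>s. \<bar>w s\<bar>) ` {0..T})"
      using assms(7) by (intro compact_continuous_image continuous_intros) auto
    then have "bdd_above ((\<lambda>s. \<bar>w s\<bar>) ` {0..T})" by (intro bounded_imp_bdd_above compact_imp_bounded)
    then have "\<bar>w s\<bar> \<le> C_norm T w" unfolding C_norm_def using that by (intro cSUP_upper)
    then show ?thesis using assms(9) by linarith
  qed
  interpret hyperbola p \<xi> n T R \<phi> \<beta> \<alpha>
  proof unfold_locales
    fix j assume j: "j \<le> n"
    then have "\<xi> j \<in> {0..T}" using xi[OF j] by auto
    then show "0 \<le> p j" using assms(8) gauss_weight_nonneg[OF j] T by (simp add: p_def \<xi>_def)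
  next
    have "(\<Sum>j\<le>n. p j) \<le> (\<Sum>j\<le>n. T / 2 * gauss_weight n j * (1 / T))"
    proof (rule sum_mono)
      fix j assume "j \<in> {..n}"
      then have j: "j \<le> n" by simp
      then have "w (\<xi> j) \<le> 1 / T" using xi[OF j] by (intro w_le) auto
      then show "p j \<le> T / 2 * gauss_weight n j * (1 / T)"
        unfolding p_def using gauss_weight_nonneg[OF j] T by (intro mult_left_mono) (auto simp: \<xi>_def)
    qed
    also have "\<dots> = (\<Sum>j\<le>n. gauss_weight n j) / 2" using T by (simp add: sum_divide_distrib)
    finally show "(\<Sum>j\<le>n. p j) \<le> 1" by (simp add: sum_gauss_weight)
  qed (use R ph dpos dle xi assms in \<open>auto simp: \<beta>_def less_imp_le\<close>)
  have Delta: "\<Delta> = d / 2" unfolding \<Delta>_def by (simp add: \<beta>_def)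
  have aI: "aI \<rho>\<^sub>0 \<phi> \<rho>\<^sub>1 = R * cos \<beta>" and bI: "bI \<rho>\<^sub>0 \<phi> \<rho>\<^sub>1 = R * sin \<beta>"
    by (simp_all add: aI_def bI_def Rsqrt \<beta>_def d_def)
  have zp: "zpath \<rho>\<^sub>0 \<phi> \<rho>\<^sub>1 x = Z (of_real x)" for x
    using Z_Complex[of x 0] by (simp add: zpath_def aI bI complex_eq_iff complex_of_real_def[of x])
  have zp': "zpath' \<rho>\<^sub>0 \<phi> \<rho>\<^sub>1 x = Z' (of_real x)" for x
  proof -
    have e: "of_real \<beta> + \<i> * of_real x = Complex \<beta> x" by (simp add: complex_eq_iff)
    show ?thesis unfolding Z'_def e Re_Im_sin_Complex zpath'_def aI bI by (simp add: complex_eq_iff)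
  qed
  have In: "I_n \<rho>\<^sub>0 \<phi> \<rho>\<^sub>1 T w n x = S (Z (of_real x))" for x
    by (simp add: I_n_def S_def zp p_def \<xi>_def atLeast0AtMost)
  have Fn: "F_n D A \<rho>\<^sub>0 \<phi> \<rho>\<^sub>1 T w n u0 t = vector_integrand D A u0 t" for u0 t
    by (simp add: fun_eq_iff F_n_def vector_integrand_def Let_def zp zp' In f_def)
  obtain C1 where C1: "0 \<le> C1" and op: "\<forall>v h N t e. 0 \<le> t \<longrightarrow> 0 < h \<longrightarrow>
    (\<forall>B C0 I. resolvent_symbol B C0 \<longrightarrow> ((\<lambda>x. scalar_integrand B t (of_real x)) has_integral I) UNIV \<longrightarrow>
       cmod (I - h * (\<Sum>k=-int N..int N. scalar_integrand B t (of_real (of_int k * h)))) \<le> C0 * e) \<longrightarrow>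
    norm (integral UNIV (vector_integrand D A (neg_frac_power D A \<alpha> v) t)
       - h *\<^sub>R (\<Sum>k=-int N..int N. vector_integrand D A (neg_frac_power D A \<alpha> v) t (of_int k * h))) \<le> C1 * norm v * e"
    using operator_error[of D A, unfolded R(2), OF SP] by (elim exE conjE) (rule that)
  have tb: "tail_bound C0 t x = C0 * tail_bound 1 t x" for C0 t x by (simp add: tail_bound_def)
  have err: "norm (u_n D A \<rho>\<^sub>0 \<phi> \<rho>\<^sub>1 T w n u0 t - u_nN D A \<rho>\<^sub>0 \<phi> \<rho>\<^sub>1 T w n u0 h N t)
      \<le> C1 * norm (frac_power D A \<alpha> u0) * (C2 / (exp (2 * pi * e / h) - 1) + tail_bound 1 t (real N * h))"
    if u0: "u0 \<in> frac_power_dom D A \<alpha>" and t: "0 \<le> t" and h: "0 < h"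
      and disc: "\<And>B C0 I. resolvent_symbol B C0 \<Longrightarrow> ((\<lambda>x. scalar_integrand B t (of_real x)) has_integral I) UNIV \<Longrightarrow>
        cmod (I - h * (\<Sum>k=-int N..int N. scalar_integrand B t (of_real (of_int k * h))))
          \<le> C2 * C0 / (exp (2 * pi * e / h) - 1) + tail_bound C0 t (real N * h)"
    for u0 t h N C2 e
  proof -
    \<comment> \<open>\<open>frac_power\<close> chooses a preimage, so this holds on the whole range.\<close>
    have u: "neg_frac_power D A \<alpha> (frac_power D A \<alpha> u0) = u0"
      using u0 unfolding frac_power_def frac_power_dom_def by (rule f_inv_into_f)
    have "norm (integral UNIV (vector_integrand D A (neg_frac_power D A \<alpha> (frac_power D A \<alpha> u0)) t)
       - h *\<^sub>R (\<Sum>k=-int N..int N. vector_integrand D A (neg_frac_power D A \<alpha> (frac_power D A \<alpha> u0)) t (of_int k * h)))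
      \<le> C1 * norm (frac_power D A \<alpha> u0) * (C2 / (exp (2 * pi * e / h) - 1) + tail_bound 1 t (real N * h))"
    proof (rule op[rule_format, OF t h])
      fix B C0 I assume "resolvent_symbol B C0" "((\<lambda>x. scalar_integrand B t (of_real x)) has_integral I) UNIV"
      from disc[OF this]
      show "cmod (I - h * (\<Sum>k=-int N..int N. scalar_integrand B t (of_real (of_int k * h))))
          \<le> C0 * (C2 / (exp (2 * pi * e / h) - 1) + tail_bound 1 t (real N * h))"
        unfolding tb[of C0] by (simp add: distrib_left mult.commute)
    qed
    then show ?thesis by (simp add: u u_n_def u_nN_def Fn)
  qed
  define L where "L = 2 * K (cos \<beta>) / \<alpha>"
  have L: "0 \<le> L" using K_nonneg cos_phi_pos alpha by (simp add: L_def)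
  have part1: "\<exists>c. \<forall>u0 \<in> frac_power_dom D A \<alpha>. \<forall>N::nat. \<forall>t\<ge>0.
           let d = d1 \<rho>\<^sub>0 \<phi> \<rho>\<^sub>1 - \<delta>;
               h = sqrt (pi * d1 \<rho>\<^sub>0 \<phi> \<rho>\<^sub>1 / (\<alpha> * (real N + 1)))
           in norm (u_n D A \<rho>\<^sub>0 \<phi> \<rho>\<^sub>1 T w n u0 t - u_nN D A \<rho>\<^sub>0 \<phi> \<rho>\<^sub>1 T w n u0 h N t)
              \<le> c / \<alpha> * exp (- sqrt (pi * d * \<alpha> * (real N + 1))) * norm (frac_power D A \<alpha> u0)"
    if \<delta>: "0 < \<delta>" "\<delta> < d" for \<delta>
  proof -
    \<comment> \<open>The step size is tuned to \<open>d\<close>, so half-width \<open>e\<close> yields the rate \<open>2 \<pi> e / h\<close>; the geometric mean of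
      \<open>d\<close> and \<open>d - \<delta>\<close> makes it exactly \<open>sqrt (\<pi> (d - \<delta>) \<alpha> (N + 1))\<close>, and it lies below \<open>d\<close>.\<close>
    define e where "e = sqrt (d * (d - \<delta>)) / 2"
    have e: "0 < e" "e < \<Delta>"
    proof -
      show "0 < e" using \<delta> by (simp add: e_def)
      have "d * (d - \<delta>) < d * d" using \<delta> dpos by (intro mult_strict_left_mono) auto
      then have "sqrt (d * (d - \<delta>)) < sqrt (d * d)" by (rule real_sqrt_less_mono)
      then show "e < \<Delta>" using dpos by (simp add: e_def Delta)
    qed
    obtain C2 where C2: "0 \<le> C2" and disc: "\<forall>B C0 h N I t. resolvent_symbol B C0 \<longrightarrow> 0 \<le> t \<longrightarrow> 0 < h \<longrightarrow>
      ((\<lambda>x. scalar_integrand B t (of_real x)) has_integral I) UNIV \<longrightarrow>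
      cmod (I - h * (\<Sum>k=-int N..int N. scalar_integrand B t (of_real (of_int k * h))))
        \<le> C2 * C0 / (exp (2 * pi * e / h) - 1) + tail_bound C0 t (real N * h)"
      using discretization_inside[OF e] by (elim exE conjE) (rule that)
    define H where "H = sqrt (pi * d / \<alpha>)"
    have H: "0 < H" using dpos alpha by (simp add: H_def)
    define x0 where "x0 = 2 * pi * e / H"
    have x0: "0 < x0" using e H by (simp add: x0_def)
    define c where "c = \<alpha> * (C1 * (C2 / (1 - exp (- x0)) + L * exp (\<alpha> * H)))"
    have main: "norm (u_n D A \<rho>\<^sub>0 \<phi> \<rho>\<^sub>1 T w n u0 t - u_nN D A \<rho>\<^sub>0 \<phi> \<rho>\<^sub>1 T w n u0 h N t)
              \<le> c / \<alpha> * exp (- sqrt (pi * (d - \<delta>) * \<alpha> * (real N + 1))) * norm (frac_power D A \<alpha> u0)"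
      if u0: "u0 \<in> frac_power_dom D A \<alpha>" and t: "0 \<le> t" and h_def: "h = sqrt (pi * d / (\<alpha> * (real N + 1)))" for u0 N t h
    proof -
      have h: "0 < h" using dpos alpha by (simp add: h_def)
      have hH: "h \<le> H" unfolding h_def H_def using dpos alpha
        by (intro real_sqrt_le_mono divide_left_mono) (auto simp: mult_le_cancel_left1)
      define s where "s = sqrt (pi * (d - \<delta>) * \<alpha> * (real N + 1))"
      have ex: "2 * pi * e / h = s"
      proof -
        have "(2 * pi * e / h)\<^sup>2 = pi * (d - \<delta>) * \<alpha> * (real N + 1)"
          using dpos alpha \<delta> by (simp add: e_def h_def power_divide power_mult_distrib power2_eq_square field_simps)
        then show ?thesis unfolding s_def using e h by (intro real_sqrt_unique[symmetric]) auto
      qed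
      have Nh: "s \<le> \<alpha> * (real N * h) + \<alpha> * H"
      proof -
        have "\<alpha> * ((real N + 1) * h) = sqrt (pi * d * \<alpha> * (real N + 1))"
        proof (rule real_sqrt_unique[symmetric])
          show "(\<alpha> * ((real N + 1) * h))\<^sup>2 = pi * d * \<alpha> * (real N + 1)"
          proof -
            define m where "m = real N + 1"
            have m: "0 < m" by (simp add: m_def)
            have hs: "h\<^sup>2 = pi * d / (\<alpha> * m)" using dpos alpha m by (simp add: h_def m_def)
            have "(\<alpha> * (m * h))\<^sup>2 = \<alpha>\<^sup>2 * (m\<^sup>2 * h\<^sup>2)" by (simp only: power_mult_distrib)
            also have "\<dots> = pi * d * \<alpha> * m" unfolding hs using alpha m by (simp add: power2_eq_square)
            finally show ?thesis by (simp add: m_def)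
          qed
        qed (use h alpha in auto)
        moreover have "s \<le> sqrt (pi * d * \<alpha> * (real N + 1))"
          unfolding s_def using \<delta> dpos alpha by (intro real_sqrt_le_mono mult_right_mono mult_left_mono) auto
        moreover have "\<alpha> * h \<le> \<alpha> * H" using hH alpha by simp
        ultimately show ?thesis by (simp add: algebra_simps)
      qed
      have t1: "C2 / (exp (2 * pi * e / h) - 1) \<le> C2 / (1 - exp (- x0)) * exp (- s)"
      proof -
        have "x0 \<le> 2 * pi * e / h" unfolding x0_def using h hH e by (intro divide_left_mono) auto
        from mult_left_mono[OF inverse_exp_minus_1_le[OF x0 this] C2] show ?thesis by (simp add: ex)
      qed
      have t2: "tail_bound 1 t (real N * h) \<le> L * exp (\<alpha> * H) * exp (- s)"
      proof -
        have "tail_bound 1 t (real N * h) = L * (exp (- (R * cos \<beta> * cosh (real N * h) * t)) * exp (- \<alpha> * (real N * h)))"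
          by (simp add: tail_bound_def L_def)
        also have "\<dots> \<le> L * (1 * exp (\<alpha> * H - s))"
          using Nh R_pos cos_phi_pos t L by (intro mult_left_mono mult_mono) auto
        finally show ?thesis by (simp add: exp_diff exp_minus divide_inverse mult.assoc)
      qed
      have "norm (u_n D A \<rho>\<^sub>0 \<phi> \<rho>\<^sub>1 T w n u0 t - u_nN D A \<rho>\<^sub>0 \<phi> \<rho>\<^sub>1 T w n u0 h N t)
        \<le> C1 * norm (frac_power D A \<alpha> u0) * (C2 / (exp (2 * pi * e / h) - 1) + tail_bound 1 t (real N * h))"
        by (rule err[OF u0 t h]) (rule disc[rule_format, OF _ t h])
      also have "\<dots> \<le> C1 * norm (frac_power D A \<alpha> u0) * (C2 / (1 - exp (- x0)) * exp (- s) + L * exp (\<alpha> * H) * exp (- s))"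
        using C1 t1 t2 by (intro mult_left_mono add_mono) auto
      also have "\<dots> = c / \<alpha> * exp (- s) * norm (frac_power D A \<alpha> u0)"
      proof -
        have ca: "c / \<alpha> = C1 * (C2 / (1 - exp (- x0)) + L * exp (\<alpha> * H))" using alpha by (simp add: c_def)
        show ?thesis unfolding ca by (simp add: distrib_left distrib_right mult_ac)
      qed
      finally show ?thesis by (simp add: s_def)
    qed
    show ?thesis unfolding Let_def d_def[symmetric]
      by (rule exI[of _ c], intro ballI allI impI, rule main) auto
  qed
  have part2: "\<exists>c. \<forall>u0 \<in> frac_power_dom D A \<alpha>. \<forall>N::nat. 2 \<le> N \<longrightarrow>
           (let h = c\<^sub>1 * ln (real N) / real N
            in norm (u_n D A \<rho>\<^sub>0 \<phi> \<rho>\<^sub>1 T w n u0 t - u_nN D A \<rho>\<^sub>0 \<phi> \<rho>\<^sub>1 T w n u0 h N t)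
               \<le> c * (exp (- (pi * d1 \<rho>\<^sub>0 \<phi> \<rho>\<^sub>1 * real N / (c\<^sub>1 * ln (real N))))
                      + exp (- (c\<^sub>1 * t * aI \<rho>\<^sub>0 \<phi> \<rho>\<^sub>1 * real N / 2) - c\<^sub>1 * \<alpha> * ln (real N)))
                 * norm (frac_power D A \<alpha> u0))"
    if c1: "2 \<le> c\<^sub>1" and t: "0 < t" for c\<^sub>1 t
  proof -
    have t0: "0 \<le> t" using t by simp
    obtain C2 where C2: "0 \<le> C2" and disc: "\<forall>B C0 h N I. resolvent_symbol B C0 \<longrightarrow> 0 < h \<longrightarrow>
      ((\<lambda>x. scalar_integrand B t (of_real x)) has_integral I) UNIV \<longrightarrow>
      cmod (I - h * (\<Sum>k=-int N..int N. scalar_integrand B t (of_real (of_int k * h))))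
        \<le> C2 * C0 / (exp (2 * pi * \<Delta> / h) - 1) + tail_bound C0 t (real N * h)"
      using discretization_full[OF t0] by (elim exE conjE) (rule that)
    define x0 where "x0 = pi * d / c\<^sub>1"
    have x0: "0 < x0" using dpos c1 by (simp add: x0_def)
    define c where "c = C1 * (C2 / (1 - exp (- x0)) + L)"
    have q0: "0 \<le> C2 / (1 - exp (- x0))" using C2 x0 by simp
    have main: "norm (u_n D A \<rho>\<^sub>0 \<phi> \<rho>\<^sub>1 T w n u0 t - u_nN D A \<rho>\<^sub>0 \<phi> \<rho>\<^sub>1 T w n u0 h N t)
               \<le> c * (exp (- (pi * d * real N / (c\<^sub>1 * ln (real N))))
                      + exp (- (c\<^sub>1 * t * aI \<rho>\<^sub>0 \<phi> \<rho>\<^sub>1 * real N / 2) - c\<^sub>1 * \<alpha> * ln (real N)))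
                 * norm (frac_power D A \<alpha> u0)"
      if u0: "u0 \<in> frac_power_dom D A \<alpha>" and N: "2 \<le> N" and h_def: "h = c\<^sub>1 * ln (real N) / real N" for u0 N h
    proof -
      have lnN: "0 < ln (real N)" "ln (real N) \<le> real N" using N ln_bound[of "real N"] by auto
      have h: "0 < h" "h \<le> c\<^sub>1" using lnN c1 N by (auto simp: h_def field_simps)
      have Nh: "real N * h = c\<^sub>1 * ln (real N)" using N by (simp add: h_def)
      define P where "P = exp (- (pi * d * real N / (c\<^sub>1 * ln (real N))))"
      define Q where "Q = exp (- (c\<^sub>1 * t * aI \<rho>\<^sub>0 \<phi> \<rho>\<^sub>1 * real N / 2) - c\<^sub>1 * \<alpha> * ln (real N))"
      have PQ: "0 \<le> P" "0 \<le> Q" by (simp_all add: P_def Q_def)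
      have ex: "2 * pi * \<Delta> / h = pi * d * real N / (c\<^sub>1 * ln (real N))" by (simp add: Delta h_def)
      have t1: "C2 / (exp (2 * pi * \<Delta> / h) - 1) \<le> C2 / (1 - exp (- x0)) * P"
      proof -
        have "x0 \<le> pi * d / h" unfolding x0_def using h dpos by (intro divide_left_mono) auto
        then have "x0 \<le> 2 * pi * \<Delta> / h" by (simp add: Delta)
        from mult_left_mono[OF inverse_exp_minus_1_le[OF x0 this] C2] show ?thesis by (simp add: ex P_def)
      qed
      have t2: "tail_bound 1 t (real N * h) \<le> L * Q"
      proof -
        have "tail_bound 1 t (real N * h) = L * exp (- (R * cos \<beta> * cosh (real N * h) * t) - \<alpha> * (real N * h))"
          by (simp add: tail_bound_def L_def exp_diff exp_minus divide_inverse)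
        also have "\<dots> \<le> L * Q"
        proof (rule mult_left_mono[OF _ L])
          have "R * cos \<beta> * t * (c\<^sub>1 * real N / 2) \<le> R * cos \<beta> * t * cosh (c\<^sub>1 * ln (real N))"
            using R_pos cos_phi_pos t by (intro mult_left_mono cosh_ln_ge c1 N) auto
          then show "exp (- (R * cos \<beta> * cosh (real N * h) * t) - \<alpha> * (real N * h)) \<le> Q"
            unfolding Q_def Nh aI by (simp add: mult_ac)
        qed
        finally show ?thesis .
      qed
      have "norm (u_n D A \<rho>\<^sub>0 \<phi> \<rho>\<^sub>1 T w n u0 t - u_nN D A \<rho>\<^sub>0 \<phi> \<rho>\<^sub>1 T w n u0 h N t)
        \<le> C1 * norm (frac_power D A \<alpha> u0) * (C2 / (exp (2 * pi * \<Delta> / h) - 1) + tail_bound 1 t (real N * h))"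
        by (rule err[OF u0 t0 h(1)]) (rule disc[rule_format, OF _ h(1)])
      also have "\<dots> \<le> C1 * norm (frac_power D A \<alpha> u0) * ((C2 / (1 - exp (- x0)) + L) * (P + Q))"
      proof (rule mult_left_mono)
        have "C2 / (exp (2 * pi * \<Delta> / h) - 1) + tail_bound 1 t (real N * h) \<le> C2 / (1 - exp (- x0)) * P + L * Q"
          using t1 t2 by (rule add_mono)
        also have "\<dots> \<le> (C2 / (1 - exp (- x0)) + L) * (P + Q)"
          using mult_nonneg_nonneg[OF q0 PQ(2)] mult_nonneg_nonneg[OF L PQ(1)] by (simp add: distrib_left distrib_right)
        finally show "C2 / (exp (2 * pi * \<Delta> / h) - 1) + tail_bound 1 t (real N * h) \<le> (C2 / (1 - exp (- x0)) + L) * (P + Q)" .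
      qed (use C1 in simp)
      also have "\<dots> = c * (P + Q) * norm (frac_power D A \<alpha> u0)" by (simp add: c_def mult_ac)
      finally show ?thesis by (simp add: P_def Q_def)
    qed
    show ?thesis unfolding Let_def d_def[symmetric]
      by (rule exI[of _ c], intro ballI allI impI, rule main) auto
  qed
  show ?thesis
  proof (intro conjI allI impI)
    fix \<delta> assume "0 < \<delta> \<and> \<delta> < d1 \<rho>\<^sub>0 \<phi> \<rho>\<^sub>1"
    then show "\<exists>c. \<forall>u0 \<in> frac_power_dom D A \<alpha>. \<forall>N::nat. \<forall>t\<ge>0.
           let d = d1 \<rho>\<^sub>0 \<phi> \<rho>\<^sub>1 - \<delta>;
               h = sqrt (pi * d1 \<rho>\<^sub>0 \<phi> \<rho>\<^sub>1 / (\<alpha> * (real N + 1)))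
           in norm (u_n D A \<rho>\<^sub>0 \<phi> \<rho>\<^sub>1 T w n u0 t - u_nN D A \<rho>\<^sub>0 \<phi> \<rho>\<^sub>1 T w n u0 h N t)
              \<le> c / \<alpha> * exp (- sqrt (pi * d * \<alpha> * (real N + 1))) * norm (frac_power D A \<alpha> u0)"
      by (intro part1) (auto simp: d_def)
  next
    show "\<exists>c\<^sub>0>0. \<forall>c\<^sub>1\<ge>c\<^sub>0. \<forall>t>0.
        (\<exists>c. \<forall>u0 \<in> frac_power_dom D A \<alpha>. \<forall>N::nat. 2 \<le> N \<longrightarrow>
           (let h = c\<^sub>1 * ln (real N) / real N
            in norm (u_n D A \<rho>\<^sub>0 \<phi> \<rho>\<^sub>1 T w n u0 t - u_nN D A \<rho>\<^sub>0 \<phi> \<rho>\<^sub>1 T w n u0 h N t)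
               \<le> c * (exp (- (pi * d1 \<rho>\<^sub>0 \<phi> \<rho>\<^sub>1 * real N / (c\<^sub>1 * ln (real N))))
                      + exp (- (c\<^sub>1 * t * aI \<rho>\<^sub>0 \<phi> \<rho>\<^sub>1 * real N / 2) - c\<^sub>1 * \<alpha> * ln (real N)))
                 * norm (frac_power D A \<alpha> u0)))"
      by (rule exI[of _ 2], intro conjI allI impI zero_less_numeral part2)
  qed
qed

end
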